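(* For every $\Theta>0$ there exist real numbers $\lambda_1,\lambda_2$ with $\lambda_1\lambda_2\geq 0$ and $\lambda_1+\lambda_2>0$, and functions $u,v\in H^1(\mathbb{R}^3\times\mathbb{T})$ with $u>0$ and $v>0$, such that \[ \begin{cases} -\Delta_{x,y}u+\lambda_1 u=|u|^2u+u|v|^2 & \text{in } \mathbb{R}^3\times\mathbb{T},\\ -\Delta_{x,y}v+\lambda_2 v=|v|^2v+v|u|^2 & \text{in } \mathbb{R}^3\times\mathbb{T},\\ \int_{\mathbb{R}^3\times\mathbb{T}}u^2\,dx\,dy=\int_{\mathbb{R}^3\times\mathbb{T}}v^2\,dx\,dy=\Theta^2 . \end{cases} \]
   Context: $\mathbb{T}=\mathbb{R}/2\pi\mathbb{Z}$ is the one-dimensional torus of length $2\pi$; points of $\mathbb{R}^3\times\mathbb{T}$ are written $(x,y)$ with $x\in\mathbb{R}^3$, $y\in\mathbb{T}$, and $\Delta_{x,y}$ is the Laplacian in all four variables. Functions are real-valued and the equations are understood in the weak sense. *)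

theory Defs
  imports "HOL-Analysis.Analysis"
begin

text \<open>Points of R^3 x T are represented as pairs (x, y) :: real^3 \<times> real; functions on
  R^3 x T are functions on R^3 x R that are 2pi-periodic in y. Integrals over
  R^3 x T are integrals over the fundamental domain R^3 x [0, 2pi).\<close>

type_synonym pt = "(real^3) \<times> real"

definition Omega :: "pt set" where
  "Omega = UNIV \<times> {0..<2*pi}"

definition periodic_y :: "(pt \<Rightarrow> real) \<Rightarrow> bool" where
  "periodic_y f \<longleftrightarrow> (\<forall>x y. f (x, y + 2*pi) = f (x, y))"

definition pd :: "pt \<Rightarrow> (pt \<Rightarrow> real) \<Rightarrow> pt \<Rightarrow> real" where
  "pd b f z = deriv (\<lambda>t. f (z + t *\<^sub>R b)) 0"

fun pd_iter :: "pt list \<Rightarrow> (pt \<Rightarrow> real) \<Rightarrow> pt \<Rightarrow> real" where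
  "pd_iter [] f = f"
| "pd_iter (b # bs) f = pd b (pd_iter bs f)"

definition smooth :: "(pt \<Rightarrow> real) \<Rightarrow> bool" where
  "smooth f \<longleftrightarrow> (\<forall>bs. set bs \<subseteq> Basis \<longrightarrow>
      continuous_on UNIV (pd_iter bs f) \<and>
      (\<forall>b\<in>Basis. \<forall>z. (\<lambda>t. pd_iter bs f (z + t *\<^sub>R b)) differentiable (at 0)))"

definition test_fun :: "(pt \<Rightarrow> real) \<Rightarrow> bool" where
  "test_fun \<phi> \<longleftrightarrow> smooth \<phi> \<and> periodic_y \<phi> \<and>
      (\<exists>R. \<forall>x y. norm x > R \<longrightarrow> \<phi> (x, y) = 0)"

definition grad :: "(pt \<Rightarrow> real) \<Rightarrow> pt \<Rightarrow> pt" where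
  "grad \<phi> z = (\<Sum>b\<in>Basis. pd b \<phi> z *\<^sub>R b)"

definition L2 :: "(pt \<Rightarrow> real) \<Rightarrow> bool" where
  "L2 f \<longleftrightarrow> f measurable_on Omega \<and> (\<lambda>z. (f z)^2) integrable_on Omega"

definition weak_gradient :: "(pt \<Rightarrow> real) \<Rightarrow> (pt \<Rightarrow> pt) \<Rightarrow> bool" where
  "weak_gradient u G \<longleftrightarrow> (\<forall>b\<in>Basis. L2 (\<lambda>z. G z \<bullet> b)) \<and>
     (\<forall>\<phi>. test_fun \<phi> \<longrightarrow> (\<forall>b\<in>Basis.
        integral Omega (\<lambda>z. u z * pd b \<phi> z) = - integral Omega (\<lambda>z. (G z \<bullet> b) * \<phi> z)))"

definition H1 :: "(pt \<Rightarrow> real) \<Rightarrow> bool" where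
  "H1 u \<longleftrightarrow> periodic_y u \<and> L2 u \<and> (\<exists>G. weak_gradient u G)"

definition weak_solution :: "real \<Rightarrow> (pt \<Rightarrow> real) \<Rightarrow> (pt \<Rightarrow> real) \<Rightarrow> bool" where
  "weak_solution lam u f \<longleftrightarrow> (\<exists>G. weak_gradient u G \<and>
     (\<forall>\<phi>. test_fun \<phi> \<longrightarrow>
        integral Omega (\<lambda>z. G z \<bullet> grad \<phi> z + lam * u z * \<phi> z)
        = integral Omega (\<lambda>z. f z * \<phi> z)))"

end

theory Submission
  imports Defs "HOL-Complex_Analysis.Great_Picard" "HOL-Real_Asymp.Real_Asymp" "HOL-Probability.Sinc_Integral"
begin

text \<open>
  Take \<open>u = v\<close> independent of \<open>y\<close> and radial in \<open>x\<close>. If \<open>Q > 0\<close> solves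
  \<open>-Q'' - 2 Q' / r + Q = Q\<^sup>3\<close>, then \<open>u(x, y) = (\<kappa> / \<surd>2) Q(\<kappa> |x|)\<close> solves both equations with
  \<open>\<lambda>\<^sub>1 = \<lambda>\<^sub>2 = \<kappa>\<^sup>2\<close>, and its mass is a constant times \<open>1 / \<kappa>\<close>, so every mass is attained.

  For \<open>w = r Q\<close> the profile equation is \<open>w - w'' = w\<^sup>3 / r\<^sup>2\<close>, \<open>w(0) = 0\<close>. Writing
  \<open>1 - \<partial>\<^sup>2 = (1 - \<partial>)(1 + \<partial>)\<close> and \<open>h = w + w'\<close>, one maximises \<open>J(h) = \<integral> w\<^sup>4 / r\<^sup>2\<close> subject to
  \<open>\<integral> h\<^sup>2 \<le> 1\<close> over a compact class of functions with fixed decay and Lipschitz constants. Let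
  \<open>k\<close> be the \<open>L\<^sup>2\<close>-normalisation \<open>\<eta> / c\<close> of the decaying solution of \<open>\<eta> - \<eta>' = w\<^sup>3 / r\<^sup>2\<close>, and
  \<open>z + z' = k\<close>. The Cauchy-Schwarz and Young inequalities give
  \<open>J(h) \<le> c = \<integral> w\<^sup>3 z / r\<^sup>2 \<le> 3/4 J(h) + 1/4 J(k)\<close>. The constants can be chosen so that \<open>k\<close> is
  again in the class; at a maximiser equality holds throughout, whence \<open>z = w\<close>, and a rescaling
  of \<open>w\<close> solves the equation.
\<close>

section \<open>Integration on the half-line\<close>

text \<open>Up to a factor, and formally, \<open>\<integral> h^2\<close> is the H^1 norm squared of
  the radial function \<open>Q\<close> on R^3: the cross term \<open>2 w w'\<close> is a total
  derivative, and so is the difference between \<open>w'^2\<close> and \<open>r^2 Q'^2\<close>. The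
  functional is thus a Sobolev quotient. Decay and Lipschitz bounds replace a compact embedding, but
  a maximiser under pointwise constraints need not satisfy an Euler-Lagrange equation, since the
  constraints may be active. The power step avoids variations altogether. The obstacle is that this
  step must preserve the class although the cubic term is built from its members. The energy bound
  alone gives \<open>w <= 1\<close> and \<open>w <= sqrt r\<close>, hence a bound on
  \<open>\<eta>\<close> that is free of \<open>M\<close> and \<open>L\<close>. There is then no
  circularity: \<open>j\<close> is the value at the fixed competitor \<open>exp (-t)\<close>,
  \<open>M\<close> is chosen from \<open>j\<close>, and \<open>L\<close> from \<open>j\<close> and
  \<open>M\<close>. Regularity of \<open>Q\<close> at the origin is never established: bounded first
  and second derivatives off the null set \<open>x = 0\<close> are enough for the weak
  formulation.\<close>

definition rho :: "real \<Rightarrow> real" where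
  "rho t = 1 / (4 + t\<^sup>2)"

lemma rho_pos [simp]: "0 < rho t"
  by (simp add: rho_def add_pos_nonneg)

lemma rho_nonneg [simp]: "0 \<le> rho t"
  by (simp add: less_imp_le)

lemma rho_le_quarter: "rho t \<le> 1/4"
  by (simp add: rho_def field_simps add_pos_nonneg)

lemma square_mult_rho_le: "t\<^sup>2 * rho t \<le> 1"
  by (simp add: rho_def field_simps add_pos_nonneg)

lemma continuous_on_rho [continuous_intros]: "continuous_on S rho"
proof -
  have "4 + t\<^sup>2 \<noteq> 0" for t :: real
    by (metis add_pos_nonneg less_numeral_extra(3) zero_le_power2 zero_less_numeral)
  then show ?thesis
    unfolding rho_def by (intro continuous_intros) auto
qed

lemma rho_has_derivative:
  "(rho has_real_derivative - (2 * t * (rho t)\<^sup>2)) (at t within S)"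
proof -
  have "4 + t\<^sup>2 \<noteq> 0"
    by (metis add_pos_nonneg less_numeral_extra(3) zero_le_power2 zero_less_numeral)
  then show ?thesis
    unfolding rho_def [abs_def]
    by (auto intro!: derivative_eq_intros simp: rho_def field_simps power2_eq_square)
qed

lemma rho_integrable: "rho integrable_on {0..}"
proof -
  have der: "((\<lambda>t. arctan (t/2) / 2) has_real_derivative rho t) (at t within S)" for t S
  proof -
    have "4 + t\<^sup>2 \<noteq> 0"
      by (metis add_pos_nonneg less_numeral_extra(3) zero_le_power2 zero_less_numeral)
    then show ?thesis
      by (auto intro!: derivative_eq_intros simp: rho_def field_simps power2_eq_square)
  qed
  have int: "(rho has_integral (arctan (y/2) / 2 - arctan (0/2) / 2)) {0..y}" if "0 \<le> y" for y
    using that by (intro fundamental_theorem_of_calculus)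
      (auto simp: der simp flip: has_real_derivative_iff_has_vector_derivative)
  have "((\<lambda>y. arctan (y/2) / 2) \<longlongrightarrow> (pi/2) / 2) at_top"
    by (intro tendsto_divide tendsto_const filterlim_compose[OF tendsto_arctan_at_top]
        filterlim_at_top_mult_tendsto_pos[where c="1/2" and f="\<lambda>x. 1/2" and g="\<lambda>x. x", simplified]
        filterlim_ident) auto
  moreover have "\<forall>\<^sub>F y in at_top. arctan (y/2) / 2 = integral {0..y} rho"
  proof (rule eventually_mono[OF eventually_ge_at_top[of 0]])
    show "arctan (y/2) / 2 = integral {0..y} rho" if "0 \<le> y" for y
      using integral_unique[OF int[OF that]] by simp
  qed
  ultimately have "((\<lambda>y. integral {0..y} rho) \<longlongrightarrow> (pi/2) / 2) at_top"
    by (rule Lim_transform_eventually)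
  then have "(rho has_integral (pi/2)/2) {0..}"
    by (intro has_integral_to_inf integrable_continuous_interval continuous_intros) auto
  then show ?thesis by blast
qed

lemma integrable_halfline_of_continuous:
  assumes "continuous_on {0..} g" and "\<And>t. 0 \<le> t \<Longrightarrow> \<bar>g t\<bar> \<le> C * rho t"
  shows "g integrable_on {0..}"
proof (rule measurable_bounded_by_integrable_imp_integrable)
  show "g \<in> borel_measurable (lebesgue_on {0..})"
    by (intro continuous_imp_measurable_on_sets_lebesgue assms) auto
  show "(\<lambda>t. C * rho t) integrable_on {0..}"
    by (intro integrable_on_mult_right rho_integrable)
qed (use assms(2) in auto)

lemma integral_halfline_tendsto:
  assumes "continuous_on {0..} g" and "\<And>t. 0 \<le> t \<Longrightarrow> \<bar>g t\<bar> \<le> C * rho t"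
  shows "(\<lambda>n. integral {0..real n} g) \<longlonglongrightarrow> integral {0..} g"
proof -
  have "(\<lambda>n. integral {0..} (\<lambda>t. if t \<in> {0..real n} then g t else 0)) \<longlonglongrightarrow> integral {0..} g"
  proof (rule dominated_convergence)
    show "(\<lambda>t. C * rho t) integrable_on {0..}"
      by (intro integrable_on_mult_right rho_integrable)
    show "(\<lambda>t. if t \<in> {0..real n} then g t else 0) integrable_on {0..}" for n
    proof -
      have "g integrable_on {0..real n}"
        by (intro integrable_continuous_interval continuous_on_subset[OF assms(1)]) auto
      moreover have "{0..real n} \<inter> {0..} = {0..real n}" by auto
      ultimately show ?thesis
        by (simp only: integrable_restrict_Int)
    qed
    show "norm (if t \<in> {0..real n} then g t else 0) \<le> C * rho t" if "t \<in> {0..}" for n t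
    proof -
      have "0 \<le> C * rho t" using assms(2)[of t] that by (meson abs_ge_zero atLeast_iff order_trans)
      then show ?thesis using assms(2)[of t] that by auto
    qed
    show "(\<lambda>n. if t \<in> {0..real n} then g t else 0) \<longlonglongrightarrow> g t" if "t \<in> {0..}" for t
    proof (rule tendsto_eventually)
      obtain N where "t \<le> real N" using real_arch_simple by blast
      then show "\<forall>\<^sub>F n in sequentially. (if t \<in> {0..real n} then g t else 0) = g t"
        using that by (intro eventually_sequentiallyI[of N]) auto
    qed
  qed
  moreover have "integral {0..} (\<lambda>t. if t \<in> {0..real n} then g t else 0) = integral {0..real n} g" for n
  proof -
    have "{0..real n} \<inter> {0..} = {0..real n}" by auto
    then show ?thesis by (simp only: integral_restrict_Int)
  qed
  ultimately show ?thesis by simp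
qed

lemma halfline_FTC:
  assumes "continuous_on {0..} g" and "\<And>t. 0 \<le> t \<Longrightarrow> \<bar>g t\<bar> \<le> C * rho t"
    and der: "\<And>t. 0 \<le> t \<Longrightarrow> (F has_real_derivative g t) (at t within {0..})"
    and lim: "(\<lambda>n. F (real n)) \<longlonglongrightarrow> 0"
  shows "integral {0..} g = - F 0"
proof -
  have "integral {0..real n} g = F (real n) - F 0" for n
  proof (rule integral_unique, rule fundamental_theorem_of_calculus)
    fix t :: real assume t: "t \<in> {0..real n}"
    then have "(F has_real_derivative g t) (at t within {0..real n})"
      by (intro DERIV_subset[OF der]) auto
    then show "(F has_vector_derivative g t) (at t within {0..real n})"
      by (simp add: has_real_derivative_iff_has_vector_derivative)
  qed auto
  then have "(\<lambda>n. F (real n) - F 0) \<longlonglongrightarrow> integral {0..} g"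
    using integral_halfline_tendsto[OF assms(1,2)] by simp
  moreover have "(\<lambda>n. F (real n) - F 0) \<longlonglongrightarrow> 0 - F 0"
    by (intro tendsto_intros lim)
  ultimately show ?thesis
    using LIMSEQ_unique by fastforce
qed

section \<open>One-sided calculus on the closed half-line\<close>

lemma at_within_halfline: "0 < (t::real) \<Longrightarrow> at t within {0..} = at t"
  by (rule at_within_open_subset[of _ "{0<..}"]) auto

lemma at_within_halfline_Icc: "0 \<le> (t::real) \<Longrightarrow> at t within {0..t+1} = at t within {0..}"
  by (rule at_within_nhd[of _ "{..<t+1}"]) auto

lemma continuous_on_halfline_derivative:
  assumes "\<And>t. 0 \<le> t \<Longrightarrow> (F has_real_derivative g t) (at t within {0..})"
  shows "continuous_on {0..} F"
  by (rule DERIV_continuous_on[where D=g]) (simp add: assms)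

text \<open>The comparison principle behind most pointwise bounds below: an auxiliary function is
  monotone by the sign of its derivative. The sign is asked for only on the open interval, which
  keeps the endpoint 0 out of the estimates.\<close>

lemma mono_halfline:
  assumes der: "\<And>t. 0 \<le> t \<Longrightarrow> (F has_real_derivative g t) (at t within {0..})"
    and "\<And>t. a < t \<Longrightarrow> t < b \<Longrightarrow> 0 \<le> g t" and "0 \<le> a" "a \<le> b"
  shows "F a \<le> F (b::real)"
proof (rule DERIV_nonneg_imp_increasing_open[of a b F])
  show "continuous_on {a..b} F"
    using continuous_on_halfline_derivative[OF der] assms by (auto elim!: continuous_on_subset)
  show "\<exists>y. (F has_real_derivative y) (at x) \<and> 0 \<le> y" if "a < x" "x < b" for x
  proof (intro exI conjI)
    show "(F has_real_derivative g x) (at x)"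
      using der[of x] at_within_halfline[of x] \<open>0 \<le> a\<close> that by simp
    show "0 \<le> g x" using assms(2) that .
  qed
qed fact

lemma lipschitz_halfline:
  assumes der: "\<And>t. 0 \<le> t \<Longrightarrow> (F has_real_derivative g t) (at t within {0..})"
    and "\<And>t. 0 \<le> t \<Longrightarrow> \<bar>g t\<bar> \<le> L" and "0 \<le> s" "0 \<le> t"
  shows "\<bar>F s - F t\<bar> \<le> L * \<bar>s - (t::real)\<bar>"
  using field_differentiable_bound[of "{0..}" F g L s t] assms by auto

text \<open>Converts equality of integrals into equality of functions; its main application is to
  the nonnegative deficit in Young's inequality at a maximiser.\<close>

lemma integral_zero_halfline:
  fixes g :: "real \<Rightarrow> real"
  assumes cont: "continuous_on {0..} g" and nonneg: "\<And>t. 0 \<le> t \<Longrightarrow> 0 \<le> g t"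
    and ig: "g integrable_on {0..}" "integral {0..} g \<le> 0" and "0 \<le> x"
  shows "g x = 0"
proof (rule has_integral_0_cbox_imp_0[of 0 "x+1" g])
  show c: "continuous_on (cbox 0 (x+1)) g"
    using cont by (rule continuous_on_subset) auto
  then have int: "g integrable_on {0..x+1}"
    using integrable_continuous_interval by simp
  have "integral {0..x+1} g \<le> integral {0..} g"
    by (rule integral_subset_le[OF _ int ig(1)]) (simp_all add: nonneg)
  moreover have "0 \<le> integral {0..x+1} g"
    by (rule integral_nonneg[OF int]) (simp add: nonneg)
  ultimately have "integral {0..x+1} g = 0"
    using ig(2) by linarith
  then show "(g has_integral 0) (cbox 0 (x+1))"
    using int by (metis box_real(2) has_integral_integral)
  show "box 0 (x+1) \<noteq> {}" "x \<in> cbox 0 (x+1)"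
    using \<open>0 \<le> x\<close> by auto
  show "0 \<le> g y" if "y \<in> box 0 (x+1)" for y
    using that by (simp add: nonneg)
qed

section \<open>The first-order factors of \<open>1 - \<partial>\<^sup>2\<close>\<close>

text \<open>\<open>fwd h\<close> solves \<open>w' + w = h\<close>, \<open>w 0 = 0\<close>, and \<open>bwd f\<close> is the decaying solution of
  \<open>\<eta> - \<eta>' = f\<close>; thus \<open>fwd (bwd f)\<close> solves \<open>w - w'' = f\<close>, and the two operators are adjoint
  in \<open>L\<^sup>2(0, \<infinity>)\<close>.\<close>
definition fwd :: "(real \<Rightarrow> real) \<Rightarrow> real \<Rightarrow> real" where
  "fwd h r = exp (- r) * integral {0..r} (\<lambda>t. exp t * h t)"

definition bwd :: "(real \<Rightarrow> real) \<Rightarrow> real \<Rightarrow> real" where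
  "bwd f t = exp t * (integral {0..} (\<lambda>s. exp (- s) * f s) - integral {0..t} (\<lambda>s. exp (- s) * f s))"

lemma integral_halfline_has_derivative:
  fixes g :: "real \<Rightarrow> real"
  assumes "continuous_on {0..} g" "0 \<le> t"
  shows "((\<lambda>t. integral {0..t} g) has_real_derivative g t) (at t within {0..})"
proof -
  have "((\<lambda>t. integral {0..t} g) has_real_derivative g t) (at t within {0..t+1})"
    using assms by (intro integral_has_real_derivative continuous_on_subset[OF assms(1)]) auto
  then show ?thesis
    using at_within_halfline_Icc[OF \<open>0 \<le> t\<close>] by simp
qed

lemma fwd_0 [simp]: "fwd h 0 = 0"
  by (simp add: fwd_def)

lemma fwd_has_derivative:
  assumes "continuous_on {0..} h" "0 \<le> r"
  shows "(fwd h has_real_derivative h r - fwd h r) (at r within {0..})"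
proof -
  have "((\<lambda>r. integral {0..r} (\<lambda>t. exp t * h t)) has_real_derivative exp r * h r) (at r within {0..})"
    by (intro integral_halfline_has_derivative continuous_intros assms)
  note * = this
  show ?thesis
    unfolding fwd_def[abs_def]
    by (rule derivative_eq_intros refl *)+ (simp add: exp_minus field_simps)
qed

lemma continuous_on_fwd: "continuous_on {0..} h \<Longrightarrow> continuous_on {0..} (fwd h)"
  by (rule continuous_on_halfline_derivative[OF fwd_has_derivative])

lemma fwd_nonneg:
  assumes "continuous_on {0..} h" "\<And>t. 0 \<le> t \<Longrightarrow> 0 \<le> h t" "0 \<le> r"
  shows "0 \<le> fwd h r"
  unfolding fwd_def
proof (intro mult_nonneg_nonneg integral_nonneg integrable_continuous_interval continuous_intros)
  show "continuous_on {0..r} h"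
    using assms(1) by (rule continuous_on_subset) auto
qed (use assms in auto)

text \<open>The derivative \<open>h - fwd h\<close> is at most \<open>M\<close> because
  \<open>fwd h\<close> is nonnegative. For \<open>w = r Q\<close> this is boundedness of
  \<open>Q\<close> near the origin.\<close>

lemma fwd_le_linear:
  assumes "continuous_on {0..} h" "\<And>t. 0 \<le> t \<Longrightarrow> 0 \<le> h t" "\<And>t. 0 \<le> t \<Longrightarrow> h t \<le> M" "0 \<le> r"
  shows "fwd h r \<le> M * r"
proof -
  have "M * 0 - fwd h 0 \<le> M * r - fwd h r"
  proof (rule mono_halfline[where F="\<lambda>t. M * t - fwd h t" and g="\<lambda>t. M - (h t - fwd h t)"])
    show "((\<lambda>t. M * t - fwd h t) has_real_derivative M - (h t - fwd h t)) (at t within {0..})"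
      if "0 \<le> t" for t
      using fwd_has_derivative[OF assms(1) that] by (auto intro!: derivative_eq_intros)
    show "0 \<le> M - (h t - fwd h t)" if "0 < t" for t
      using assms(3)[of t] fwd_nonneg[OF assms(1,2), of t] that by simp
  qed (use assms in auto)
  then show ?thesis by simp
qed

text \<open>The weight is chosen so that \<open>2 (\<rho>' + \<rho>) \<ge> \<rho>\<close>.\<close>
lemma fwd_le_rho:
  assumes "continuous_on {0..} h" "\<And>t. 0 \<le> t \<Longrightarrow> 0 \<le> h t" "\<And>t. 0 \<le> t \<Longrightarrow> h t \<le> M * rho t" "0 \<le> r"
  shows "fwd h r \<le> 2 * M * rho r"
proof -
  have "0 \<le> M * rho 0" using assms(2,3)[of 0] by simp
  then have "0 \<le> M" by (simp add: rho_def)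
  \<comment> \<open>This amounts to \<open>(t - 2)^2 >= 0\<close>: with the constant 4 in
    \<open>rho\<close>, the logarithmic derivative of \<open>rho\<close> never falls below
    -1/2.\<close>
  have key: "rho t \<le> 2 * (rho t - 2 * t * (rho t)\<^sup>2)" for t
  proof -
    have "0 < 4 + t\<^sup>2" by (simp add: add_pos_nonneg)
    moreover have "t * 4 \<le> t * t + 4" using zero_le_power2[of "t - 2"] by (simp add: power2_eq_square algebra_simps)
    ultimately show ?thesis
      by (simp add: rho_def power2_eq_square divide_simps) (simp add: algebra_simps)?
  qed
  \<comment> \<open>The integrating factor \<open>exp t\<close> removes the undifferentiated
    \<open>fwd h\<close> from the derivative of the gap.\<close>
  have "exp 0 * (2 * M * rho 0 - fwd h 0) \<le> exp r * (2 * M * rho r - fwd h r)"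
  proof (rule mono_halfline[where F="\<lambda>t. exp t * (2 * M * rho t - fwd h t)" and g="\<lambda>t. exp t * (2 * M * (rho t - 2 * t * (rho t)\<^sup>2) - h t)"])
    show "((\<lambda>t. exp t * (2 * M * rho t - fwd h t)) has_real_derivative
        exp t * (2 * M * (rho t - 2 * t * (rho t)\<^sup>2) - h t)) (at t within {0..})" if "0 \<le> t" for t
      by (rule derivative_eq_intros refl rho_has_derivative fwd_has_derivative assms that)+
        (simp add: algebra_simps)
    show "0 \<le> exp t * (2 * M * (rho t - 2 * t * (rho t)\<^sup>2) - h t)" if "0 < t" for t
    proof -
      have "h t \<le> M * rho t" using assms(3) that by simp
      also have "\<dots> \<le> M * (2 * (rho t - 2 * t * (rho t)\<^sup>2))"
        using key \<open>0 \<le> M\<close> by (intro mult_left_mono) auto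
      finally show ?thesis by (intro mult_nonneg_nonneg) (simp_all only: mult.assoc mult.left_commute exp_ge_zero diff_ge_0_iff_ge)
    qed
  qed (use assms in auto)
  moreover have "0 \<le> exp 0 * (2 * M * rho 0 - fwd h 0)"
    using \<open>0 \<le> M\<close> by simp
  ultimately have "0 \<le> exp r * (2 * M * rho r - fwd h r)" by linarith
  then show ?thesis by (simp add: zero_le_mult_iff)
qed

text \<open>Both bounds come from the energy alone and contain no pointwise constant of
  \<open>h\<close>. The first is strong near 0, the second at infinity; together they control
  \<open>w^3 / r^2\<close> uniformly over the class.\<close>

lemma fwd_le_sqrt_and_one:
  assumes cont: "continuous_on {0..} h" and nn: "\<And>t. 0 \<le> t \<Longrightarrow> 0 \<le> h t"
    and "(\<lambda>t. (h t)\<^sup>2) integrable_on {0..}" and "integral {0..} (\<lambda>t. (h t)\<^sup>2) \<le> 1" and "0 \<le> r"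
  shows "fwd h r \<le> sqrt r" "fwd h r \<le> 1"
proof -
  define N where "N = (\<lambda>r. integral {0..r} (\<lambda>t. (h t)\<^sup>2))"
  have c2: "continuous_on {0..} (\<lambda>t. (h t)\<^sup>2)" by (intro continuous_intros cont)
  have Nder: "(N has_real_derivative (h t)\<^sup>2) (at t within {0..})" if "0 \<le> t" for t
    unfolding N_def by (rule integral_halfline_has_derivative[OF c2 that])
  have "(\<lambda>t. (h t)\<^sup>2) integrable_on {0..r}"
    using c2 by (intro integrable_continuous_interval) (auto elim!: continuous_on_subset)
  then have "N r \<le> integral {0..} (\<lambda>t. (h t)\<^sup>2)"
    unfolding N_def by (intro integral_subset_le) (use assms in auto)
  then have N1: "N r \<le> 1" using assms by simp
  have N0: "N 0 = 0" by (simp add: N_def)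
  \<comment> \<open>Completing the square gives
    \<open>(w^2)' = 2 w (h - w) <= h^2 / 2\<close>.\<close>
  have "1/2 * N 0 - (fwd h 0)\<^sup>2 \<le> 1/2 * N r - (fwd h r)\<^sup>2"
  proof (rule mono_halfline[where F="\<lambda>t. 1/2 * N t - (fwd h t)\<^sup>2" and g="\<lambda>t. (h t)\<^sup>2 / 2 - 2 * fwd h t * (h t - fwd h t)"])
    show "((\<lambda>t. 1/2 * N t - (fwd h t)\<^sup>2) has_real_derivative
        (h t)\<^sup>2 / 2 - 2 * fwd h t * (h t - fwd h t)) (at t within {0..})" if "0 \<le> t" for t
      by (rule derivative_eq_intros refl Nder fwd_has_derivative cont that)+ simp
    show "0 \<le> (h t)\<^sup>2 / 2 - 2 * fwd h t * (h t - fwd h t)" for t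
    proof -
      have "(h t)\<^sup>2 / 2 - 2 * fwd h t * (h t - fwd h t) = 2 * (h t / 2 - fwd h t)\<^sup>2"
        by (simp add: power2_eq_square algebra_simps)
      then show ?thesis by simp
    qed
  qed (use assms in auto)
  then have "(fwd h r)\<^sup>2 \<le> 1\<^sup>2" using N0 N1 by simp
  then show "fwd h r \<le> 1" by (rule power2_le_imp_le) simp
  show "fwd h r \<le> sqrt r"
  proof (cases "r = 0")
    case False
    \<comment> \<open>In \<open>h <= q/2 * h^2 + 1/(2q)\<close>, integrated over
      \<open>[0, r]\<close>, the weight \<open>q = sqrt r\<close> balances the two contributions
      \<open>q/2\<close> and \<open>r/(2q)\<close>.\<close>
    define q where "q = sqrt r"
    have q: "0 < q" "q * q = r" using False \<open>0 \<le> r\<close> by (auto simp: q_def)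
    have "q / 2 * N 0 + 1 / (2 * q) * 0 - fwd h 0 \<le> q / 2 * N r + 1 / (2 * q) * r - fwd h r"
    proof (rule mono_halfline[where F="\<lambda>t. q / 2 * N t + 1 / (2 * q) * t - fwd h t" and g="\<lambda>t. q / 2 * (h t)\<^sup>2 + 1 / (2 * q) - (h t - fwd h t)"])
      show "((\<lambda>t. q / 2 * N t + 1 / (2 * q) * t - fwd h t) has_real_derivative
          q / 2 * (h t)\<^sup>2 + 1 / (2 * q) - (h t - fwd h t)) (at t within {0..})" if "0 \<le> t" for t
        by (rule derivative_eq_intros refl Nder fwd_has_derivative cont that)+
          (use q in \<open>simp add: power2_eq_square divide_simps\<close>)
      show "0 \<le> q / 2 * (h t)\<^sup>2 + 1 / (2 * q) - (h t - fwd h t)" if "0 < t" for t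
      proof -
        have "q / 2 * (h t)\<^sup>2 + 1 / (2 * q) - h t = (q * h t - 1)\<^sup>2 / (2 * q)"
          using q by (simp add: power2_eq_square divide_simps) (simp add: algebra_simps)
        also have "\<dots> \<ge> 0" using q by simp
        finally show ?thesis using fwd_nonneg[OF cont nn, of t] that by simp
      qed
    qed (use assms in auto)
    then have "fwd h r \<le> q / 2 * N r + r / (2 * q)" using N0 by simp
    also have "\<dots> \<le> q / 2 * 1 + r / (2 * q)" using N1 q by (intro add_mono mult_left_mono) auto
    also have "\<dots> = q" using q by (auto simp: field_simps)
    finally show ?thesis by (simp add: q_def)
  qed simp
qed

lemma bwd_has_derivative:
  assumes "continuous_on {0..} f" "0 \<le> t"
  shows "(bwd f has_real_derivative bwd f t - f t) (at t within {0..})"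
proof -
  have *: "((\<lambda>r. integral {0..r} (\<lambda>t. exp (-t) * f t)) has_real_derivative exp (-t) * f t) (at t within {0..})"
    by (intro integral_halfline_has_derivative continuous_intros assms)
  show ?thesis
    unfolding bwd_def[abs_def]
    by (rule derivative_eq_intros refl *)+ (simp add: exp_minus field_simps)
qed

lemma continuous_on_bwd: "continuous_on {0..} f \<Longrightarrow> continuous_on {0..} (bwd f)"
  by (rule continuous_on_halfline_derivative[OF bwd_has_derivative])

section \<open>Bounds for the backward operator and its duality with the forward one\<close>

context
  fixes f :: "real \<Rightarrow> real" and D :: real
  assumes cf: "continuous_on {0..} f" and f0: "\<And>t. 0 \<le> t \<Longrightarrow> 0 \<le> f t"
    and fD: "\<And>t. 0 \<le> t \<Longrightarrow> f t \<le> D * rho t"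
begin

lemma exp_weighted_bound: "0 \<le> t \<Longrightarrow> \<bar>exp (- t) * f t\<bar> \<le> D * rho t"
proof -
  assume t: "0 \<le> t"
  then have "exp (-t) * f t \<le> 1 * f t" by (intro mult_right_mono f0) auto
  then show ?thesis using f0[OF t] fD[OF t] by auto
qed

lemma bwd_nonneg: "0 \<le> t \<Longrightarrow> 0 \<le> bwd f t"
proof -
  assume t: "0 \<le> t"
  have c: "continuous_on {0..} (\<lambda>s. exp (- s) * f s)" by (intro continuous_intros cf)
  have "integral {0..t} (\<lambda>s. exp (- s) * f s) \<le> integral {0..} (\<lambda>s. exp (- s) * f s)"
  proof (rule integral_subset_le)
    show "(\<lambda>s. exp (- s) * f s) integrable_on {0..t}"
      using c by (intro integrable_continuous_interval) (auto elim!: continuous_on_subset)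
    show "(\<lambda>s. exp (- s) * f s) integrable_on {0..}"
      using exp_weighted_bound by (intro integrable_halfline_of_continuous[OF c])
  qed (use f0 in auto)
  then show ?thesis by (simp add: bwd_def)
qed

text \<open>\<open>bwd f t\<close> is the integral of \<open>exp (t - s) * f s\<close> over
  \<open>s >= t\<close>, so only values of \<open>f\<close> beyond \<open>t\<close> enter, and
  \<open>rho\<close> decreases there. The constant \<open>D\<close> secures convergence, whereas the
  result carries \<open>K\<close>; hence a bound on \<open>f\<close> beyond \<open>a\<close> that is
  free of \<open>M\<close> gives a bound on \<open>bwd f\<close> free of \<open>M\<close>.\<close>

lemma bwd_le_rho:
  assumes "0 \<le> a" "\<And>t. a \<le> t \<Longrightarrow> f t \<le> K * rho t" "a \<le> t" 
  shows "bwd f t \<le> K * rho t"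
proof -
  have "0 \<le> K * rho a" using f0[of a] assms(1) assms(2)[of a] by simp
  then have K: "0 \<le> K" by (smt (verit) mult_neg_pos rho_pos)
  let ?g = "\<lambda>s. exp (- s) * f s"
  \<comment> \<open>This is \<open>exp (-t) * (bwd f t - K * rho t)\<close>. It increases beyond
    \<open>a\<close> and tends to 0, so it is nonpositive there.\<close>
  define F where "F = (\<lambda>t. integral {0..} ?g - integral {0..t} ?g - K * (exp (-t) * rho t))"
  have c: "continuous_on {0..} ?g" by (intro continuous_intros cf)
  have lim: "(\<lambda>n. integral {0..real n} ?g) \<longlonglongrightarrow> integral {0..} ?g"
    using exp_weighted_bound by (intro integral_halfline_tendsto[OF c])
  have "(\<lambda>n. integral {0..} ?g - integral {0..real n} ?g - K * (exp (- real n) * rho (real n)))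
      \<longlonglongrightarrow> integral {0..} ?g - integral {0..} ?g - K * 0"
  proof (intro tendsto_intros lim)
    have e: "(\<lambda>n. exp (- real n)) \<longlonglongrightarrow> 0"
      by (rule filterlim_compose[OF exp_at_bot]) 
        (simp add: filterlim_uminus_at_top[symmetric] filterlim_real_sequentially filterlim_uminus_at_bot)
    show "(\<lambda>n. exp (- real n) * rho (real n)) \<longlonglongrightarrow> 0"
    proof (rule Lim_null_comparison[OF _ e])
      show "\<forall>\<^sub>F n in sequentially. norm (exp (- real n) * rho (real n)) \<le> exp (- real n)"
        by (intro always_eventually allI) (simp add: mult_left_le order_trans[OF rho_le_quarter])
    qed
  qed
  then have "(\<lambda>n. F (real n)) \<longlonglongrightarrow> 0" by (simp add: F_def)
  moreover have "\<forall>\<^sub>F n in sequentially. F t \<le> F (real n)"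
  proof -
    obtain N where "t \<le> real N" using real_arch_simple by blast
    have "F t \<le> F (real n)" if "N \<le> n" for n
    proof (rule mono_halfline[where F=F and g="\<lambda>t. exp (-t) * (K * (rho t + 2 * t * (rho t)\<^sup>2) - f t)"])
      show "(F has_real_derivative exp (-t) * (K * (rho t + 2 * t * (rho t)\<^sup>2) - f t)) (at t within {0..})"
        if "0 \<le> t" for t
        unfolding F_def
        by (rule derivative_eq_intros refl integral_halfline_has_derivative c that rho_has_derivative)+
          (simp add: algebra_simps)
      show "0 \<le> exp (-s) * (K * (rho s + 2 * s * (rho s)\<^sup>2) - f s)" if "t < s" for s
      proof -
        have "f s \<le> K * rho s" using that assms by simp
        also have "\<dots> \<le> K * (rho s + 2 * s * (rho s)\<^sup>2)"
          using that assms K by (intro mult_left_mono) auto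
        finally show ?thesis by simp
      qed
      show "0 \<le> t" "t \<le> real n" using assms \<open>t \<le> real N\<close> that by auto
    qed
    then show ?thesis by (intro eventually_sequentiallyI)
  qed
  ultimately have "F t \<le> 0"
    using tendsto_lowerbound trivial_limit_sequentially by blast
  then have "exp t * (integral {0..} ?g - integral {0..t} ?g) \<le> exp t * (K * (exp (-t) * rho t))"
    by (simp add: F_def)
  then show ?thesis by (simp add: bwd_def exp_minus field_simps)
qed

text \<open>The derivative of \<open>fwd h * bwd f\<close> is \<open>h * bwd f - fwd h * f\<close>,
  since the mixed terms cancel; the boundary terms vanish because \<open>fwd h 0 = 0\<close> and
  both factors decay.\<close>

lemma fwd_bwd_adjoint:
  assumes ch: "continuous_on {0..} h" and h0: "\<And>t. 0 \<le> t \<Longrightarrow> 0 \<le> h t"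
    and hM: "\<And>t. 0 \<le> t \<Longrightarrow> h t \<le> M * rho t"
  shows "integral {0..} (\<lambda>t. h t * bwd f t) = integral {0..} (\<lambda>t. fwd h t * f t)"
proof -
  have DM: "0 \<le> D" "0 \<le> M"
    using f0[of 0] fD[of 0] h0[of 0] hM[of 0] by (auto simp: rho_def)
  have bD: "bwd f t \<le> D * rho t" if "0 \<le> t" for t
    using fD that by (intro bwd_le_rho[of 0]) auto
  note b0 = bwd_nonneg
  note w0 = fwd_nonneg[OF ch h0]
  have wM: "fwd h t \<le> 2 * M * rho t" if "0 \<le> t" for t
    by (rule fwd_le_rho[OF ch h0 hM that])
  have rr: "rho t * rho t \<le> rho t" for t
    using rho_le_quarter[of t] by (intro mult_left_le) auto
  have hb: "\<bar>h t * bwd f t\<bar> \<le> M * D * rho t" if "0 \<le> t" for t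
  proof -
    have "h t * bwd f t \<le> (M * rho t) * (D * rho t)"
      using h0 hM b0 bD that DM by (intro mult_mono) auto
    also have "\<dots> = M * D * (rho t * rho t)" by simp
    also have "\<dots> \<le> M * D * rho t" using DM rr by (intro mult_left_mono) auto
    finally show ?thesis using h0 b0 that by simp
  qed
  have wf: "\<bar>fwd h t * f t\<bar> \<le> 2 * M * D * rho t" if "0 \<le> t" for t
  proof -
    have "fwd h t * f t \<le> (2 * M * rho t) * (D * rho t)"
      using w0 wM f0 fD that DM by (intro mult_mono) auto
    also have "\<dots> = 2 * M * D * (rho t * rho t)" by simp
    also have "\<dots> \<le> 2 * M * D * rho t" using DM rr by (intro mult_left_mono) auto
    finally show ?thesis using w0 f0 that by simp
  qed
  have wb: "\<bar>fwd h t * bwd f t\<bar> \<le> 2 * M * D * rho t" if "0 \<le> t" for t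
  proof -
    have "fwd h t * bwd f t \<le> (2 * M * rho t) * (D * rho t)"
      using w0 wM b0 bD that DM by (intro mult_mono) auto
    also have "\<dots> = 2 * M * D * (rho t * rho t)" by simp
    also have "\<dots> \<le> 2 * M * D * rho t" using DM rr by (intro mult_left_mono) auto
    finally show ?thesis using w0 b0 that by simp
  qed
  have c1: "continuous_on {0..} (\<lambda>t. h t * bwd f t)"
    by (intro continuous_intros ch cf continuous_on_bwd)
  have c2: "continuous_on {0..} (\<lambda>t. fwd h t * f t)"
    by (intro continuous_intros ch cf continuous_on_fwd)
  have "integral {0..} (\<lambda>t. h t * bwd f t - fwd h t * f t) = - (fwd h 0 * bwd f 0)"
  proof (rule halfline_FTC[where C="3 * M * D"])
    show "\<bar>h t * bwd f t - fwd h t * f t\<bar> \<le> 3 * M * D * rho t" if "0 \<le> t" for t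
      using hb[OF that] wf[OF that] by linarith
    show "((\<lambda>t. fwd h t * bwd f t) has_real_derivative h t * bwd f t - fwd h t * f t) (at t within {0..})"
      if "0 \<le> t" for t
      by (rule derivative_eq_intros refl fwd_has_derivative bwd_has_derivative ch cf that)+
        (simp add: algebra_simps)
    have "(\<lambda>n. 2 * M * D * rho (real n)) \<longlonglongrightarrow> 2 * M * D * 0"
    proof (intro tendsto_intros)
      show "(\<lambda>n. rho (real n)) \<longlonglongrightarrow> 0"
        unfolding rho_def by real_asymp
    qed
    then have lim0: "(\<lambda>n. 2 * M * D * rho (real n)) \<longlonglongrightarrow> 0" by simp
    have "norm (fwd h (real n) * bwd f (real n)) \<le> 2 * M * D * rho (real n)" for n
      unfolding real_norm_def by (rule wb) simp
    then show "(\<lambda>n. fwd h (real n) * bwd f (real n)) \<longlonglongrightarrow> 0"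
      by (intro Lim_null_comparison[OF _ lim0] always_eventually allI)
  qed (intro continuous_intros c1 c2)
  moreover have "integral {0..} (\<lambda>t. h t * bwd f t - fwd h t * f t)
     = integral {0..} (\<lambda>t. h t * bwd f t) - integral {0..} (\<lambda>t. fwd h t * f t)"
    using hb wf by (intro integral_diff integrable_halfline_of_continuous[OF c1] integrable_halfline_of_continuous[OF c2])
  ultimately show ?thesis by simp
qed

end

section \<open>The maximisation problem\<close>

text \<open>The factor 5 is \<open>4 + s^2\<close> at \<open>s = 1\<close>, the point where the
  estimates near 0 and near infinity are glued.\<close>

lemma inverse_square_le_rho: "1 \<le> s \<Longrightarrow> 1 / s\<^sup>2 \<le> 5 * rho s"
proof -
  assume s: "1 \<le> s"
  then have "1 \<le> s\<^sup>2" by simp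
  then show ?thesis by (simp add: rho_def divide_simps add_pos_nonneg) 
qed

lemma one_le_rho: "0 \<le> s \<Longrightarrow> s \<le> 1 \<Longrightarrow> 1 \<le> 5 * rho s"
proof -
  assume "0 \<le> s" "s \<le> 1"
  then have "s\<^sup>2 \<le> 1" by (simp add: power_le_one)
  then show ?thesis by (simp add: rho_def divide_simps add_pos_nonneg) 
qed

text \<open>With \<open>w = fwd h\<close> standing for \<open>r Q(r)\<close>, the functional is \<open>\<integral> Q\<^sup>4 r\<^sup>2 dr\<close>; at \<open>s = 0\<close> the
  quotients take the correct limit value 0 because \<open>x / 0 = 0\<close>.\<close>
definition cubic :: "(real \<Rightarrow> real) \<Rightarrow> real \<Rightarrow> real" where
  "cubic h s = (fwd h s) ^ 3 / s\<^sup>2"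

definition quartic_int :: "(real \<Rightarrow> real) \<Rightarrow> real" where
  "quartic_int h = integral {0..} (\<lambda>s. (fwd h s) ^ 4 / s\<^sup>2)"

text \<open>The pointwise and Lipschitz bounds make the class compact under pointwise convergence;
  for suitable constants they are preserved by the power step.\<close>
definition admissible :: "real \<Rightarrow> real \<Rightarrow> (real \<Rightarrow> real) \<Rightarrow> bool" where
  "admissible M L h \<longleftrightarrow>
     (\<forall>t\<ge>0. 0 \<le> h t \<and> h t \<le> M * rho t) \<and>
     (\<forall>s\<ge>0. \<forall>t\<ge>0. \<bar>h s - h t\<bar> \<le> L * \<bar>s - t\<bar>) \<and>
     integral {0..} (\<lambda>t. (h t)\<^sup>2) \<le> 1"

context
  fixes M L :: real and h :: "real \<Rightarrow> real"
  assumes adm: "admissible M L h"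
begin

lemma adm_nonneg: "0 \<le> t \<Longrightarrow> 0 \<le> h t"
  and adm_le_rho: "0 \<le> t \<Longrightarrow> h t \<le> M * rho t"
  and adm_lipschitz: "0 \<le> s \<Longrightarrow> 0 \<le> t \<Longrightarrow> \<bar>h s - h t\<bar> \<le> L * \<bar>s - t\<bar>"
  and adm_L2: "integral {0..} (\<lambda>t. (h t)\<^sup>2) \<le> 1"
  using adm by (auto simp: admissible_def)

lemma adm_M_nonneg: "0 \<le> M"
  using adm_nonneg[of 0] adm_le_rho[of 0] by (auto simp: rho_def)

lemma adm_continuous: "continuous_on {0..} h"
proof -
  have "0 \<le> L" using adm_lipschitz[of 0 1] by auto
  then have "L-lipschitz_on {0..} h"
    using adm_lipschitz by (auto simp: lipschitz_on_def dist_real_def)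
  then show ?thesis by (rule lipschitz_on_continuous_on)
qed

lemma adm_le_M: "0 \<le> t \<Longrightarrow> h t \<le> M"
proof -
  assume t: "0 \<le> t"
  have "M * rho t \<le> M * 1" using adm_M_nonneg rho_le_quarter[of t] by (intro mult_left_mono) auto
  then show "h t \<le> M" using adm_le_rho[OF t] by simp
qed

lemma adm_square_le: "0 \<le> t \<Longrightarrow> \<bar>(h t)\<^sup>2\<bar> \<le> M\<^sup>2 * rho t"
proof -
  assume t: "0 \<le> t"
  have "h t * h t \<le> M * (M * rho t)"
    using t adm_nonneg adm_le_M adm_le_rho adm_M_nonneg by (intro mult_mono) auto
  then show ?thesis by (simp add: power2_eq_square)
qed

lemma adm_square_integrable: "(\<lambda>t. (h t)\<^sup>2) integrable_on {0..}"
  using adm_square_le by (intro integrable_halfline_of_continuous[where C="M\<^sup>2"] continuous_intros adm_continuous)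

lemma adm_fwd_nonneg: "0 \<le> r \<Longrightarrow> 0 \<le> fwd h r"
  by (rule fwd_nonneg[OF adm_continuous adm_nonneg])

lemma adm_fwd_le_linear: "0 \<le> r \<Longrightarrow> fwd h r \<le> M * r"
  by (rule fwd_le_linear[OF adm_continuous adm_nonneg adm_le_M])

lemma adm_fwd_le_rho: "0 \<le> r \<Longrightarrow> fwd h r \<le> 2 * M * rho r"
  by (rule fwd_le_rho[OF adm_continuous adm_nonneg adm_le_rho])

lemmas adm_fwd_le_sqrt_one = fwd_le_sqrt_and_one[OF adm_continuous adm_nonneg adm_square_integrable adm_L2]

section \<open>Estimates for the cubic term, with and without the constant \<open>M\<close>\<close>

lemma cubic_nonneg: "0 \<le> s \<Longrightarrow> 0 \<le> cubic h s"
  by (simp add: cubic_def adm_fwd_nonneg)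

lemma cubic_le_inverse_square: "0 \<le> s \<Longrightarrow> cubic h s \<le> 1 / s\<^sup>2"
  unfolding cubic_def using adm_fwd_nonneg adm_fwd_le_sqrt_one(2)
  by (intro divide_right_mono power_le_one) auto

text \<open>An integrable singularity at the origin with an absolute constant, which the bound by
  \<open>1 / s^2\<close> cannot provide.\<close>

lemma cubic_le_inverse_sqrt: "0 < s \<Longrightarrow> cubic h s \<le> 1 / sqrt s"
proof -
  assume s: "0 < s"
  have "(fwd h s) ^ 3 \<le> (sqrt s) ^ 3"
    using s adm_fwd_nonneg adm_fwd_le_sqrt_one(1) by (intro power_mono) auto
  then have "cubic h s \<le> (sqrt s) ^ 3 / s\<^sup>2"
    unfolding cubic_def by (intro divide_right_mono) auto
  also have "\<dots> = (sqrt s) ^ 3 / (sqrt s) ^ 4"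
    using s by (simp add: power2_eq_square power4_eq_xxxx)
  also have "\<dots> = 1 / sqrt s"
    using s by (simp add: field_simps power3_eq_cube power4_eq_xxxx)
  finally show ?thesis .
qed

text \<open>Provides continuity at 0, where the default value of the quotient agrees with the
  limit.\<close>

lemma cubic_le_linear: "0 \<le> s \<Longrightarrow> cubic h s \<le> M ^ 3 * s"
proof -
  assume s: "0 \<le> s"
  have "(fwd h s) ^ 3 \<le> (M * s) ^ 3"
    using s adm_fwd_nonneg adm_fwd_le_linear by (intro power_mono) auto
  then have "cubic h s \<le> (M * s) ^ 3 / s\<^sup>2"
    unfolding cubic_def by (intro divide_right_mono) auto
  also have "\<dots> = M ^ 3 * s"
    by (cases "s = 0") (auto simp: field_simps power3_eq_cube power2_eq_square)
  finally show ?thesis .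
qed

text \<open>Dependence on \<open>M\<close> is harmless here: the bound feeds the Lipschitz constant
  \<open>L\<close>, chosen after \<open>M\<close>, and majorants whose size does not matter.\<close>

lemma cubic_le_square: "0 \<le> s \<Longrightarrow> cubic h s \<le> M\<^sup>2"
proof (cases "s = 0")
  case False
  assume s: "0 \<le> s"
  have "fwd h s / s \<le> M" using False s adm_fwd_le_linear[of s] by (simp add: field_simps)
  then have "(fwd h s / s)\<^sup>2 \<le> M\<^sup>2" using s adm_fwd_nonneg by (intro power_mono) auto
  then have "fwd h s * (fwd h s / s)\<^sup>2 \<le> 1 * M\<^sup>2"
    using s adm_fwd_nonneg adm_fwd_le_sqrt_one(2) by (intro mult_mono) auto
  then show ?thesis by (simp add: cubic_def power2_eq_square power3_eq_cube mult.assoc)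
qed (simp add: cubic_def)

lemma cubic_le_rho: "0 \<le> s \<Longrightarrow> cubic h s \<le> 5 * (1 + M\<^sup>2) * rho s"
proof (cases "s \<le> 1")
  case True
  assume s: "0 \<le> s"
  have "M\<^sup>2 * 1 \<le> (1 + M\<^sup>2) * (5 * rho s)"
    using one_le_rho[OF s True] by (intro mult_mono) auto
  then show ?thesis using cubic_le_square[OF s] by (simp add: algebra_simps)
next
  case False
  then have "cubic h s \<le> 5 * rho s"
    using cubic_le_inverse_square[of s] inverse_square_le_rho[of s] by simp
  also have "\<dots> \<le> (1 + M\<^sup>2) * (5 * rho s)" by (simp add: algebra_simps)
  finally show ?thesis by (simp add: algebra_simps)
qed

lemma continuous_on_cubic: "continuous_on {0..} (cubic h)"
proof (rule continuous_on_eq_continuous_within[THEN iffD2], rule ballI)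
  fix s :: real assume s: "s \<in> {0..}"
  have cw: "continuous (at s within {0..}) (fwd h)"
    using s continuous_on_fwd[OF adm_continuous] continuous_on_eq_continuous_within by blast
  show "continuous (at s within {0..}) (cubic h)"
  proof (cases "s = 0")
    case False
    then show ?thesis
      unfolding cubic_def by (intro continuous_intros cw) auto
  next
    case True
    have "((\<lambda>t. M ^ 3 * t) \<longlongrightarrow> M ^ 3 * 0) (at 0 within {0..})"
      by (intro tendsto_intros)
    then have lim0: "((\<lambda>t. M ^ 3 * t) \<longlongrightarrow> 0) (at 0 within {0..})" by simp
    have "norm (cubic h t) \<le> M ^ 3 * t" if "0 \<le> t" for t
      using cubic_nonneg[OF that] cubic_le_linear[OF that] by simp
    then have "\<forall>\<^sub>F t in at 0 within {0..}. norm (cubic h t) \<le> M ^ 3 * t"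
      by (simp add: eventually_at_filter)
    then have "(cubic h \<longlongrightarrow> 0) (at 0 within {0..})"
      by (rule Lim_null_comparison[OF _ lim0])
    then show ?thesis
      using True by (simp add: continuous_within cubic_def)
  qed
qed

lemma quartic_eq: "(fwd h s) ^ 4 / s\<^sup>2 = fwd h s * cubic h s"
  by (simp add: cubic_def power_def numeral_eq_Suc)

lemma quartic_bound: "0 \<le> s \<Longrightarrow> \<bar>(fwd h s) ^ 4 / s\<^sup>2\<bar> \<le> 5 * (1 + M\<^sup>2) * rho s"
proof -
  assume s: "0 \<le> s"
  have "fwd h s * cubic h s \<le> 1 * cubic h s"
    using s adm_fwd_le_sqrt_one(2) cubic_nonneg by (intro mult_right_mono) auto
  then show ?thesis
    using cubic_le_rho[OF s] cubic_nonneg[OF s] adm_fwd_nonneg[OF s] by (simp add: quartic_eq)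
qed

lemma continuous_on_quartic: "continuous_on {0..} (\<lambda>s. (fwd h s) ^ 4 / s\<^sup>2)"
  unfolding quartic_eq by (intro continuous_intros continuous_on_fwd continuous_on_cubic adm_continuous)

lemma quartic_integrable: "(\<lambda>s. (fwd h s) ^ 4 / s\<^sup>2) integrable_on {0..}"
  using quartic_bound by (intro integrable_halfline_of_continuous continuous_on_quartic)

lemma quartic_int_le: "quartic_int h \<le> integral {0..} (\<lambda>s. 5 * (1 + M\<^sup>2) * rho s)"
  unfolding quartic_int_def using quartic_bound
  by (intro integral_le quartic_integrable integrable_on_mult_right rho_integrable) (auto simp: abs_le_iff)

lemma bwd_cubic_nonneg: "0 \<le> t \<Longrightarrow> 0 \<le> bwd (cubic h) t"
  by (rule bwd_nonneg[OF continuous_on_cubic cubic_nonneg cubic_le_rho])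

text \<open>The key estimate, with an absolute constant. Beyond 1 the inverse-square decay gives
  \<open>5 * rho\<close>, in particular a value at most 1 at \<open>t = 1\<close>. Going back to 0
  adds at most 2, and \<open>3 <= 15 * rho t\<close> on \<open>[0, 1]\<close>.\<close>

lemma bwd_cubic_le: "0 \<le> t \<Longrightarrow> bwd (cubic h) t \<le> 15 * rho t"
proof -
  assume t: "0 \<le> t"
  have ge1: "bwd (cubic h) t \<le> 5 * rho t" if "1 \<le> t" for t
  proof (rule bwd_le_rho[OF continuous_on_cubic cubic_nonneg cubic_le_rho])
    show "cubic h t \<le> 5 * rho t" if "1 \<le> t" for t
      using that cubic_le_inverse_square[of t] inverse_square_le_rho[of t] by simp
  qed (use that in auto)
  show ?thesis
  proof (cases "1 \<le> t")
    case True
    show ?thesis using ge1[OF True] rho_nonneg[of t] by linarith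
  next
    case False
    \<comment> \<open>Since \<open>\<eta>' = \<eta> - cubic h >= - 1 / sqrt t\<close>, adding the
      antiderivative \<open>2 * sqrt t\<close> of the singularity makes the sum increasing.\<close>
    have "bwd (cubic h) t + 2 * sqrt t \<le> bwd (cubic h) 1 + 2 * sqrt 1"
    proof (rule DERIV_nonneg_imp_increasing_open[of t 1 "\<lambda>t. bwd (cubic h) t + 2 * sqrt t"])
      show "continuous_on {t..1} (\<lambda>t. bwd (cubic h) t + 2 * sqrt t)"
        using t continuous_on_bwd[OF continuous_on_cubic]
        by (intro continuous_intros) (auto elim!: continuous_on_subset)
      fix x assume x: "t < x" "x < 1"
      then have x0: "0 < x" using t by simp
      have "(bwd (cubic h) has_real_derivative bwd (cubic h) x - cubic h x) (at x)"
        using bwd_has_derivative[OF continuous_on_cubic, of x] x0 at_within_halfline[OF x0] by simp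
      moreover have "((\<lambda>x. 2 * sqrt x) has_real_derivative 1 / sqrt x) (at x)"
        using x0 by (auto intro!: derivative_eq_intros simp: divide_simps)
      ultimately have "((\<lambda>t. bwd (cubic h) t + 2 * sqrt t) has_real_derivative
          bwd (cubic h) x - cubic h x + 1 / sqrt x) (at x)"
        by (rule DERIV_add)
      moreover have "0 \<le> bwd (cubic h) x - cubic h x + 1 / sqrt x"
        using cubic_le_inverse_sqrt[OF x0] bwd_cubic_nonneg[of x] x0 by simp
      ultimately show "\<exists>y. ((\<lambda>t. bwd (cubic h) t + 2 * sqrt t) has_real_derivative y) (at x) \<and> 0 \<le> y"
        by blast
    qed (use False in auto)
    moreover have "bwd (cubic h) 1 \<le> 1" using ge1[of 1] by (simp add: rho_def)
    moreover have "0 \<le> sqrt t" using t by simp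
    ultimately have "bwd (cubic h) t \<le> 3" unfolding real_sqrt_one by linarith
    then show ?thesis using one_le_rho[of t] t False by simp
  qed
qed

lemma quartic_int_eq_bwd: "quartic_int h = integral {0..} (\<lambda>t. h t * bwd (cubic h) t)"
  unfolding quartic_int_def quartic_eq
  by (rule fwd_bwd_adjoint[OF continuous_on_cubic cubic_nonneg cubic_le_rho
        adm_continuous adm_nonneg adm_le_rho, symmetric])

text \<open>Up to a factor 4, \<open>bwd (cubic h)\<close> is the L^2 gradient of
  \<open>quartic_int\<close> at \<open>h\<close>, so this is a step of the power method for a
  nonlinear eigenvalue problem. The lower bound \<open>j\<close> keeps the norm \<open>c\<close>
  away from 0: dividing the bounds \<open>15\<close> and \<open>4 + M^2\<close> by \<open>c\<close>
  costs at most the factor \<open>1 / j\<close>.\<close>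

lemma power_step:
  assumes "0 < j" "j \<le> quartic_int h" "15 / j \<le> M" "(4 + M\<^sup>2) / j \<le> L"
  obtains c where "quartic_int h \<le> c" "admissible M L (\<lambda>t. bwd (cubic h) t / c)"
    "integral {0..} (\<lambda>t. (bwd (cubic h) t / c)\<^sup>2) = 1"
    "integral {0..} (\<lambda>s. fwd (\<lambda>t. bwd (cubic h) t / c) s * cubic h s) = c"
proof -
  define \<eta> where "\<eta> = bwd (cubic h)"
  define c where "c = sqrt (integral {0..} (\<lambda>t. (\<eta> t)\<^sup>2))"
  have c\<eta>: "continuous_on {0..} \<eta>" unfolding \<eta>_def by (rule continuous_on_bwd[OF continuous_on_cubic])
  have \<eta>0: "0 \<le> \<eta> t" and \<eta>1: "\<eta> t \<le> 15 * rho t" if "0 \<le> t" for t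
    using that bwd_cubic_nonneg bwd_cubic_le by (auto simp: \<eta>_def)
  have \<eta>4: "\<eta> t \<le> 15/4" if "0 \<le> t" for t
    using \<eta>1[OF that] rho_le_quarter[of t] by linarith
  have \<eta>2: "\<bar>(\<eta> t)\<^sup>2\<bar> \<le> 225/4 * rho t" if "0 \<le> t" for t
  proof -
    have "\<eta> t * \<eta> t \<le> 15/4 * (15 * rho t)"
      using \<eta>0 \<eta>1 \<eta>4 that by (intro mult_mono) auto
    then show ?thesis by (simp add: power2_eq_square)
  qed
  have int\<eta>: "(\<lambda>t. (\<eta> t)\<^sup>2) integrable_on {0..}"
    using \<eta>2 by (intro integrable_halfline_of_continuous[where C="225/4"] continuous_intros c\<eta>)
  have nnint: "0 \<le> integral {0..} (\<lambda>t. (\<eta> t)\<^sup>2)"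
    by (intro integral_nonneg int\<eta>) auto
  have ch\<eta>: "continuous_on {0..} (\<lambda>t. h t * \<eta> t)"
    by (intro continuous_intros c\<eta> adm_continuous)
  have h\<eta>: "\<bar>h t * \<eta> t\<bar> \<le> 15 * M * rho t" if "0 \<le> t" for t
  proof -
    have "h t * \<eta> t \<le> M * (15 * rho t)"
      using \<eta>0 \<eta>1 that adm_nonneg adm_le_M adm_M_nonneg by (intro mult_mono) auto
    then show ?thesis using adm_nonneg[OF that] \<eta>0[OF that] by simp
  qed
  have inth\<eta>: "(\<lambda>t. h t * \<eta> t) integrable_on {0..}"
    using h\<eta> by (intro integrable_halfline_of_continuous[OF ch\<eta>])
  have Jeq: "quartic_int h = integral {0..} (\<lambda>t. h t * \<eta> t)"
    using quartic_int_eq_bwd by (simp add: \<eta>_def)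
  have c2: "c\<^sup>2 = integral {0..} (\<lambda>t. (\<eta> t)\<^sup>2)" using nnint by (simp add: c_def)
  have "c \<noteq> 0"
  proof
    assume "c = 0"
    then have "\<eta> t = 0" if "0 \<le> t" for t
      using integral_zero_halfline[OF continuous_on_power[OF c\<eta>] _ int\<eta> _ that] c2 by simp
    then have "quartic_int h = 0"
      using Jeq integral_cong[of "{0..}" "\<lambda>t. h t * \<eta> t" "\<lambda>t. 0"] by simp
    then show False using assms by simp
  qed
  moreover have "0 \<le> c" using nnint by (simp add: c_def)
  ultimately have cpos: "0 < c" by simp
  \<comment> \<open>Cauchy-Schwarz in the pointwise form
    \<open>h * \<eta> <= c/2 * h^2 + \<eta>^2 / (2c)\<close>. With \<open>c\<close> the norm of
    \<open>\<eta>\<close>, the integrals on the right contribute at most \<open>c/2\<close>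
    each.\<close>
  have Jc: "quartic_int h \<le> c"
  proof -
    have i2: "(\<lambda>t. c / 2 * (h t)\<^sup>2 + 1 / (2 * c) * (\<eta> t)\<^sup>2) integrable_on {0..}"
      by (intro integrable_add integrable_on_mult_right adm_square_integrable int\<eta>)
    have "quartic_int h \<le> integral {0..} (\<lambda>t. c / 2 * (h t)\<^sup>2 + 1 / (2 * c) * (\<eta> t)\<^sup>2)"
      unfolding Jeq
    proof (rule integral_le[OF inth\<eta> i2])
      fix t :: real
      have "c / 2 * (h t)\<^sup>2 + 1 / (2 * c) * (\<eta> t)\<^sup>2 - h t * \<eta> t = (c * h t - \<eta> t)\<^sup>2 / (2 * c)"
        using cpos by (simp add: power2_eq_square divide_simps) (simp add: algebra_simps)
      also have "\<dots> \<ge> 0" using cpos by simp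
      finally show "h t * \<eta> t \<le> c / 2 * (h t)\<^sup>2 + 1 / (2 * c) * (\<eta> t)\<^sup>2" by simp
    qed
    also have "\<dots> = c / 2 * integral {0..} (\<lambda>t. (h t)\<^sup>2) + 1 / (2 * c) * c\<^sup>2"
      unfolding c2
      by (simp only: integral_mult_right
          integral_add[OF integrable_on_mult_right[OF adm_square_integrable] integrable_on_mult_right[OF int\<eta>]])
    also have "\<dots> \<le> c / 2 * 1 + 1 / (2 * c) * c\<^sup>2"
      using adm_L2 cpos by (intro add_right_mono mult_left_mono) auto
    also have "\<dots> = c" using cpos by (simp add: power2_eq_square)
    finally show ?thesis .
  qed
  have jc: "j \<le> c" using assms Jc by simp
  let ?k = "\<lambda>t. \<eta> t / c"
  have norm1: "integral {0..} (\<lambda>t. (?k t)\<^sup>2) = 1"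
  proof -
    have "integral {0..} (\<lambda>t. (?k t)\<^sup>2) = integral {0..} (\<lambda>t. (1 / c\<^sup>2) * (\<eta> t)\<^sup>2)"
      by (intro integral_cong) (simp add: power_divide)
    also have "\<dots> = (1 / c\<^sup>2) * c\<^sup>2" unfolding c2 by (rule integral_mult_right)
    finally show ?thesis using cpos by simp
  qed
  have kM: "?k t \<le> M * rho t" if "0 \<le> t" for t
  proof -
    have "?k t \<le> (15 * rho t) / c" using \<eta>1[OF that] cpos by (intro divide_right_mono) auto
    also have "\<dots> \<le> (15 * rho t) / j" using jc assms cpos by (intro divide_left_mono) auto
    also have "\<dots> = (15 / j) * rho t" by simp
    also have "\<dots> \<le> M * rho t" using assms by (intro mult_right_mono) auto
    finally show ?thesis .
  qed
  have kL: "\<bar>?k s - ?k t\<bar> \<le> L * \<bar>s - t\<bar>" if "0 \<le> s" "0 \<le> t" for s t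
  proof -
    \<comment> \<open>The derivative of \<open>\<eta>\<close> is \<open>\<eta> - cubic h\<close>,
      with \<open>\<eta> <= 15/4\<close> and \<open>cubic h <= M^2\<close>.\<close>
    have "\<bar>\<eta> s - \<eta> t\<bar> \<le> (4 + M\<^sup>2) * \<bar>s - t\<bar>"
    proof (rule lipschitz_halfline[where g="\<lambda>t. \<eta> t - cubic h t"])
      show "(\<eta> has_real_derivative \<eta> t - cubic h t) (at t within {0..})" if "0 \<le> t" for t
        unfolding \<eta>_def by (rule bwd_has_derivative[OF continuous_on_cubic that])
      show "\<bar>\<eta> t - cubic h t\<bar> \<le> 4 + M\<^sup>2" if "0 \<le> t" for t
        using \<eta>0[OF that] \<eta>4[OF that] cubic_nonneg[OF that] cubic_le_square[OF that] by linarith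
    qed fact+
    then have "\<bar>\<eta> s - \<eta> t\<bar> / c \<le> ((4 + M\<^sup>2) * \<bar>s - t\<bar>) / c"
      using cpos by (intro divide_right_mono) auto
    also have "\<dots> \<le> ((4 + M\<^sup>2) * \<bar>s - t\<bar>) / j"
      using jc assms cpos by (intro divide_left_mono) auto
    also have "\<dots> = (4 + M\<^sup>2) / j * \<bar>s - t\<bar>" by simp
    also have "\<dots> \<le> L * \<bar>s - t\<bar>" using assms by (intro mult_right_mono) auto
    finally show ?thesis using cpos by (simp add: diff_divide_distrib[symmetric])
  qed
  have adk: "admissible M L ?k"
    unfolding admissible_def using kM kL norm1 \<eta>0 cpos by auto
  have "integral {0..} (\<lambda>s. fwd ?k s * cubic h s) = integral {0..} (\<lambda>t. ?k t * \<eta> t)"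
    unfolding \<eta>_def
  proof (rule fwd_bwd_adjoint[OF continuous_on_cubic cubic_nonneg cubic_le_rho, symmetric])
    show "continuous_on {0..} (\<lambda>t. bwd (cubic h) t / c)"
      using c\<eta> cpos unfolding \<eta>_def by (intro continuous_intros) auto
  qed (use kM \<eta>0 cpos in \<open>auto simp: \<eta>_def\<close>)
  also have "\<dots> = integral {0..} (\<lambda>t. (1 / c) * (\<eta> t)\<^sup>2)"
    by (intro integral_cong) (simp add: power2_eq_square)
  also have "\<dots> = (1 / c) * c\<^sup>2" unfolding c2 by (rule integral_mult_right)
  also have "\<dots> = c" using cpos by (simp add: power2_eq_square)
  finally have "integral {0..} (\<lambda>s. fwd ?k s * cubic h s) = c" .
  with Jc adk norm1 show ?thesis using that[of c] by (simp add: \<eta>_def)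
qed

end

section \<open>Compactness of the class and existence of a maximiser\<close>

lemma admissible_convergent_subsequence:
  assumes adm: "\<And>n. admissible M L (H n)"
  shows "\<exists>k h. strict_mono (k :: nat \<Rightarrow> nat) \<and> (\<forall>t\<ge>0. (\<lambda>n. H (k n) t) \<longlonglongrightarrow> h t)"
proof -
  have "countable (\<rat> \<inter> {0::real..})"
    using countable_rat by (rule countable_subset[rotated]) auto
  moreover have "norm (H n x) \<le> M" if "x \<in> \<rat> \<inter> {0..}" for n x
    using adm_nonneg[OF adm] adm_le_M[OF adm] that by simp
  ultimately obtain k where k: "strict_mono (k :: nat \<Rightarrow> nat)"
      "\<And>x. x \<in> \<rat> \<inter> {0::real..} \<Longrightarrow> \<exists>l. (\<lambda>n. H (k n) x) \<longlonglongrightarrow> l"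
    using function_convergent_subsequence[of "\<rat> \<inter> {0::real..}" H M] by blast
  \<comment> \<open>The diagonal subsequence converges at nonnegative rationals; the common
    Lipschitz constant carries the Cauchy property over to every other point.\<close>
  have "convergent (\<lambda>n. H (k n) t)" if t: "0 \<le> t" for t
  proof (rule real_Cauchy_convergent, rule metric_CauchyI)
    fix e :: real assume e: "0 < e"
    define d where "d = e / (3 * (\<bar>L\<bar> + 1))"
    have d: "0 < d" using e by (simp add: d_def)
    obtain x where x: "x \<in> \<rat>" "t < x" "x < t + d"
      using Rats_dense_in_real[of t "t + d"] d by auto
    then have x0: "0 \<le> x" using t by simp
    then obtain l where "(\<lambda>n. H (k n) x) \<longlonglongrightarrow> l" using k(2)[of x] x by auto
    then have "Cauchy (\<lambda>n. H (k n) x)" by (rule LIMSEQ_imp_Cauchy)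
    then obtain N where N: "\<And>m n. m \<ge> N \<Longrightarrow> n \<ge> N \<Longrightarrow> dist (H (k m) x) (H (k n) x) < e / 3"
      using e metric_CauchyD[of "\<lambda>n. H (k n) x" "e/3"] by auto
    have close: "\<bar>H n t - H n x\<bar> \<le> e / 3" for n
    proof -
      have "\<bar>H n t - H n x\<bar> \<le> L * \<bar>t - x\<bar>" by (rule adm_lipschitz[OF adm t x0])
      also have "\<dots> \<le> (\<bar>L\<bar> + 1) * d" using x by (intro mult_mono) auto
      also have "\<dots> = e / 3" by (simp add: d_def field_simps)
      finally show ?thesis .
    qed
    show "\<exists>N. \<forall>m\<ge>N. \<forall>n\<ge>N. dist (H (k m) t) (H (k n) t) < e"
    proof (intro exI allI impI)
      fix m n assume "N \<le> m" "N \<le> n"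
      from N[OF this] close[of "k m"] close[of "k n"]
      show "dist (H (k m) t) (H (k n) t) < e" unfolding dist_real_def by linarith
    qed
  qed
  then have "(\<lambda>n. H (k n) t) \<longlonglongrightarrow> lim (\<lambda>n. H (k n) t)" if "0 \<le> t" for t
    using that by (simp add: convergent_LIMSEQ_iff)
  with k(1) show ?thesis
    by (intro exI[of _ k] exI[of _ "\<lambda>t. lim (\<lambda>n. H (k n) t)"] conjI allI impI)
qed

text \<open>The conditions of the class pass to pointwise limits. The decay bounds supply common
  integrable majorants, so nothing is lost at infinity and the functional is continuous along the
  sequence.\<close>

lemma admissible_limit:
  assumes adm: "\<And>n. admissible M L (H n)"
    and lim: "\<And>t. 0 \<le> t \<Longrightarrow> (\<lambda>n. H n t) \<longlonglongrightarrow> h t"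
  shows "admissible M L h" "(\<lambda>n. quartic_int (H n)) \<longlonglongrightarrow> quartic_int h"
proof -
  have h0: "0 \<le> h t" if "0 \<le> t" for t
    by (rule LIMSEQ_le_const[OF lim[OF that]]) (use adm_nonneg[OF adm that] in blast)
  have hM: "h t \<le> M * rho t" if "0 \<le> t" for t
    by (rule LIMSEQ_le_const2[OF lim[OF that]]) (use adm_le_rho[OF adm that] in blast)
  have hL: "\<bar>h s - h t\<bar> \<le> L * \<bar>s - t\<bar>" if "0 \<le> s" "0 \<le> t" for s t
  proof (rule LIMSEQ_le_const2)
    show "(\<lambda>n. \<bar>H n s - H n t\<bar>) \<longlonglongrightarrow> \<bar>h s - h t\<bar>"
      by (intro tendsto_intros lim that)
    show "\<exists>N. \<forall>n\<ge>N. \<bar>H n s - H n t\<bar> \<le> L * \<bar>s - t\<bar>"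
      using adm_lipschitz[OF adm that] by blast
  qed
  have "(\<lambda>n. integral {0..} (\<lambda>t. (H n t)\<^sup>2)) \<longlonglongrightarrow> integral {0..} (\<lambda>t. (h t)\<^sup>2)"
  proof (rule dominated_convergence)
    show "(\<lambda>t. (H n t)\<^sup>2) integrable_on {0..}" for n by (rule adm_square_integrable[OF adm])
    show "(\<lambda>t. M\<^sup>2 * rho t) integrable_on {0..}" by (intro integrable_on_mult_right rho_integrable)
    show "norm ((H n t)\<^sup>2) \<le> M\<^sup>2 * rho t" if "t \<in> {0..}" for n t
      using adm_square_le[OF adm, of t] that by simp
    show "(\<lambda>n. (H n t)\<^sup>2) \<longlonglongrightarrow> (h t)\<^sup>2" if "t \<in> {0..}" for t
      using lim[of t] that by (intro tendsto_intros) auto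
  qed
  then have hI: "integral {0..} (\<lambda>t. (h t)\<^sup>2) \<le> 1"
    by (rule LIMSEQ_le_const2) (use adm_L2[OF adm] in blast)
  show "admissible M L h"
    unfolding admissible_def using h0 hM hL hI by blast
  have fwd_lim: "(\<lambda>n. fwd (H n) r) \<longlonglongrightarrow> fwd h r" if r: "0 \<le> r" for r
    unfolding fwd_def
  proof (intro tendsto_intros)
    show "(\<lambda>n. integral {0..r} (\<lambda>t. exp t * H n t)) \<longlonglongrightarrow> integral {0..r} (\<lambda>t. exp t * h t)"
    proof (rule dominated_convergence)
      show "(\<lambda>t. exp t * H n t) integrable_on {0..r}" for n
        by (intro integrable_continuous_interval continuous_intros
            continuous_on_subset[OF adm_continuous[OF adm]]) auto
      show "(\<lambda>t. exp r * M) integrable_on {0..r}" by (rule integrable_const_ivl)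
      show "norm (exp t * H n t) \<le> exp r * M" if "t \<in> {0..r}" for n t
      proof -
        have "exp t * H n t \<le> exp r * M"
          using that adm_nonneg[OF adm] adm_le_M[OF adm] by (intro mult_mono) auto
        then show ?thesis using adm_nonneg[OF adm, of t n] that by simp
      qed
      show "(\<lambda>n. exp t * H n t) \<longlonglongrightarrow> exp t * h t" if "t \<in> {0..r}" for t
        using lim[of t] that by (intro tendsto_intros) auto
    qed
  qed
  show "(\<lambda>n. quartic_int (H n)) \<longlonglongrightarrow> quartic_int h"
    unfolding quartic_int_def
  proof (rule dominated_convergence)
    show "(\<lambda>s. (fwd (H n) s) ^ 4 / s\<^sup>2) integrable_on {0..}" for n by (rule quartic_integrable[OF adm])
    show "(\<lambda>t. 5 * (1 + M\<^sup>2) * rho t) integrable_on {0..}" by (intro integrable_on_mult_right rho_integrable)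
    show "norm ((fwd (H n) s) ^ 4 / s\<^sup>2) \<le> 5 * (1 + M\<^sup>2) * rho s" if "s \<in> {0..}" for n s
      using quartic_bound[OF adm, of s] that by (simp only: real_norm_def atLeast_iff)
    show "(\<lambda>n. (fwd (H n) s) ^ 4 / s\<^sup>2) \<longlonglongrightarrow> (fwd h s) ^ 4 / s\<^sup>2" if "s \<in> {0..}" for s
    proof (cases "s = 0")
      case False
      then show ?thesis using fwd_lim[of s] that by (intro tendsto_intros) auto
    qed simp
  qed
qed

lemma admissible_maximizer:
  assumes "admissible M L h0"
  obtains h where "admissible M L h" "\<And>k. admissible M L k \<Longrightarrow> quartic_int k \<le> quartic_int h"
proof -
  define A where "A = quartic_int ` {h. admissible M L h}"
  have ne: "A \<noteq> {}" using assms by (auto simp: A_def)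
  have bdd: "bdd_above A"
    unfolding A_def by (rule bdd_aboveI2[where M="integral {0..} (\<lambda>s. 5 * (1 + M\<^sup>2) * rho s)"])
      (use quartic_int_le in blast)
  have "\<exists>h. admissible M L h \<and> Sup A - 1 / real (Suc n) < quartic_int h" for n
  proof -
    have "Sup A - 1 / real (Suc n) < Sup A" by simp
    then obtain y where "y \<in> A" "Sup A - 1 / real (Suc n) < y"
      using less_cSup_iff[OF ne bdd] by blast
    then show ?thesis by (auto simp: A_def)
  qed
  then obtain H where H: "\<And>n. admissible M L (H n)" "\<And>n. Sup A - 1 / real (Suc n) < quartic_int (H n)"
    by metis
  obtain k h where k: "strict_mono (k :: nat \<Rightarrow> nat)" and h: "\<And>t. 0 \<le> t \<Longrightarrow> (\<lambda>n. H (k n) t) \<longlonglongrightarrow> h t"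
    using admissible_convergent_subsequence[of M L H] H(1) by metis
  have adm: "admissible M L h" and lim: "(\<lambda>n. quartic_int (H (k n))) \<longlonglongrightarrow> quartic_int h"
    using admissible_limit[OF H(1) h] by auto
  have "Sup A - 0 \<le> quartic_int h"
  proof (rule LIMSEQ_le[OF _ lim])
    have "(\<lambda>n. 1 / real (Suc n)) \<longlonglongrightarrow> 0" by (rule lim_1_over_n[THEN LIMSEQ_Suc])
    then show "(\<lambda>n. Sup A - 1 / real (Suc n)) \<longlonglongrightarrow> Sup A - 0" by (intro tendsto_intros)
    have "Sup A - 1 / real (Suc n) \<le> quartic_int (H (k n))" for n
    proof -
      have "1 / real (Suc (k n)) \<le> 1 / real (Suc n)"
        using seq_suble[OF k, of n] by (intro divide_left_mono) auto
      then show ?thesis using H(2)[of "k n"] by linarith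
    qed
    then show "\<exists>N. \<forall>n\<ge>N. Sup A - 1 / real (Suc n) \<le> quartic_int (H (k n))" by blast
  qed
  moreover have "quartic_int k \<le> Sup A" if "admissible M L k" for k
    using that by (intro cSup_upper bdd) (simp add: A_def)
  ultimately have "quartic_int k \<le> quartic_int h" if "admissible M L k" for k
    using that by fastforce
  with adm show ?thesis by (rule that)
qed

text \<open>The competitor that starts the argument: here \<open>fwd h r = r * exp (-r)\<close>,
  that is \<open>Q = exp (-r)\<close>. Its functional value does not depend on \<open>M\<close> and
  \<open>L\<close>. The threshold 6 comes from \<open>4 + t^2 <= 6 * exp t\<close>.\<close>

lemma exp_admissible:
  assumes "6 \<le> M" "1 \<le> L"
  shows "admissible M L (\<lambda>t. exp (- t))"
  unfolding admissible_def
proof (intro conjI allI impI)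
  fix t :: real assume t: "0 \<le> t"
  have "1 + t + t\<^sup>2 / 2 \<le> exp t" by (rule exp_lower_Taylor_quadratic[OF t])
  then have "4 + t\<^sup>2 \<le> 6 * exp t" using t zero_le_power2[of t] by linarith
  then have "exp (- t) \<le> 6 * rho t"
    by (simp add: rho_def exp_minus divide_simps add_pos_nonneg)
  also have "\<dots> \<le> M * rho t" using assms by (intro mult_right_mono) auto
  finally show "exp (- t) \<le> M * rho t" .
next
  fix s t :: real assume st: "0 \<le> s" "0 \<le> t"
  have "\<bar>exp (- s) - exp (- t)\<bar> \<le> 1 * \<bar>s - t\<bar>"
    by (rule lipschitz_halfline[where g="\<lambda>t. - exp (- t)"])
      (use st in \<open>auto intro!: derivative_eq_intros\<close>)
  also have "\<dots> \<le> L * \<bar>s - t\<bar>" using assms by (intro mult_right_mono) auto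
  finally show "\<bar>exp (- s) - exp (- t)\<bar> \<le> L * \<bar>s - t\<bar>" .
next
  have "integral {0..} (\<lambda>t::real. exp (-2 * t)) = exp (-2 * 0) / 2"
    using has_integral_exp_minus_to_infinity[of 2 0] by (intro integral_unique) auto
  moreover have "(\<lambda>t::real. (exp (- t))\<^sup>2) = (\<lambda>t. exp (-2 * t))"
    by (auto simp: power2_eq_square simp flip: exp_add)
  ultimately show "integral {0..} (\<lambda>t::real. (exp (- t))\<^sup>2) \<le> 1" by simp
qed simp

lemma quartic_int_exp_pos: "0 < quartic_int (\<lambda>t. exp (- t))"
proof (rule ccontr)
  assume neg: "\<not> 0 < quartic_int (\<lambda>t. exp (- t))"
  have adm: "admissible 6 1 (\<lambda>t. exp (- t))" by (rule exp_admissible) auto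
  let ?g = "\<lambda>s. (fwd (\<lambda>t. exp (- t)) s) ^ 4 / s\<^sup>2"
  have "?g 1 = 0"
    by (rule integral_zero_halfline[of ?g])
      (use continuous_on_quartic[OF adm] quartic_integrable[OF adm] neg in \<open>auto simp: quartic_int_def not_less\<close>)
  then have "integral {0..1} (\<lambda>t::real. exp t * exp (- t)) = 0" by (simp add: fwd_def)
  moreover have "(\<lambda>t::real. exp t * exp (- t)) = (\<lambda>t. 1)" by (simp flip: exp_add)
  ultimately show False by simp
qed

text \<open>Young's inequality with exponents 4/3 and 4, applied to \<open>a^3\<close> and
  \<open>b\<close>. The explicit factorisation with \<open>(a - b)^2\<close> also settles the case
  of equality, which is what identifies the two functions at a maximiser.\<close>

lemma quartic_young:
  fixes a b :: real
  assumes "0 \<le> a" "0 \<le> b"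
  shows "0 \<le> 3/4 * a ^ 4 + 1/4 * b ^ 4 - a ^ 3 * b"
    and "3/4 * a ^ 4 + 1/4 * b ^ 4 - a ^ 3 * b = 0 \<Longrightarrow> a = b"
proof -
  have eq: "3/4 * a ^ 4 + 1/4 * b ^ 4 - a ^ 3 * b = 1/4 * ((a - b)\<^sup>2 * (3 * a\<^sup>2 + 2 * (a * b) + b\<^sup>2))"
    by (simp add: power2_eq_square power3_eq_cube power4_eq_xxxx algebra_simps)
  show "0 \<le> 3/4 * a ^ 4 + 1/4 * b ^ 4 - a ^ 3 * b"
    unfolding eq using assms by (intro mult_nonneg_nonneg add_nonneg_nonneg) auto
  assume "3/4 * a ^ 4 + 1/4 * b ^ 4 - a ^ 3 * b = 0"
  then have "(a - b)\<^sup>2 = 0 \<or> 3 * a\<^sup>2 + 2 * (a * b) + b\<^sup>2 = 0" unfolding eq by simp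
  then show "a = b"
  proof
    assume "3 * a\<^sup>2 + 2 * (a * b) + b\<^sup>2 = 0"
    moreover have "0 \<le> a\<^sup>2" "0 \<le> a * b" "0 \<le> b\<^sup>2" using assms by auto
    ultimately have "a\<^sup>2 = 0" "b\<^sup>2 = 0" by linarith+
    then show ?thesis by simp
  qed simp
qed

text \<open>The first-order system for \<open>w\<close> and \<open>h = w + w'\<close> encodes
  \<open>w - w'' = w^3 / (c r^2)\<close> without a second derivative at the endpoint 0. Here
  \<open>h\<close> is the image of the maximiser \<open>k\<close> under the power step. Equality in
  Young yields \<open>fwd k = w\<close>, and this closes the system because \<open>k\<close> enters
  the equation for \<open>h\<close> only through \<open>cubic k\<close>.\<close>

theorem nonlinear_eigenfunction:
  "\<exists>c M w h. 0 < c \<and> 0 \<le> M \<and> w 0 = 0 \<and> (\<forall>r>0. 0 < w r) \<and>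
    (\<forall>r\<ge>0. (w has_real_derivative h r - w r) (at r within {0..}) \<and>
      (h has_real_derivative h r - (w r) ^ 3 / r\<^sup>2 / c) (at r within {0..}) \<and>
      0 \<le> h r \<and> h r \<le> M * rho r \<and> w r \<le> 2 * M * rho r \<and> w r \<le> M * r)"
proof -
  define j where "j = quartic_int (\<lambda>t. exp (- t))"
  have j: "0 < j" unfolding j_def by (rule quartic_int_exp_pos)
  \<comment> \<open>The constants are fixed in the order \<open>j\<close>, \<open>M\<close>,
    \<open>L\<close>. The entries 6 and 1 admit the exponential; the quotients are those demanded by
    the power step.\<close>
  define M where "M = max 6 (15 / j)"
  define L where "L = max 1 ((4 + M\<^sup>2) / j)"
  have M_ge: "15 / j \<le> M" and L_ge: "(4 + M\<^sup>2) / j \<le> L"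
    unfolding M_def L_def by (rule max.cobounded2)+
  have e_adm: "admissible M L (\<lambda>t. exp (- t))"
    by (rule exp_admissible) (auto simp: M_def L_def)
  obtain k where k: "admissible M L k" and kmax: "\<And>l. admissible M L l \<Longrightarrow> quartic_int l \<le> quartic_int k"
    using admissible_maximizer[OF e_adm] by blast
  have jk: "j \<le> quartic_int k" unfolding j_def by (rule kmax[OF e_adm])
  obtain c where c: "quartic_int k \<le> c" and adm: "admissible M L (\<lambda>t. bwd (cubic k) t / c)"
    and n1: "integral {0..} (\<lambda>t. (bwd (cubic k) t / c)\<^sup>2) = 1"
    and dual: "integral {0..} (\<lambda>s. fwd (\<lambda>t. bwd (cubic k) t / c) s * cubic k s) = c"
    using power_step[OF k j jk M_ge L_ge] by blast
  define h where "h = (\<lambda>t. bwd (cubic k) t / c)"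
  define w where "w = fwd h"
  note adm = adm[folded h_def] and n1 = n1[folded h_def] and dual = dual[folded h_def]
  have cpos: "0 < c" using c jk j by linarith
  have wk: "fwd k s = w s" if s: "0 \<le> s" for s
  proof -
    let ?g = "\<lambda>s. 3/4 * ((fwd k s) ^ 4 / s\<^sup>2) + 1/4 * ((w s) ^ 4 / s\<^sup>2) - w s * cubic k s"
    have geq: "?g s = (3/4 * (fwd k s) ^ 4 + 1/4 * (w s) ^ 4 - (fwd k s) ^ 3 * w s) / s\<^sup>2" for s
      by (simp add: cubic_def diff_divide_distrib add_divide_distrib mult.commute)
    have c1: "continuous_on {0..} (\<lambda>s. w s * cubic k s)"
      unfolding w_def by (intro continuous_intros continuous_on_fwd adm_continuous[OF adm] continuous_on_cubic[OF k])
    have b1: "\<bar>w s * cubic k s\<bar> \<le> 5 * (1 + M\<^sup>2) * rho s" if "0 \<le> s" for s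
    proof -
      have "w s * cubic k s \<le> 1 * cubic k s"
        unfolding w_def using that adm_fwd_le_sqrt_one(2)[OF adm] cubic_nonneg[OF k] by (intro mult_right_mono) auto
      moreover have "0 \<le> w s * cubic k s"
        unfolding w_def using that adm_fwd_nonneg[OF adm] cubic_nonneg[OF k] by (intro mult_nonneg_nonneg) auto
      ultimately show ?thesis using cubic_le_rho[OF k that] by linarith
    qed
    have i1: "(\<lambda>s. w s * cubic k s) integrable_on {0..}"
      by (rule integrable_halfline_of_continuous[OF c1 b1])
    note i2 = integrable_on_mult_right[OF quartic_integrable[OF k], of "3/4"]
      and i3 = integrable_on_mult_right[OF quartic_integrable[OF adm, folded w_def], of "1/4"]
    have "?g s = 0"
    proof (rule integral_zero_halfline[of ?g])
      show "continuous_on {0..} ?g"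
        by (intro continuous_on_diff continuous_on_add continuous_on_mult_left c1
            continuous_on_quartic[OF k] continuous_on_quartic[OF adm, folded w_def])
      show "0 \<le> ?g t" if "0 \<le> t" for t
        unfolding geq using quartic_young(1)[of "fwd k t" "w t"] adm_fwd_nonneg[OF k that]
          adm_fwd_nonneg[OF adm that] by (simp add: w_def)
      show "?g integrable_on {0..}"
        by (intro integrable_diff integrable_add i1 i2 i3)
      have Jh: "quartic_int h = integral {0..} (\<lambda>s. (w s) ^ 4 / s\<^sup>2)" by (simp only: quartic_int_def w_def)
      have "integral {0..} ?g = 3/4 * quartic_int k + 1/4 * quartic_int h - c"
        by (simp only: integral_diff[OF integrable_add[OF i2 i3] i1] integral_add[OF i2 i3]
            integral_mult_right quartic_int_def[of k] Jh dual[folded w_def])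
      then show "integral {0..} ?g \<le> 0" using kmax[OF adm] c by simp
    qed fact
    \<comment> \<open>At \<open>s = 0\<close> the quotients vanish by the convention for division by
      0 and carry no information; there both functions are 0 by definition of
      \<open>fwd\<close>.\<close>
    then have "s \<noteq> 0 \<Longrightarrow> 3/4 * (fwd k s) ^ 4 + 1/4 * (w s) ^ 4 - (fwd k s) ^ 3 * w s = 0"
      unfolding geq by simp
    then show ?thesis
      using quartic_young(2)[of "fwd k s" "w s"] adm_fwd_nonneg[OF k s] adm_fwd_nonneg[OF adm s]
      by (cases "s = 0") (auto simp: w_def)
  qed
  have wder: "(w has_real_derivative h r - w r) (at r within {0..})" if "0 \<le> r" for r
    unfolding w_def by (rule fwd_has_derivative[OF adm_continuous[OF adm] that])
  have hder: "(h has_real_derivative h r - (w r) ^ 3 / r\<^sup>2 / c) (at r within {0..})" if "0 \<le> r" for r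
  proof -
    have "(h has_real_derivative (bwd (cubic k) r - cubic k r) / c) (at r within {0..})"
      unfolding h_def by (intro DERIV_cdivide bwd_has_derivative[OF continuous_on_cubic[OF k] that])
    then show ?thesis using wk[OF that] by (simp add: h_def cubic_def diff_divide_distrib)
  qed
  have w0: "0 \<le> w r" if "0 \<le> r" for r unfolding w_def by (rule adm_fwd_nonneg[OF adm that])
  have h0: "0 \<le> h r" if "0 \<le> r" for r by (rule adm_nonneg[OF adm that])
  \<comment> \<open>A zero of \<open>w\<close> at \<open>r > 0\<close> would spread. Since
    \<open>exp s * w s\<close> increases, \<open>w\<close> and hence \<open>h\<close> would vanish
    before \<open>r\<close>; since \<open>exp (-s) * h s\<close> decreases, \<open>h\<close> would
    vanish afterwards as well, contradicting its unit norm.\<close>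
  have wpos: "0 < w r" if r: "0 < r" for r
  proof (rule ccontr)
    assume "\<not> 0 < w r"
    then have wr: "w r = 0" using w0[of r] r by simp
    have wz: "w s = 0" if s: "0 \<le> s" "s \<le> r" for s
    proof -
      have "exp s * w s \<le> exp r * w r"
      proof (rule mono_halfline[where F="\<lambda>s. exp s * w s" and g="\<lambda>s. exp s * h s"])
        show "((\<lambda>s. exp s * w s) has_real_derivative exp s * h s) (at s within {0..})" if "0 \<le> s" for s
          by (rule derivative_eq_intros refl wder that)+ (simp add: algebra_simps)
      qed (use h0 s in auto)
      then have "exp s * w s \<le> 0" using wr by simp
      then show ?thesis using w0[OF s(1)] by (simp add: mult_le_0_iff)
    qed
    have hz: "h s = 0" if s: "0 < s" "s < r" for s
    proof -
      have d1: "(w has_real_derivative h s - w s) (at s)"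
        using wder[of s] at_within_halfline[OF s(1)] s by simp
      have "((\<lambda>_. 0) has_real_derivative 0) (at s)" by simp
      then have d2: "(w has_real_derivative 0) (at s)"
        by (rule has_field_derivative_transform_within_open[where S="{0<..<r}"]) (use s wz in auto)
      show ?thesis using DERIV_unique[OF d1 d2] wz[of s] s by simp
    qed
    have hz': "h s = 0" if s: "0 < s" for s
    proof (cases "s < r")
      case True
      then show ?thesis using hz s by blast
    next
      case False
      have "- (exp (- (r/2)) * h (r/2)) \<le> - (exp (- s) * h s)"
      proof (rule mono_halfline[where F="\<lambda>s. - (exp (- s) * h s)" and g="\<lambda>s. exp (- s) * ((w s) ^ 3 / s\<^sup>2 / c)"])
        show "((\<lambda>s. - (exp (- s) * h s)) has_real_derivative exp (- s) * ((w s) ^ 3 / s\<^sup>2 / c)) (at s within {0..})"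
          if "0 \<le> s" for s
          by (rule derivative_eq_intros refl hder that)+ (simp add: algebra_simps)
        show "0 \<le> exp (- t) * ((w t) ^ 3 / t\<^sup>2 / c)" if "r/2 < t" for t
          using w0[of t] r cpos that by simp
      qed (use r False in auto)
      then have "exp (- s) * h s \<le> 0" using hz[of "r/2"] r by simp
      then show ?thesis using h0[of s] s by (simp add: mult_le_0_iff)
    qed
    have "integral {0..} (\<lambda>t. (h t)\<^sup>2) = integral {0..} (\<lambda>t::real. 0::real)"
      by (rule integral_spike[of "{0}"]) (use hz' in auto)
    then show False using n1 by (simp add: h_def)
  qed
  show ?thesis
  proof (rule exI[of _ c], rule exI[of _ M], rule exI[of _ w], rule exI[of _ h], intro conjI allI impI)
    show "w r \<le> 2 * M * rho r" "w r \<le> M * r" if "0 \<le> r" for r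
      unfolding w_def using adm_fwd_le_rho[OF adm that] adm_fwd_le_linear[OF adm that] by auto
    show "h r \<le> M * rho r" if "0 \<le> r" for r by (rule adm_le_rho[OF adm that])
    show "w 0 = 0" by (simp add: w_def)
    show "0 \<le> M" by (simp add: M_def)
  qed (fact cpos wder hder wpos h0)+
qed

section \<open>The radial profile\<close>

text \<open>\<open>P\<close> and \<open>R\<close> are the first and second derivatives of
  \<open>Q\<close> off the origin. Decay like \<open>r^(-3)\<close> gives square integrability over
  R^3, and \<open>\<bar>P r\<bar> \<le> B * r\<close> keeps \<open>P r / r\<close>, hence the second
  derivatives of \<open>Q (norm x)\<close>, bounded near the axis.\<close>

definition radial_profile :: "(real \<Rightarrow> real) \<Rightarrow> (real \<Rightarrow> real) \<Rightarrow> (real \<Rightarrow> real) \<Rightarrow> bool" where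
  "radial_profile Q P R \<longleftrightarrow>
    (\<forall>r\<ge>0. 0 < Q r) \<and> continuous_on {0<..} R \<and>
    (\<forall>r>0. (Q has_real_derivative P r) (at r) \<and> (P has_real_derivative R r) (at r)) \<and>
    (\<exists>B. \<forall>r>0. \<bar>Q r\<bar> \<le> B \<and> r ^ 3 * \<bar>Q r\<bar> \<le> B \<and> \<bar>P r\<bar> \<le> B \<and> r ^ 3 * \<bar>P r\<bar> \<le> B \<and>
      \<bar>P r\<bar> \<le> B * r \<and> \<bar>R r\<bar> \<le> B)"

theorem ground_state_profile:
  "\<exists>Q P R. radial_profile Q P R \<and> (\<forall>r>0. R r + 2 * P r / r = Q r - (Q r) ^ 3)"
proof -
  obtain c M w h where c: "0 < c" and M: "0 \<le> M" and w0: "w 0 = 0" and wpos': "\<forall>r>0. 0 < w r"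
    and sol: "\<forall>r\<ge>0. (w has_real_derivative h r - w r) (at r within {0..}) \<and>
      (h has_real_derivative h r - (w r) ^ 3 / r\<^sup>2 / c) (at r within {0..}) \<and>
      0 \<le> h r \<and> h r \<le> M * rho r \<and> w r \<le> 2 * M * rho r \<and> w r \<le> M * r"
    using nonlinear_eigenfunction by (elim exE conjE)
  have wpos: "0 < w r" if "0 < r" for r using wpos' that by simp
  have wder: "(w has_real_derivative h r - w r) (at r within {0..})"
    and hder: "(h has_real_derivative h r - (w r) ^ 3 / r\<^sup>2 / c) (at r within {0..})"
    and h0: "0 \<le> h r" and hM: "h r \<le> M * rho r"
    and wM: "w r \<le> 2 * M * rho r" and wr: "w r \<le> M * r" if "0 \<le> r" for r
    using sol[rule_format, OF that] by auto
  \<comment> \<open>Multiplying by \<open>a\<close> with \<open>a^2 = 1/c\<close> absorbs the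
    eigenvalue into the cubic term.\<close>
  define a where "a = 1 / sqrt c"
  have a: "0 < a" "a * a = 1 / c" using c by (auto simp: a_def)
  define v k where "v = (\<lambda>r. a * w r)" and "k = (\<lambda>r. a * h r)"
  define N where "N = a * M"
  define D where "D = N + N ^ 3"
  have N: "0 \<le> N" "0 \<le> D" using a M by (auto simp: N_def D_def)
  have vder: "(v has_real_derivative k r - v r) (at r within {0..})" if "0 \<le> r" for r
    unfolding v_def k_def by (rule derivative_eq_intros refl wder that)+ (simp add: algebra_simps)
  have kder: "(k has_real_derivative k r - (v r) ^ 3 / r\<^sup>2) (at r within {0..})" if "0 \<le> r" for r
  proof -
    have "a * (h r - (w r) ^ 3 / r\<^sup>2 / c) = a * h r - (a * w r) ^ 3 / r\<^sup>2"
    proof -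
      have "(a * w r) ^ 3 = a * (a * a) * (w r) ^ 3" by (simp add: power3_eq_cube)
      then show ?thesis by (simp add: a(2) right_diff_distrib)
    qed
    then show ?thesis
      unfolding v_def k_def using DERIV_cmult[OF hder[OF that], of a] by simp
  qed
  have v0: "0 \<le> v r" and k0: "0 \<le> k r" and kN: "k r \<le> N * rho r" and vN: "v r \<le> 2 * N * rho r" and vr: "v r \<le> N * r"
    if "0 \<le> r" for r
  proof -
    show "0 \<le> v r" using wpos[of r] w0 a that by (cases "r = 0") (auto simp: v_def)
    show "0 \<le> k r" using h0[OF that] a by (simp add: k_def)
    show "k r \<le> N * rho r" using mult_left_mono[OF hM[OF that], of a] a by (simp add: k_def N_def mult_ac)
    show "v r \<le> 2 * N * rho r" using mult_left_mono[OF wM[OF that], of a] a by (simp add: v_def N_def mult_ac)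
    show "v r \<le> N * r" using mult_left_mono[OF wr[OF that], of a] a by (simp add: v_def N_def mult_ac)
  qed
  \<comment> \<open>This is the second derivative of \<open>v\<close>, obtained by eliminating
    \<open>k\<close> from the system.\<close>
  define g where "g = (\<lambda>r. v r - (v r) ^ 3 / r\<^sup>2)"
  have gD: "\<bar>g r\<bar> \<le> D * r" if "0 \<le> r" for r
  proof -
    have "(v r) ^ 3 / r\<^sup>2 \<le> (N * r) ^ 3 / r\<^sup>2"
      using v0[OF that] vr[OF that] by (intro divide_right_mono power_mono) auto
    also have "\<dots> = N ^ 3 * r"
      by (cases "r = 0") (auto simp: field_simps power3_eq_cube power2_eq_square)
    finally have "(v r) ^ 3 / r\<^sup>2 \<le> N ^ 3 * r" .
    moreover have "0 \<le> (v r) ^ 3 / r\<^sup>2" using v0[OF that] by simp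
    ultimately show ?thesis
      using v0[OF that] vr[OF that] unfolding g_def D_def distrib_right by linarith
  qed
  \<comment> \<open>This is \<open>r v' - v = r^2 (v / r)'\<close>, so it becomes
    \<open>r^2 P\<close>. Its derivative is \<open>r v''\<close>, where the terms singular in the
    quotient have cancelled; with \<open>v'' = O(r)\<close> and \<open>m 0 = 0\<close> this gives
    \<open>m = O(r^3)\<close> and hence \<open>P = O(r)\<close>.\<close>
  define m where "m = (\<lambda>r. r * (k r - v r) - v r)"
  have mder: "(m has_real_derivative r * g r) (at r within {0..})" if "0 \<le> r" for r
    unfolding m_def by (rule derivative_eq_intros refl vder kder that)+ (simp add: g_def algebra_simps)
  have m_le: "\<bar>m r\<bar> \<le> D * r ^ 3" if "0 \<le> r" for r
  proof -
    have "norm (m r - m 0) \<le> (D * r\<^sup>2) * norm (r - 0)"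
    proof (rule field_differentiable_bound[of "{0..r}" m "\<lambda>t. t * g t"])
      show "(m has_field_derivative t * g t) (at t within {0..r})" if "t \<in> {0..r}" for t
        using that by (intro DERIV_subset[OF mder]) auto
      show "norm (t * g t) \<le> D * r\<^sup>2" if "t \<in> {0..r}" for t
      proof -
        have "\<bar>t\<bar> * \<bar>g t\<bar> \<le> r * (D * r)"
          using that gD[of t] N mult_left_mono[of t r D] by (intro mult_mono) auto
        then show ?thesis by (simp add: abs_mult power2_eq_square mult_ac)
      qed
    qed (use that in auto)
    then show ?thesis using w0 that by (simp add: m_def v_def power2_eq_square power3_eq_cube mult_ac)
  qed
  \<comment> \<open>The value at \<open>r = 0\<close> is arbitrary; it only has to be positive.\<close>
  define Q where "Q = (\<lambda>r. if r = 0 then 1 else v r / r)"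
  define P where "P = (\<lambda>r. m r / r\<^sup>2)"
  \<comment> \<open>Chosen so that the profile equation holds by construction; what remains to be
    checked is that \<open>R\<close> is the derivative of \<open>P\<close>.\<close>
  define R where "R = (\<lambda>r. g r / r - 2 * P r / r)"
  have at: "at r within {0..} = at r" if "0 < r" for r :: real by (rule at_within_halfline[OF that])
  have Qder: "(Q has_real_derivative P r) (at r)" if r: "0 < r" for r
  proof -
    have "(v has_real_derivative k r - v r) (at r)" using vder[of r] at[OF r] r by simp
    from DERIV_divide[OF this DERIV_ident]
    have "((\<lambda>r. v r / r) has_real_derivative P r) (at r)"
      using r by (simp add: P_def m_def power2_eq_square mult.commute)
    then show ?thesis
      by (rule has_field_derivative_transform_within_open[where S="{0<..}"]) (use r in \<open>auto simp: Q_def\<close>)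
  qed
  have Pder: "(P has_real_derivative R r) (at r)" if r: "0 < r" for r
  proof -
    have "(m has_real_derivative r * g r) (at r)" using mder[of r] at[OF r] r by simp
    moreover have "((\<lambda>r. r\<^sup>2) has_real_derivative 2 * r) (at r)"
      by (auto intro!: derivative_eq_intros)
    ultimately have "(P has_real_derivative (r * g r * r\<^sup>2 - m r * (2 * r)) / (r\<^sup>2 * r\<^sup>2)) (at r)"
      unfolding P_def by (rule DERIV_divide) (use r in simp)
    moreover have "(r * g r * r\<^sup>2 - m r * (2 * r)) / (r\<^sup>2 * r\<^sup>2) = R r"
      using r by (simp add: R_def P_def field_simps power2_eq_square)
    ultimately show ?thesis by simp
  qed
  have Qpos: "0 < Q r" if "0 \<le> r" for r using wpos[of r] a that by (simp add: Q_def v_def)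
  have eq: "R r + 2 * P r / r = Q r - (Q r) ^ 3" if "0 < r" for r
    using that by (simp add: R_def g_def Q_def field_simps power2_eq_square power3_eq_cube)
  have b1: "\<bar>Q r\<bar> \<le> N" if r: "0 < r" for r
    using v0[of r] vr[of r] r by (simp add: Q_def field_simps)
  have b2: "r ^ 3 * \<bar>Q r\<bar> \<le> 2 * N" if r: "0 < r" for r
  proof -
    have "r ^ 3 * \<bar>Q r\<bar> = r\<^sup>2 * v r" using r v0[of r] by (simp add: Q_def power2_eq_square power3_eq_cube)
    also have "\<dots> \<le> r\<^sup>2 * (2 * N * rho r)" using vN[of r] r by (intro mult_left_mono) auto
    also have "\<dots> = 2 * N * (r\<^sup>2 * rho r)" by simp
    also have "\<dots> \<le> 2 * N * 1" using N square_mult_rho_le[of r] by (intro mult_left_mono) auto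
    finally show ?thesis by simp
  qed
  have b3: "\<bar>P r\<bar> \<le> D * r" if r: "0 < r" for r
    using m_le[of r] r by (simp add: P_def power2_eq_square power3_eq_cube field_simps)
  \<comment> \<open>At infinity the cancellation in \<open>m\<close> is not exploited: the triangle
    inequality and the decay of \<open>k\<close> and \<open>v\<close> are enough.\<close>
  have b4: "r ^ 3 * \<bar>P r\<bar> \<le> 5 * N" if r: "0 < r" for r
  proof -
    have "r ^ 3 * \<bar>P r\<bar> = r * \<bar>m r\<bar>" using r by (simp add: P_def power2_eq_square power3_eq_cube)
    also have "\<dots> \<le> r * (r * (k r + v r) + v r)"
    proof (intro mult_left_mono)
      have "\<bar>r * (k r - v r)\<bar> \<le> r * (k r + v r)"
        using r k0[of r] v0[of r] by (simp add: abs_mult)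
      then show "\<bar>m r\<bar> \<le> r * (k r + v r) + v r"
        using v0[of r] r unfolding m_def by linarith
    qed (use r in auto)
    also have "\<dots> \<le> r * (r * (3 * N * rho r) + 2 * N * rho r)"
      using r kN[of r] vN[of r] by (intro mult_left_mono add_mono) auto
    also have "\<dots> = 3 * N * (r\<^sup>2 * rho r) + 2 * N * (r * rho r)"
      by (simp add: power2_eq_square algebra_simps)
    also have "\<dots> \<le> 3 * N * 1 + 2 * N * 1"
    proof (intro add_mono mult_left_mono square_mult_rho_le)
      have "0 \<le> (r - 1)\<^sup>2" by simp
      then have "r \<le> 4 + r\<^sup>2" using r by (simp add: power2_eq_square algebra_simps)
      then show "r * rho r \<le> 1" by (simp add: rho_def divide_simps add_pos_nonneg)
    qed (use N in auto)
    finally show ?thesis by simp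
  qed
  have b5: "\<bar>P r\<bar> \<le> 5 * N + D" if r: "0 < r" for r
  proof (cases "r \<le> 1")
    case True
    then have "D * r \<le> D * 1" using N by (intro mult_left_mono) auto
    then show ?thesis using b3[OF r] N by linarith
  next
    case False
    then have "1 * \<bar>P r\<bar> \<le> r ^ 3 * \<bar>P r\<bar>" by (intro mult_right_mono) auto
    then show ?thesis using b4[OF r] N by linarith
  qed
  have b6: "\<bar>R r\<bar> \<le> 3 * D" if r: "0 < r" for r
  proof -
    have "\<bar>g r / r\<bar> \<le> D" using gD[of r] r by (simp add: field_simps)
    moreover have "\<bar>P r / r\<bar> \<le> D" using b3[of r] r by (simp add: field_simps)
    ultimately show ?thesis unfolding R_def times_divide_eq_right[symmetric] by linarith
  qed
  have "continuous_on {0<..} v"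
    by (rule continuous_on_subset[OF continuous_on_halfline_derivative[OF vder]]) auto
  moreover have "continuous_on {0<..} P"
    by (rule DERIV_continuous_on[where D=R]) (simp add: has_field_derivative_at_within[OF Pder])
  ultimately have Rcont: "continuous_on {0<..} R"
    unfolding R_def g_def by (intro continuous_intros) auto
  have "radial_profile Q P R"
    unfolding radial_profile_def
  proof (intro conjI allI impI exI[of _ "5 * N + 3 * D"])
    fix r :: real assume r: "0 < r"
    note bs = b1[OF r] b2[OF r] b3[OF r] b4[OF r] b5[OF r] b6[OF r] N
    show "\<bar>Q r\<bar> \<le> 5 * N + 3 * D" using bs by linarith
    show "r ^ 3 * \<bar>Q r\<bar> \<le> 5 * N + 3 * D" using bs by linarith
    show "\<bar>P r\<bar> \<le> 5 * N + 3 * D" using bs by linarith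
    show "r ^ 3 * \<bar>P r\<bar> \<le> 5 * N + 3 * D" using bs by linarith
    show "\<bar>R r\<bar> \<le> 5 * N + 3 * D" using bs by linarith
    have "D * r \<le> (5 * N + 3 * D) * r" using N r by (intro mult_right_mono) auto
    then show "\<bar>P r\<bar> \<le> (5 * N + 3 * D) * r" using bs by linarith
  qed (use Qpos Qder Pder Rcont in auto)
  with eq show ?thesis by blast
qed

text \<open>The two parameters serve different purposes: \<open>\<kappa>\<close> will fix the mass
  and \<open>a\<close> the coefficient of the cubic term.\<close>

lemma radial_profile_scale:
  assumes "radial_profile Q P R" and a: "0 < a" and \<kappa>: "0 < \<kappa>"
  shows "radial_profile (\<lambda>r. a * Q (\<kappa> * r)) (\<lambda>r. a * \<kappa> * P (\<kappa> * r)) (\<lambda>r. a * \<kappa>\<^sup>2 * R (\<kappa> * r))"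
proof -
  obtain B where B: "\<And>r. 0 < r \<Longrightarrow> \<bar>Q r\<bar> \<le> B \<and> r ^ 3 * \<bar>Q r\<bar> \<le> B \<and> \<bar>P r\<bar> \<le> B \<and> r ^ 3 * \<bar>P r\<bar> \<le> B \<and>
      \<bar>P r\<bar> \<le> B * r \<and> \<bar>R r\<bar> \<le> B"
    and pos: "\<And>r. 0 \<le> r \<Longrightarrow> 0 < Q r" and cont: "continuous_on {0<..} R"
    and Q: "\<And>r. 0 < r \<Longrightarrow> (Q has_real_derivative P r) (at r)"
    and P: "\<And>r. 0 < r \<Longrightarrow> (P has_real_derivative R r) (at r)"
    using assms(1) unfolding radial_profile_def by metis
  have B0: "0 \<le> B" using B[of 1] by linarith
  define C where "C = a * B + a * B / \<kappa> ^ 3 + a * \<kappa> * B + a * \<kappa> * B / \<kappa> ^ 3 + a * \<kappa>\<^sup>2 * B"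
  have parts: "0 \<le> a * B" "0 \<le> a * B / \<kappa> ^ 3" "0 \<le> a * \<kappa> * B" "0 \<le> a * \<kappa> * B / \<kappa> ^ 3" "0 \<le> a * \<kappa>\<^sup>2 * B"
    using a \<kappa> B0 by simp_all
  have C: "a * B \<le> C" "a / \<kappa> ^ 3 * B \<le> C" "a * \<kappa> * B \<le> C" "a * \<kappa> / \<kappa> ^ 3 * B \<le> C" "a * \<kappa>\<^sup>2 * B \<le> C"
    unfolding C_def times_divide_eq_left using parts by linarith+
  have abs_eq: "\<bar>a * x\<bar> = a * \<bar>x\<bar>" "\<bar>a * \<kappa> * x\<bar> = a * \<kappa> * \<bar>x\<bar>" "\<bar>a * \<kappa>\<^sup>2 * x\<bar> = a * \<kappa>\<^sup>2 * \<bar>x\<bar>" for x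
    using a \<kappa> by (simp_all add: abs_mult)
  show ?thesis
    unfolding radial_profile_def
  proof (intro conjI allI impI exI[of _ C])
    show "0 < a * Q (\<kappa> * r)" if "0 \<le> r" for r using a \<kappa> pos[of "\<kappa> * r"] that by simp
    show "continuous_on {0<..} (\<lambda>r. a * \<kappa>\<^sup>2 * R (\<kappa> * r))"
      by (intro continuous_on_mult_left continuous_on_compose2[OF cont]) (use \<kappa> in \<open>auto intro: continuous_intros\<close>)
    fix r :: real assume r: "0 < r"
    then have kr: "0 < \<kappa> * r" using \<kappa> by simp
    have lin: "((*) \<kappa> has_real_derivative \<kappa>) (at r)" by (auto intro!: derivative_eq_intros)
    show "((\<lambda>r. a * Q (\<kappa> * r)) has_real_derivative a * \<kappa> * P (\<kappa> * r)) (at r)"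
      using DERIV_cmult[OF DERIV_chain2[OF Q[OF kr] lin], of a] by (simp add: mult_ac)
    show "((\<lambda>r. a * \<kappa> * P (\<kappa> * r)) has_real_derivative a * \<kappa>\<^sup>2 * R (\<kappa> * r)) (at r)"
      using DERIV_cmult[OF DERIV_chain2[OF P[OF kr] lin], of "a * \<kappa>"] by (simp add: power2_eq_square mult_ac)
    note b = B[OF kr]
    have "a * \<bar>Q (\<kappa> * r)\<bar> \<le> a * B" using b a by (intro mult_left_mono) auto
    then show "\<bar>a * Q (\<kappa> * r)\<bar> \<le> C" unfolding abs_eq using C by linarith
    have "a / \<kappa> ^ 3 * ((\<kappa> * r) ^ 3 * \<bar>Q (\<kappa> * r)\<bar>) \<le> a / \<kappa> ^ 3 * B" using b a \<kappa> by (intro mult_left_mono) auto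
    moreover have "a / \<kappa> ^ 3 * ((\<kappa> * r) ^ 3 * \<bar>Q (\<kappa> * r)\<bar>) = r ^ 3 * \<bar>a * Q (\<kappa> * r)\<bar>"
      using a \<kappa> by (simp add: abs_mult power_mult_distrib)
    ultimately show "r ^ 3 * \<bar>a * Q (\<kappa> * r)\<bar> \<le> C" using C by linarith
    have "a * \<kappa> * \<bar>P (\<kappa> * r)\<bar> \<le> a * \<kappa> * B" using b a \<kappa> by (intro mult_left_mono) auto
    then show "\<bar>a * \<kappa> * P (\<kappa> * r)\<bar> \<le> C" unfolding abs_eq using C by linarith
    have "a * \<kappa> / \<kappa> ^ 3 * ((\<kappa> * r) ^ 3 * \<bar>P (\<kappa> * r)\<bar>) \<le> a * \<kappa> / \<kappa> ^ 3 * B" using b a \<kappa> by (intro mult_left_mono) auto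
    moreover have "a * \<kappa> / \<kappa> ^ 3 * ((\<kappa> * r) ^ 3 * \<bar>P (\<kappa> * r)\<bar>) = r ^ 3 * \<bar>a * \<kappa> * P (\<kappa> * r)\<bar>"
      using a \<kappa> by (simp add: abs_mult power_mult_distrib)
    ultimately show "r ^ 3 * \<bar>a * \<kappa> * P (\<kappa> * r)\<bar> \<le> C" using C by linarith
    have "a * \<kappa> * \<bar>P (\<kappa> * r)\<bar> \<le> a * \<kappa> * (B * (\<kappa> * r))" using b a \<kappa> by (intro mult_left_mono) auto
    also have "\<dots> = a * \<kappa>\<^sup>2 * B * r" by (simp add: power2_eq_square)
    also have "\<dots> \<le> C * r" using r C by (intro mult_right_mono) auto
    finally show "\<bar>a * \<kappa> * P (\<kappa> * r)\<bar> \<le> C * r" unfolding abs_eq .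
    have "a * \<kappa>\<^sup>2 * \<bar>R (\<kappa> * r)\<bar> \<le> a * \<kappa>\<^sup>2 * B" using b a \<kappa> by (intro mult_left_mono) auto
    then show "\<bar>a * \<kappa>\<^sup>2 * R (\<kappa> * r)\<bar> \<le> C" unfolding abs_eq using C by linarith
  qed
qed

section \<open>Integration by parts on the cylinder\<close>

lemma Omega_measurable [measurable]: "Omega \<in> sets borel"
  unfolding Omega_def borel_prod[symmetric] by (intro pair_measureI) auto

lemma mem_Omega_shift [simp]: "(c, 0) + z \<in> Omega \<longleftrightarrow> z \<in> Omega"
  by (cases z) (auto simp: Omega_def)

lemma integral_lborel_translation:
  fixes f :: "'a::euclidean_space \<Rightarrow> real"
  assumes [measurable]: "f \<in> borel_measurable borel"
  shows "(LINT z|lborel. f (c + z)) = (LINT z|lborel. f z)"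
  using integral_distr[of "(+) c" lborel borel f] by (simp add: lborel_distr_plus)

lemma integrable_lborel_translation:
  fixes f :: "'a::euclidean_space \<Rightarrow> real"
  assumes "f \<in> borel_measurable borel" "integrable lborel f"
  shows "integrable lborel (\<lambda>z. f (c + z))"
  using integrable_distr_eq[of "(+) c" lborel borel f] assms by (simp add: lborel_distr_plus)

lemma AE_lborel_inner_neq_0:
  fixes b :: "'a::euclidean_space"
  assumes "b \<in> Basis"
  shows "AE z in lborel. z \<bullet> b \<noteq> 0"
proof -
  have "closed {z. z \<bullet> b = 0}"
    by (rule closed_Collect_eq) (auto intro: continuous_intros)
  then have "{z. z \<bullet> b = 0} \<in> sets lborel" by simp
  moreover have "{z. z \<bullet> b = 0} \<in> null_sets lebesgue"
    using negligible_standard_hyperplane[OF assms, of 0] negligible_iff_null_sets by blast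
  ultimately have "{z. z \<bullet> b = 0} \<in> null_sets lborel"
    using null_sets_completion_iff by blast
  then show ?thesis by (rule AE_I') auto
qed

text \<open>If \<open>x \<bullet> e'\<close> is nonzero, the whole line through \<open>x\<close> in
  direction \<open>e\<close> misses the origin. Almost every line can therefore be treated by the
  mean value theorem.\<close>

lemma exists_other_Basis_vec:
  fixes e :: "real^3"
  assumes "e \<in> Basis"
  obtains e' where "e' \<in> (Basis :: (real^3) set)" "e' \<bullet> e = 0"
proof -
  have "Basis \<noteq> {e}"
  proof
    assume "Basis = {e}"
    then have "DIM(real^3) = card {e}" by simp
    then show False by simp
  qed
  then obtain e' where "e' \<in> Basis" "e' \<noteq> e" using assms by blast
  then show ?thesis using that assms by (auto simp: inner_Basis)
qed

lemma integrable_indicator_compact: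
  assumes "compact K"
  shows "integrable lborel (\<lambda>z. indicator K z * (C::real))"
proof (rule integrable_mult_left)
  have "emeasure lborel K < \<infinity>" by (rule emeasure_bounded_finite[OF compact_imp_bounded[OF assms]])
  then show "integrable lborel (indicator K :: _ \<Rightarrow> real)"
    using compact_imp_closed[OF assms] by (intro integrable_real_indicator) auto
qed

lemma set_integrable_Omega_bounded_support:
  assumes [measurable]: "f \<in> borel_measurable borel"
    and bd: "\<And>x y. x \<noteq> 0 \<Longrightarrow> 0 \<le> y \<Longrightarrow> y \<le> 2*pi \<Longrightarrow> \<bar>f (x, y)\<bar> \<le> C"
    and supp: "\<And>x y. norm x > R \<Longrightarrow> f (x, y) = 0"
  shows "set_integrable lborel Omega (f :: pt \<Rightarrow> real)"
proof -
  let ?K = "cball (0::real^3) R \<times> {0..2*pi}"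
  have K: "compact ?K" by (intro compact_Times) auto
  have "integrable lborel (\<lambda>z. indicator ?K z * C)"
    by (rule integrable_indicator_compact[OF K])
  then show ?thesis
    unfolding set_integrable_def
  proof (rule Bochner_Integration.integrable_bound)
    obtain e where e: "e \<in> (Basis :: (real^3) set)" using nonempty_Basis by blast
    have "AE z :: pt in lborel. z \<bullet> (e, 0) \<noteq> 0"
      by (rule AE_lborel_inner_neq_0) (use e in \<open>simp add: Basis_prod_def\<close>)
    then show "AE z in lborel. norm (indicator Omega z *\<^sub>R f z) \<le> norm (indicator ?K z * C)"
    proof (rule AE_mp, intro AE_I2 impI)
      fix z :: pt assume z0: "z \<bullet> (e, 0) \<noteq> 0"
      obtain x y where z: "z = (x, y)" by (cases z)
      have x0: "x \<noteq> 0" using z0 z by auto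
      show "norm (indicator Omega z *\<^sub>R f z) \<le> norm (indicator ?K z * C)"
      proof (cases "z \<in> Omega \<and> norm x \<le> R")
        case True
        then have "z \<in> ?K" "\<bar>f z\<bar> \<le> C" using bd[OF x0, of y] z by (auto simp: Omega_def)
        then show ?thesis using True by simp
      next
        case False
        then have "indicator Omega z *\<^sub>R f z = 0" using supp[of x y] z by (auto simp: indicator_def)
        then show ?thesis by (simp only: norm_zero norm_ge_zero)
      qed
    qed
  qed measurable
qed

text \<open>The difference quotients of \<open>F\<close> have integral zero by translation invariance; lines
  through the axis \<open>x = 0\<close>, where nothing is assumed, form a null set.\<close>
lemma integral_x_derivative_eq_0:
  fixes F D :: "pt \<Rightarrow> real" and e :: "real^3"
  assumes e: "e \<in> Basis"
    and [measurable]: "F \<in> borel_measurable borel" "D \<in> borel_measurable borel"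
    and F: "set_integrable lborel Omega F"
    and der: "\<And>x y. x \<noteq> 0 \<Longrightarrow> ((\<lambda>s. F (x + s *\<^sub>R e, y)) has_real_derivative D (x, y)) (at 0)"
    and D: "\<And>x y. x \<noteq> 0 \<Longrightarrow> 0 \<le> y \<Longrightarrow> y \<le> 2*pi \<Longrightarrow> \<bar>D (x, y)\<bar> \<le> C"
    and supp: "\<And>x y. norm x > R \<Longrightarrow> F (x, y) = 0"
  shows "(LINT z:Omega|lborel. D z) = 0"
proof -
  define t where "t = (\<lambda>n. 1 / real (Suc n))"
  have t: "0 < t n" "t n \<le> 1" for n by (auto simp: t_def)
  have tlim: "t \<longlonglongrightarrow> 0" unfolding t_def by (rule lim_1_over_n[THEN LIMSEQ_Suc])
  let ?b = "(e, 0::real)"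
  define q where "q = (\<lambda>n z. indicator Omega z * ((F (t n *\<^sub>R ?b + z) - F z) / t n))"
  have normF: "integrable lborel (\<lambda>z. indicator Omega z * F z)"
    using F by (simp add: set_integrable_def)
  have q0: "(LINT z|lborel. q n z) = 0" for n
  proof -
    have sh: "indicator Omega (t n *\<^sub>R ?b + z) = (indicator Omega z :: real)" for z
      using mem_Omega_shift[of "t n *\<^sub>R e" z] by (simp add: indicator_def scaleR_prod_def)
    have eq: "q n = (\<lambda>z. (indicator Omega (t n *\<^sub>R ?b + z) * F (t n *\<^sub>R ?b + z) - indicator Omega z * F z) / t n)"
      unfolding q_def sh by (auto simp: algebra_simps diff_divide_distrib)
    have m: "(\<lambda>z. indicator Omega z * F z) \<in> borel_measurable borel" by measurable
    have "(LINT z|lborel. q n z) = ((LINT z|lborel. indicator Omega (t n *\<^sub>R ?b + z) * F (t n *\<^sub>R ?b + z))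
        - (LINT z|lborel. indicator Omega z * F z)) / t n"
      unfolding eq 
      by (simp add: Bochner_Integration.integral_diff[OF integrable_lborel_translation[OF m normF] normF])
    also have "\<dots> = 0" using integral_lborel_translation[OF m, of "t n *\<^sub>R ?b"] by simp
    finally show ?thesis .
  qed
  obtain e' where e': "e' \<in> (Basis :: (real^3) set)" "e' \<bullet> e = 0" by (rule exists_other_Basis_vec[OF e])
  have AE0: "AE z :: pt in lborel. z \<bullet> (e', 0) \<noteq> 0"
    by (rule AE_lborel_inner_neq_0) (use e' in \<open>simp add: Basis_prod_def\<close>)
  \<comment> \<open>The shifts are at most 1, so beyond radius \<open>R + 1\<close> both values of
    \<open>F\<close> in the quotient vanish.\<close>
  let ?K = "cball (0::real^3) (R+1) \<times> {0..2*pi}"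
  have K: "compact ?K" by (intro compact_Times) auto
  have "(\<lambda>n. LINT z|lborel. q n z) \<longlonglongrightarrow> (LINT z|lborel. indicator Omega z * D z)"
  proof (rule integral_dominated_convergence)
    show "integrable lborel (\<lambda>z. indicator ?K z * \<bar>C\<bar>)"
      by (rule integrable_indicator_compact[OF K])
    show "AE z in lborel. (\<lambda>n. q n z) \<longlonglongrightarrow> indicator Omega z * D z"
      using AE0
    proof (rule AE_mp, intro AE_I2 impI)
      fix z :: pt assume z0: "z \<bullet> (e', 0) \<noteq> 0"
      obtain x y where z: "z = (x, y)" by (cases z)
      have x0: "x \<noteq> 0" using z0 z by auto
      have "((\<lambda>s. (F (x + s *\<^sub>R e, y) - F (x + 0 *\<^sub>R e, y)) / (s - 0)) \<longlongrightarrow> D (x, y)) (at 0)"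
        using der[OF x0, of y] unfolding has_field_derivative_iff by simp
      moreover have "filterlim t (at 0) sequentially"
        using tlim t by (auto simp: filterlim_at intro!: always_eventually less_imp_neq[symmetric])
      ultimately have "(\<lambda>n. (F (x + t n *\<^sub>R e, y) - F (x + 0 *\<^sub>R e, y)) / (t n - 0)) \<longlonglongrightarrow> D (x, y)"
        by (rule filterlim_compose)
      then have "(\<lambda>n. indicator Omega z * ((F (x + t n *\<^sub>R e, y) - F (x + 0 *\<^sub>R e, y)) / (t n - 0)))
          \<longlonglongrightarrow> indicator Omega z * D (x, y)"
        by (intro tendsto_intros)
      then show "(\<lambda>n. q n z) \<longlonglongrightarrow> indicator Omega z * D z"
        by (simp add: q_def z add.commute)
    qed
    show "AE z in lborel. norm (q n z) \<le> indicator ?K z * \<bar>C\<bar>" for n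
      using AE0
    proof (rule AE_mp, intro AE_I2 impI)
      fix z :: pt assume z0: "z \<bullet> (e', 0) \<noteq> 0"
      obtain x y where z: "z = (x, y)" by (cases z)
      have xe: "x \<bullet> e' \<noteq> 0" using z0 z by simp
      have xs: "x + s *\<^sub>R e \<noteq> 0" for s
      proof
        assume "x + s *\<^sub>R e = 0"
        then have "(x + s *\<^sub>R e) \<bullet> e' = 0" by simp
        then show False using xe e'(2) by (simp add: inner_add_left inner_commute[of e])
      qed
      show "norm (q n z) \<le> indicator ?K z * \<bar>C\<bar>"
      proof (cases "z \<in> Omega")
        case False
        then show ?thesis by (simp add: q_def)
      next
        case True
        then have y: "0 \<le> y" "y \<le> 2*pi" using z by (auto simp: Omega_def)
        show ?thesis
        proof (cases "norm x \<le> R + 1")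
          case False
          have "norm (t n *\<^sub>R e) \<le> 1" using e t[of n] by simp
          then have "R < norm (x + t n *\<^sub>R e)" "R < norm x"
            using False norm_diff_ineq[of x "t n *\<^sub>R e"] by linarith+
          then have "q n z = 0" using supp by (simp add: q_def z add.commute)
          then show ?thesis by simp
        next
          case True
          have der': "((\<lambda>s. F (x + s *\<^sub>R e, y)) has_real_derivative D (x + s *\<^sub>R e, y)) (at s)" for s
          proof -
            have "((\<lambda>h. F (x + s *\<^sub>R e + h *\<^sub>R e, y)) has_real_derivative D (x + s *\<^sub>R e, y)) (at 0)"
              by (rule der[OF xs])
            then have "((\<lambda>h. F (x + (h + s) *\<^sub>R e, y)) has_real_derivative D (x + s *\<^sub>R e, y)) (at 0)"
              by (simp add: scaleR_add_left algebra_simps)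
            then show ?thesis using DERIV_shift[of "\<lambda>s. F (x + s *\<^sub>R e, y)" "D (x + s *\<^sub>R e, y)" 0 s] by simp
          qed
          have "norm (F (x + t n *\<^sub>R e, y) - F (x + 0 *\<^sub>R e, y)) \<le> \<bar>C\<bar> * norm (t n - 0)"
          proof (rule field_differentiable_bound[of UNIV "\<lambda>s. F (x + s *\<^sub>R e, y)" "\<lambda>s. D (x + s *\<^sub>R e, y)"])
            show "norm (D (x + s *\<^sub>R e, y)) \<le> \<bar>C\<bar>" for s
              using D[OF xs y, of s] by simp
          qed (use der' in auto)
          then have "\<bar>(F (x + t n *\<^sub>R e, y) - F (x, y)) / t n\<bar> \<le> \<bar>C\<bar>"
            using t[of n] by (simp add: divide_simps)
          moreover have "z \<in> ?K" using True y z by simp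
          ultimately show ?thesis using \<open>z \<in> Omega\<close> by (simp add: q_def z add.commute)
        qed
      qed
    qed
    show "q n \<in> borel_measurable lborel" for n unfolding q_def by measurable
  qed measurable
  then have "(\<lambda>n. 0) \<longlonglongrightarrow> (LINT z|lborel. indicator Omega z * D z)" unfolding q0 .
  then have "(LINT z|lborel. indicator Omega z * D z) = 0" using LIMSEQ_unique tendsto_const by blast
  then show ?thesis by (simp add: set_lebesgue_integral_def)
qed

text \<open>By Fubini the inner integral is taken over one period in \<open>y\<close>, where the
  coefficient is constant and the endpoint values of \<open>\<phi>\<close> cancel.\<close>

lemma integral_y_derivative_eq_0:
  fixes a :: "real^3 \<Rightarrow> real" and \<phi> \<psi> :: "pt \<Rightarrow> real"
  assumes int: "set_integrable lborel Omega (\<lambda>z. a (fst z) * \<psi> z)"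
    and der: "\<And>x y. ((\<lambda>y. \<phi> (x, y)) has_real_derivative \<psi> (x, y)) (at y)"
    and cont: "continuous_on UNIV \<psi>" and per: "\<And>x. \<phi> (x, 2*pi) = \<phi> (x, 0)"
  shows "(LINT z:Omega|lborel. a (fst z) * \<psi> z) = 0"
proof -
  have "integrable (lborel \<Otimes>\<^sub>M lborel) (\<lambda>z. indicator Omega z *\<^sub>R (a (fst z) * \<psi> z))"
    using int by (simp add: set_integrable_def lborel_prod)
  from lborel_pair.integral_fst'[OF this]
  have "(LINT z:Omega|lborel. a (fst z) * \<psi> z)
     = (LINT x|lborel. LINT y|lborel. indicator Omega (x, y) *\<^sub>R (a x * \<psi> (x, y)))"
    by (simp add: set_lebesgue_integral_def lborel_prod)
  moreover have "(LINT y|lborel. indicator Omega (x, y) *\<^sub>R (a x * \<psi> (x, y))) = 0" for x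
  proof -
    have c: "continuous_on S (\<lambda>y. \<psi> (x, y))" for S
      by (rule continuous_on_compose2[OF cont]) (auto intro: continuous_intros)
    have "set_integrable lborel {0..2*pi} (\<lambda>y. \<psi> (x, y))"
      by (rule borel_integrable_atLeastAtMost') (rule c)
    then have si: "set_integrable lborel {0..<2*pi} (\<lambda>y. \<psi> (x, y))"
      by (rule set_integrable_subset) auto
    have "((\<lambda>y. \<psi> (x, y)) has_integral (\<phi> (x, 2*pi) - \<phi> (x, 0))) {0..2*pi}"
      by (rule fundamental_theorem_of_calculus)
        (auto simp: has_real_derivative_iff_has_vector_derivative[symmetric] intro: has_field_derivative_at_within der)
    then have "((\<lambda>y. \<psi> (x, y)) has_integral 0) {0..2*pi}" using per by simp
    \<comment> \<open>The fundamental domain is half-open, the fundamental theorem needs the closed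
      interval; they differ by the null set \<open>{2*pi}\<close>.\<close>
    then have "((\<lambda>y. \<psi> (x, y)) has_integral 0) {0..<2*pi}"
    proof (rule has_integral_spike_set_eq[THEN iffD1, rotated 2])
      show "negligible {y \<in> {0..2*pi} - {0..<2*pi}. \<psi> (x, y) \<noteq> 0}"
        by (rule negligible_subset[of "{2*pi}"]) auto
      have "{y \<in> {0..<2*pi} - {0..2*pi}. \<psi> (x, y) \<noteq> 0} = {}" by auto
      then show "negligible {y \<in> {0..<2*pi} - {0..2*pi}. \<psi> (x, y) \<noteq> 0}" by (simp only: negligible_empty)
    qed
    then have "(LINT y:{0..<2*pi}|lborel. \<psi> (x, y)) = 0"
      using set_borel_integral_eq_integral(2)[OF si] by (simp add: integral_unique)
    moreover have "(LINT y|lborel. indicator Omega (x, y) *\<^sub>R (a x * \<psi> (x, y)))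
        = (LINT y|lborel. a x * (indicator {0..<2*pi} y *\<^sub>R \<psi> (x, y)))"
      by (intro Bochner_Integration.integral_cong) (auto simp: Omega_def indicator_def)
    ultimately show ?thesis by (simp add: set_lebesgue_integral_def)
  qed
  ultimately show ?thesis by simp
qed

section \<open>Test functions on the cylinder\<close>

lemma pt_Basis_cases:
  assumes "b \<in> (Basis :: pt set)"
  obtains e where "e \<in> Basis" "b = (e, 0)" | "b = (0, 1)"
  using assms by (auto simp: Basis_prod_def)

lemma test_fun_continuous: "test_fun \<phi> \<Longrightarrow> continuous_on UNIV \<phi>"
  unfolding test_fun_def smooth_def by (metis empty_subsetI list.set(1) pd_iter.simps(1))

lemma test_fun_pd_continuous: "test_fun \<phi> \<Longrightarrow> b \<in> Basis \<Longrightarrow> continuous_on UNIV (pd b \<phi>)"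
proof -
  assume "test_fun \<phi>" and b: "b \<in> Basis"
  then have "\<forall>bs. set bs \<subseteq> Basis \<longrightarrow> continuous_on UNIV (pd_iter bs \<phi>)"
    unfolding test_fun_def smooth_def by blast
  from this[rule_format, of "[b]"] b show ?thesis by simp
qed

lemma test_fun_has_derivative:
  assumes "test_fun \<phi>" "b \<in> Basis"
  shows "((\<lambda>s. \<phi> (z + s *\<^sub>R b)) has_real_derivative pd b \<phi> z) (at 0)"
proof -
  have "\<forall>bs. set bs \<subseteq> Basis \<longrightarrow> (\<forall>b\<in>Basis. \<forall>z. (\<lambda>t. pd_iter bs \<phi> (z + t *\<^sub>R b)) differentiable (at 0))"
    using assms unfolding test_fun_def smooth_def by blast
  from this[rule_format, of "[]" b z] assms
  have "(\<lambda>t. \<phi> (z + t *\<^sub>R b)) field_differentiable (at 0)"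
    by (simp add: field_differentiable_def real_differentiable_def)
  then show ?thesis unfolding pd_def by (simp only: DERIV_deriv_iff_field_differentiable)
qed

lemma test_fun_support:
  assumes "test_fun \<phi>"
  obtains R where "\<And>x y. R < norm x \<Longrightarrow> \<phi> (x, y) = 0"
    "\<And>b x y. b \<in> Basis \<Longrightarrow> R < norm x \<Longrightarrow> pd b \<phi> (x, y) = 0"
proof -
  obtain R where R: "\<And>x y. R < norm x \<Longrightarrow> \<phi> (x, y) = 0"
    using assms unfolding test_fun_def by blast
  have R': "\<phi> z = 0" if "R < norm (fst z)" for z
    using R[of "fst z" "snd z"] that by simp
  have "pd b \<phi> (x, y) = 0" if b: "b \<in> Basis" and x: "R < norm x" for b x y
  proof -
    \<comment> \<open>The strict inequality is an open condition, so \<open>\<phi>\<close> vanishes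
      on a piece of the line around the point and the same radius serves for all first
      derivatives.\<close>
    have "open {s. R < norm (fst ((x, y) + s *\<^sub>R b))}"
      by (intro open_Collect_less continuous_intros)
    then have "((\<lambda>s. \<phi> ((x, y) + s *\<^sub>R b)) has_real_derivative 0) (at 0)"
      by (rule has_field_derivative_transform_within_open[OF DERIV_const[of 0]])
        (use x R' in auto)
    with test_fun_has_derivative[OF assms b, of "(x, y)"] show ?thesis by (rule DERIV_unique)
  qed
  with R show ?thesis by (rule that)
qed

lemma bounded_of_x_support:
  fixes g :: "pt \<Rightarrow> real"
  assumes "continuous_on UNIV g" and supp: "\<And>x y. R < norm x \<Longrightarrow> g (x, y) = 0"
  shows "\<exists>C\<ge>0. \<forall>x y. 0 \<le> y \<longrightarrow> y \<le> 2*pi \<longrightarrow> \<bar>g (x, y)\<bar> \<le> C"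
proof -
  let ?K = "cball (0::real^3) R \<times> {0..2*pi}"
  have "compact (g ` ?K)"
    by (intro compact_continuous_image compact_Times continuous_on_subset[OF assms(1)]) auto
  then obtain C where C: "\<And>z. z \<in> ?K \<Longrightarrow> norm (g z) \<le> C"
    using bounded_iff compact_imp_bounded by (metis imageI)
  have "\<bar>g (x, y)\<bar> \<le> max C 0" if "0 \<le> y" "y \<le> 2*pi" for x y
  proof (cases "R < norm x")
    case True
    then show ?thesis using supp by simp
  next
    case False
    then show ?thesis using C[of "(x, y)"] that by auto
  qed
  then show ?thesis by (intro exI[of _ "max C 0"]) auto
qed

section \<open>Radial functions: derivatives of the norm, measurability, square
  integrability\<close>

lemma norm_line_has_derivative:
  fixes x e :: "'a::real_inner"
  assumes "x \<noteq> 0"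
  shows "((\<lambda>s. norm (x + s *\<^sub>R e)) has_real_derivative (x \<bullet> e) / norm x) (at 0)"
proof -
  have eq: "norm (x + s *\<^sub>R e) = sqrt (x \<bullet> x + 2 * s * (x \<bullet> e) + s\<^sup>2 * (e \<bullet> e))" for s
  proof -
    have "(x + s *\<^sub>R e) \<bullet> (x + s *\<^sub>R e) = x \<bullet> x + 2 * s * (x \<bullet> e) + s\<^sup>2 * (e \<bullet> e)"
      by (simp add: inner_add_left inner_add_right inner_commute[of e x] power2_eq_square distrib_left)
    then show ?thesis by (simp only: norm_eq_sqrt_inner)
  qed
  have pos: "0 < x \<bullet> x + 2 * 0 * (x \<bullet> e) + 0\<^sup>2 * (e \<bullet> e)" using assms by simp
  have "((\<lambda>s. x \<bullet> x + 2 * s * (x \<bullet> e) + s\<^sup>2 * (e \<bullet> e)) has_real_derivative 2 * (x \<bullet> e)) (at 0)"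
    by (auto intro!: derivative_eq_intros)
  from DERIV_chain2[OF DERIV_real_sqrt[OF pos] this]
  show ?thesis unfolding eq using assms by (simp add: norm_eq_sqrt_inner field_simps)
qed

lemma borel_measurable_radial:
  assumes "continuous_on {0<..} f"
  shows "(\<lambda>z::pt. f (norm (fst z)) :: real) \<in> borel_measurable borel"
proof -
  have [measurable]: "(\<lambda>r. indicator {0<..} r *\<^sub>R f r) \<in> borel_measurable borel"
    by (rule borel_measurable_continuous_on_indicator) (use assms in auto)
  have "(\<lambda>z::pt. f (norm (fst z))) = (\<lambda>z. indicator {0<..} (norm (fst z)) *\<^sub>R f (norm (fst z)) + (if norm (fst z) = 0 then f 0 else 0))"
    by (auto simp: indicator_def)
  moreover have "\<dots> \<in> borel_measurable borel"
  proof -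
    have [measurable]: "(\<lambda>z::pt. norm (fst z)) \<in> borel_measurable borel"
      by (intro borel_measurable_continuous_onI continuous_intros)
    show ?thesis by measurable
  qed
  ultimately show ?thesis by simp
qed

text \<open>A majorant in product form lets Tonelli reduce integrability over R^3 to that of
  \<open>1 / (1 + t^2)\<close> on the line, bypassing polar coordinates.\<close>

lemma integrable_product_weight:
  "integrable lborel (\<lambda>z::pt. (\<Prod>e\<in>Basis. 1 / (1 + (fst z \<bullet> e)\<^sup>2)) * indicator {0..<2*pi} (snd z))"
proof (rule integrableI_bounded)
  define f where "f = (\<lambda>b::pt. if b = (0, 1) then indicator {0..<2*pi} else (\<lambda>t::real. 1 / (1 + t\<^sup>2)))"
  have [measurable]: "f b \<in> borel_measurable borel" for b unfolding f_def by (cases "b = (0, 1)") simp_all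
  have nn: "0 \<le> f b t" for b t unfolding f_def by (simp add: add_nonneg_nonneg)
  have fin: "(\<integral>\<^sup>+t. ennreal (f b t) \<partial>lborel) < \<infinity>" for b
  proof (cases "b = (0, 1)")
    case True
    then show ?thesis by (simp add: f_def ennreal_indicator)
  next
    case False
    have "integrable lborel (\<lambda>t::real. 1 / (1 + t\<^sup>2))"
      using integrable_inverse_1_plus_square by (simp add: set_integrable_def inverse_eq_divide)
    then show ?thesis
      using False by (simp add: f_def integrable_iff_bounded add_nonneg_nonneg)
  qed
  have prod: "(\<Prod>b\<in>Basis. f b (z \<bullet> b)) = (\<Prod>e\<in>Basis. 1 / (1 + (fst z \<bullet> e)\<^sup>2)) * indicator {0..<2*pi} (snd z)" for z :: pt
  proof -
    have "(\<Prod>b\<in>Basis. f b (z \<bullet> b)) = (\<Prod>b\<in>(\<lambda>e. (e, 0)) ` Basis. f b (z \<bullet> b)) * (\<Prod>b\<in>{(0, 1)}. f b (z \<bullet> b))"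
      unfolding Basis_prod_def by (subst prod.union_disjoint) auto
    also have "(\<Prod>b\<in>(\<lambda>e. (e, 0)) ` Basis. f b (z \<bullet> b)) = (\<Prod>e\<in>Basis. f (e, 0) (z \<bullet> (e, 0)))"
      by (subst prod.reindex) (auto simp: inj_on_def)
    finally show ?thesis by (cases z) (simp add: f_def)
  qed
  show "(\<lambda>z::pt. (\<Prod>e\<in>Basis. 1 / (1 + (fst z \<bullet> e)\<^sup>2)) * indicator {0..<2*pi} (snd z)) \<in> borel_measurable lborel"
    unfolding prod[symmetric] by measurable
  have "(\<integral>\<^sup>+z. ennreal (\<Prod>b\<in>Basis. f b (z \<bullet> b)) \<partial>lborel) = (\<integral>\<^sup>+z. (\<Prod>b\<in>Basis. ennreal (f b (z \<bullet> b))) \<partial>lborel)"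
    by (intro nn_integral_cong) (simp add: prod_ennreal nn)
  also have "\<dots> = (\<Prod>b\<in>(Basis::pt set). \<integral>\<^sup>+t. ennreal (f b t) \<partial>lborel)"
    by (rule nn_integral_lborel_prod) auto
  also have "\<dots> < \<infinity>"
  proof -
    have "(\<Prod>b\<in>A. \<integral>\<^sup>+t. ennreal (f b t) \<partial>lborel) < \<infinity>" for A
      by (induction A rule: infinite_finite_induct) (use fin in \<open>auto simp: ennreal_mult_less_top\<close>)
    then show ?thesis .
  qed
  finally show "(\<integral>\<^sup>+z. ennreal (norm ((\<Prod>e\<in>(Basis :: (real^3) set). 1 / (1 + (fst z \<bullet> e)\<^sup>2)) * indicator {0..<2*pi} (snd z))) \<partial>lborel) < \<infinity>"
    by (simp add: prod abs_mult abs_prod add_nonneg_nonneg)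
qed

lemma set_integrable_decay_square:
  fixes f :: "pt \<Rightarrow> real"
  assumes [measurable]: "f \<in> borel_measurable borel"
    and b1: "\<And>x y. x \<noteq> 0 \<Longrightarrow> \<bar>f (x, y)\<bar> \<le> B" and b2: "\<And>x y. x \<noteq> 0 \<Longrightarrow> norm x ^ 3 * \<bar>f (x, y)\<bar> \<le> B"
  shows "set_integrable lborel Omega (\<lambda>z. (f z)\<^sup>2)"
proof -
  let ?g = "\<lambda>z::pt. (\<Prod>e\<in>Basis. 1 / (1 + (fst z \<bullet> e)\<^sup>2)) * indicator {0..<2*pi} (snd z)"
  have "integrable lborel (\<lambda>z. 8 * B\<^sup>2 * ?g z)"
    by (intro integrable_mult_right integrable_product_weight)
  then show ?thesis
    unfolding set_integrable_def
  proof (rule Bochner_Integration.integrable_bound)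
    obtain e0 where e0: "e0 \<in> (Basis :: (real^3) set)" using nonempty_Basis by blast
    have "AE z :: pt in lborel. z \<bullet> (e0, 0) \<noteq> 0"
      by (rule AE_lborel_inner_neq_0) (use e0 in \<open>simp add: Basis_prod_def\<close>)
    then show "AE z in lborel. norm (indicator Omega z *\<^sub>R (f z)\<^sup>2) \<le> norm (8 * B\<^sup>2 * ?g z)"
    proof (rule AE_mp, intro AE_I2 impI)
      fix z :: pt assume z0: "z \<bullet> (e0, 0) \<noteq> 0"
      obtain x y where z: "z = (x, y)" by (cases z)
      have x0: "x \<noteq> 0" using z0 z by auto
      define r where "r = norm x"
      have r: "0 \<le> r" by (simp add: r_def)
      have f1: "(f z)\<^sup>2 \<le> B\<^sup>2" using b1[OF x0, of y] z by (metis abs_ge_zero power_mono power2_abs)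
      have "(r ^ 3 * \<bar>f z\<bar>)\<^sup>2 \<le> B\<^sup>2" using b2[OF x0, of y] z r unfolding r_def by (intro power_mono) auto
      then have f2: "r ^ 6 * (f z)\<^sup>2 \<le> B\<^sup>2" by (simp add: power_mult_distrib flip: power_mult)
      \<comment> \<open>Convexity of the cube, applied to the mean of 1 and \<open>r^2\<close>. The
        exponent 3 matches the dimension, so that \<open>1 / (1 + r^2)^3\<close> splits below into
        one factor per coordinate direction.\<close>
      have conv: "(1 + r\<^sup>2) ^ 3 \<le> 4 * (1 + r ^ 6)"
      proof -
        have "4 * (1 + r ^ 6) - (1 + r\<^sup>2) ^ 3 = 3 * ((1 - r\<^sup>2)\<^sup>2 * (1 + r\<^sup>2))"
          by (simp add: power2_eq_square power3_eq_cube eval_nat_numeral algebra_simps)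
        also have "\<dots> \<ge> 0" by (intro mult_nonneg_nonneg add_nonneg_nonneg) auto
        finally show ?thesis by simp
      qed
      have pos: "0 < (1 + r\<^sup>2) ^ 3" by (simp add: add_pos_nonneg)
      have "(1 + r\<^sup>2) ^ 3 * (f z)\<^sup>2 \<le> 4 * (1 + r ^ 6) * (f z)\<^sup>2"
        using conv by (intro mult_right_mono) auto
      also have "\<dots> = 4 * ((f z)\<^sup>2 + r ^ 6 * (f z)\<^sup>2)" by (simp add: algebra_simps)
      also have "\<dots> \<le> 8 * B\<^sup>2" using f1 f2 by simp
      finally have "(f z)\<^sup>2 \<le> 8 * B\<^sup>2 * (1 / (1 + r\<^sup>2) ^ 3)"
        using pos by (simp add: field_simps)
      also have "1 / (1 + r\<^sup>2) ^ 3 = (\<Prod>e\<in>(Basis::(real^3) set). 1 / (1 + r\<^sup>2))"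
        by (simp add: power_divide)
      also have "8 * B\<^sup>2 * \<dots> \<le> 8 * B\<^sup>2 * (\<Prod>e\<in>Basis. 1 / (1 + (x \<bullet> e)\<^sup>2))"
      proof (intro mult_left_mono prod_mono conjI divide_left_mono add_left_mono mult_pos_pos)
        fix e :: "real^3" assume "e \<in> Basis"
        then have "\<bar>x \<bullet> e\<bar> \<le> r" unfolding r_def by (rule Basis_le_norm)
        then show "(x \<bullet> e)\<^sup>2 \<le> r\<^sup>2" using r by (simp add: abs_le_square_iff[symmetric])
      qed (auto simp: add_pos_nonneg add_nonneg_nonneg)
      finally have main: "(f z)\<^sup>2 \<le> 8 * B\<^sup>2 * (\<Prod>e\<in>Basis. 1 / (1 + (x \<bullet> e)\<^sup>2))" .
      show "norm (indicator Omega z *\<^sub>R (f z)\<^sup>2) \<le> norm (8 * B\<^sup>2 * ?g z)"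
      proof (cases "z \<in> Omega")
        case True
        then have "indicator {0..<2*pi} y = (1::real)" using z by (simp add: Omega_def)
        then show ?thesis using main True z by (simp add: order_trans[OF _ abs_ge_self])
      next
        case False
        then show ?thesis by simp
      qed
    qed
  qed measurable
qed

lemma L2_of_decay:
  assumes "f \<in> borel_measurable borel"
    and "\<And>x y. x \<noteq> 0 \<Longrightarrow> \<bar>f (x, y)\<bar> \<le> B" and "\<And>x y. x \<noteq> 0 \<Longrightarrow> norm x ^ 3 * \<bar>f (x, y)\<bar> \<le> B"
  shows "L2 f"
  unfolding L2_def
proof
  show "(\<lambda>z. (f z)\<^sup>2) integrable_on Omega"
    by (rule set_borel_integral_eq_integral(1)[OF set_integrable_decay_square[OF assms]])
  have "Omega \<in> sets lebesgue" using Omega_measurable by simp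
  then show "f measurable_on Omega"
    using assms(1) by (intro lebesgue_measurable_imp_measurable_on measurable_completion) auto
qed

lemma set_integrable_times_test:
  fixes a \<psi> :: "pt \<Rightarrow> real"
  assumes "a \<in> borel_measurable borel" and aB: "\<And>x y. x \<noteq> 0 \<Longrightarrow> \<bar>a (x, y)\<bar> \<le> A"
    and cont: "continuous_on UNIV \<psi>" and supp: "\<And>x y. K < norm x \<Longrightarrow> \<psi> (x, y) = 0"
  shows "set_integrable lborel Omega (\<lambda>z. a z * \<psi> z)"
proof -
  obtain C where C0: "\<forall>x y. 0 \<le> y \<longrightarrow> y \<le> 2*pi \<longrightarrow> \<bar>\<psi> (x, y)\<bar> \<le> C" "0 \<le> C"
    using bounded_of_x_support[of \<psi> K, OF cont supp] by blast
  note C = C0(2) C0(1)[rule_format]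
  show ?thesis
  proof (rule set_integrable_Omega_bounded_support[where C="A * C" and R=K])
    show "(\<lambda>z. a z * \<psi> z) \<in> borel_measurable borel"
      by (intro borel_measurable_times assms(1) borel_measurable_continuous_onI cont)
    show "\<bar>a (x, y) * \<psi> (x, y)\<bar> \<le> A * C" if "x \<noteq> 0" "0 \<le> y" "y \<le> 2*pi" for x y
      unfolding abs_mult using aB[OF that(1), of y] C(2)[OF that(2,3), of x] by (intro mult_mono) auto
  qed (simp add: supp)
qed

text \<open>The \<open>x\<close>-derivative of \<open>a * \<phi>\<close> has integral zero. Bounds
  on \<open>a\<close> and \<open>a'\<close> off the axis exclude a boundary contribution from
  \<open>x = 0\<close>, so a coefficient may be singular there.\<close>

lemma integral_by_parts_x:
  fixes a a' :: "pt \<Rightarrow> real"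
  assumes \<phi>: "test_fun \<phi>" and e: "e \<in> Basis"
    and am [measurable]: "a \<in> borel_measurable borel" and am' [measurable]: "a' \<in> borel_measurable borel"
    and aB: "\<And>x y. x \<noteq> 0 \<Longrightarrow> \<bar>a (x, y)\<bar> \<le> A" and aB': "\<And>x y. x \<noteq> 0 \<Longrightarrow> \<bar>a' (x, y)\<bar> \<le> A"
    and der: "\<And>x y. x \<noteq> 0 \<Longrightarrow> ((\<lambda>s. a (x + s *\<^sub>R e, y)) has_real_derivative a' (x, y)) (at 0)"
  shows "set_integrable lborel Omega (\<lambda>z. a z * pd (e, 0) \<phi> z)" "set_integrable lborel Omega (\<lambda>z. a' z * \<phi> z)"
    "(LINT z:Omega|lborel. a z * pd (e, 0) \<phi> z) = - (LINT z:Omega|lborel. a' z * \<phi> z)"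
proof -
  have b: "(e, 0) \<in> (Basis :: pt set)" using e by (simp add: Basis_prod_def)
  obtain K where K: "\<And>x y. K < norm x \<Longrightarrow> \<phi> (x, y) = 0"
      "\<And>b x y. b \<in> Basis \<Longrightarrow> K < norm x \<Longrightarrow> pd b \<phi> (x, y) = 0"
    by (rule test_fun_support[OF \<phi>]) (rule that; assumption)
  note c\<phi> = test_fun_continuous[OF \<phi>] and cpd = test_fun_pd_continuous[OF \<phi> b]
  have [measurable]: "\<phi> \<in> borel_measurable borel" "pd (e, 0) \<phi> \<in> borel_measurable borel"
    by (intro borel_measurable_continuous_onI c\<phi> cpd)+
  show i1: "set_integrable lborel Omega (\<lambda>z. a z * pd (e, 0) \<phi> z)"
    by (rule set_integrable_times_test[of a A "pd (e, 0) \<phi>" K, OF am aB cpd K(2)[OF b]])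
  show i2: "set_integrable lborel Omega (\<lambda>z. a' z * \<phi> z)"
    by (rule set_integrable_times_test[of a' A \<phi> K, OF am' aB' c\<phi> K(1)])
  have i0: "set_integrable lborel Omega (\<lambda>z. a z * \<phi> z)"
    by (rule set_integrable_times_test[of a A \<phi> K, OF am aB c\<phi> K(1)])
  obtain C1 where C10: "\<forall>x y. 0 \<le> y \<longrightarrow> y \<le> 2*pi \<longrightarrow> \<bar>\<phi> (x, y)\<bar> \<le> C1" "0 \<le> C1"
    using bounded_of_x_support[of \<phi> K, OF c\<phi> K(1)] by blast
  note C1 = C10(2) C10(1)[rule_format]
  obtain C2 where C20: "\<forall>x y. 0 \<le> y \<longrightarrow> y \<le> 2*pi \<longrightarrow> \<bar>pd (e, 0) \<phi> (x, y)\<bar> \<le> C2" "0 \<le> C2"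
    using bounded_of_x_support[of "pd (e, 0) \<phi>" K, OF cpd K(2)[OF b]] by blast
  note C2 = C20(2) C20(1)[rule_format]
  have "(LINT z:Omega|lborel. a z * pd (e, 0) \<phi> z + a' z * \<phi> z) = 0"
  proof (rule integral_x_derivative_eq_0[OF e, where F="\<lambda>z. a z * \<phi> z" and C="A * C2 + A * C1" and R=K])
    fix x y assume x: "(x::real^3) \<noteq> 0"
    have "((\<lambda>s. \<phi> (x + s *\<^sub>R e, y)) has_real_derivative pd (e, 0) \<phi> (x, y)) (at 0)"
      using test_fun_has_derivative[OF \<phi> b, of "(x, y)"] by simp
    from DERIV_mult[OF der[OF x] this]
    show "((\<lambda>s. a (x + s *\<^sub>R e, y) * \<phi> (x + s *\<^sub>R e, y)) has_real_derivative
        a (x, y) * pd (e, 0) \<phi> (x, y) + a' (x, y) * \<phi> (x, y)) (at 0)"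
      by (simp add: mult.commute add.commute)
    assume y: "0 \<le> y" "y \<le> 2*pi"
    have "\<bar>a (x, y) * pd (e, 0) \<phi> (x, y)\<bar> \<le> A * C2" "\<bar>a' (x, y) * \<phi> (x, y)\<bar> \<le> A * C1"
      unfolding abs_mult using aB[OF x, of y] aB'[OF x, of y] C1(2)[OF y, of x] C2(2)[OF y, of x]
      by (auto intro!: mult_mono)
    then show "\<bar>a (x, y) * pd (e, 0) \<phi> (x, y) + a' (x, y) * \<phi> (x, y)\<bar> \<le> A * C2 + A * C1"
      by linarith
  qed (use K(1) i0 in \<open>simp_all\<close>)
  then show "(LINT z:Omega|lborel. a z * pd (e, 0) \<phi> z) = - (LINT z:Omega|lborel. a' z * \<phi> z)"
    using set_integral_add(2)[OF i1 i2] by simp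
qed

section \<open>Radial weak solutions\<close>

definition radial :: "(real \<Rightarrow> real) \<Rightarrow> pt \<Rightarrow> real" where
  "radial Q z = Q (norm (fst z))"

definition radial_grad :: "(real \<Rightarrow> real) \<Rightarrow> pt \<Rightarrow> pt" where
  "radial_grad P z = ((P (norm (fst z)) / norm (fst z)) *\<^sub>R fst z, 0)"

text \<open>The diagonal entry in direction \<open>e\<close> of the Hessian of a radial function:
  eigenvalue \<open>R\<close> along the radius and \<open>P / r\<close> across it, weighted by the
  squared direction cosine. The trace over three directions is \<open>R + 2 P / r\<close>.\<close>

definition radial_second :: "(real \<Rightarrow> real) \<Rightarrow> (real \<Rightarrow> real) \<Rightarrow> real^3 \<Rightarrow> pt \<Rightarrow> real" where
  "radial_second P R e z = R (norm (fst z)) * ((fst z \<bullet> e) / norm (fst z))\<^sup>2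
     + P (norm (fst z)) / norm (fst z) * (1 - ((fst z \<bullet> e) / norm (fst z))\<^sup>2)"

lemma sum_radial_second:
  assumes "x \<noteq> 0"
  shows "(\<Sum>e\<in>Basis. radial_second P R e (x, y)) = R (norm x) + 2 * P (norm x) / norm x"
proof -
  have "(\<Sum>e\<in>Basis. ((x \<bullet> e) / norm x)\<^sup>2) = (\<Sum>e\<in>Basis. (x \<bullet> e)\<^sup>2) / (norm x)\<^sup>2"
    by (simp add: power_divide sum_divide_distrib)
  also have "(\<Sum>e\<in>Basis. (x \<bullet> e)\<^sup>2) = (norm x)\<^sup>2"
    unfolding power2_norm_eq_inner unfolding power2_eq_square by (rule euclidean_inner[symmetric])
  finally have s: "(\<Sum>e\<in>Basis. ((x \<bullet> e) / norm x)\<^sup>2) = 1" using assms by simp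
  have "(\<Sum>e\<in>Basis. radial_second P R e (x, y)) =
      R (norm x) * (\<Sum>e\<in>Basis. ((x \<bullet> e) / norm x)\<^sup>2)
      + P (norm x) / norm x * ((\<Sum>e\<in>(Basis :: (real^3) set). 1) - (\<Sum>e\<in>Basis. ((x \<bullet> e) / norm x)\<^sup>2))"
    unfolding radial_second_def fst_conv
    by (simp only: sum.distrib sum_distrib_left[symmetric] sum_subtractf)
  also have "\<dots> = R (norm x) + P (norm x) / norm x * (3 - 1)" unfolding s by simp
  finally show ?thesis by simp
qed

lemma set_integral_finite_sum:
  fixes f :: "'i \<Rightarrow> 'a \<Rightarrow> real"
  assumes "\<And>i. i \<in> I \<Longrightarrow> set_integrable M A (f i)"
  shows "set_integrable M A (\<lambda>x. \<Sum>i\<in>I. f i x)"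
    "(LINT x:A|M. \<Sum>i\<in>I. f i x) = (\<Sum>i\<in>I. LINT x:A|M. f i x)"
  using assms unfolding set_integrable_def set_lebesgue_integral_def scaleR_sum_right
  by (auto intro: Bochner_Integration.integrable_sum Bochner_Integration.integral_sum)

lemma sum_pt_Basis:
  fixes g :: "pt \<Rightarrow> real"
  shows "(\<Sum>b\<in>Basis. g b) = (\<Sum>e\<in>Basis. g (e, 0)) + g (0, 1)"
proof -
  have "(\<Sum>b\<in>Basis. g b) = (\<Sum>b\<in>(\<lambda>e. (e, 0)) ` Basis. g b) + (\<Sum>b\<in>{(0, 1)}. g b)"
    unfolding Basis_prod_def by (subst sum.union_disjoint) auto
  also have "(\<Sum>b\<in>(\<lambda>e. (e, 0)) ` Basis. g b) = (\<Sum>e\<in>Basis. g (e, 0))"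
    by (subst sum.reindex) (auto simp: inj_on_def)
  finally show ?thesis by simp
qed

context
  fixes Q P R :: "real \<Rightarrow> real"
  assumes prof: "radial_profile Q P R"
begin

lemma profile_has_derivative: "0 < r \<Longrightarrow> (Q has_real_derivative P r) (at r)"
  and profile_deriv_has_derivative: "0 < r \<Longrightarrow> (P has_real_derivative R r) (at r)"
  and continuous_on_profile_second: "continuous_on {0<..} R"
  using prof unfolding radial_profile_def by auto

lemma continuous_on_profile: "continuous_on {0<..} Q"
  by (rule DERIV_continuous_on[where D=P]) (simp add: has_field_derivative_at_within[OF profile_has_derivative])

lemma continuous_on_profile_deriv: "continuous_on {0<..} P"
  by (rule DERIV_continuous_on[where D=R]) (simp add: has_field_derivative_at_within[OF profile_deriv_has_derivative])

lemma radial_measurable [measurable]: "radial Q \<in> borel_measurable borel"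
  unfolding radial_def by (rule borel_measurable_radial[OF continuous_on_profile])

lemma radial_grad_inner: "radial_grad P z \<bullet> (e, t) = P (norm (fst z)) / norm (fst z) * (fst z \<bullet> e)"
  by (simp add: radial_grad_def)

lemma radial_grad_measurable [measurable]: "(\<lambda>z. radial_grad P z \<bullet> (e, t)) \<in> borel_measurable borel"
proof -
  note [measurable] = borel_measurable_radial[OF continuous_on_profile_deriv]
  have [measurable]: "(\<lambda>z::pt. norm (fst z)) \<in> borel_measurable borel" "(\<lambda>z::pt. fst z \<bullet> e) \<in> borel_measurable borel"
    by (intro borel_measurable_continuous_onI continuous_intros)+
  show ?thesis unfolding radial_grad_inner by measurable
qed

lemma radial_second_measurable [measurable]: "radial_second P R e \<in> borel_measurable borel"
proof -
  note [measurable] = borel_measurable_radial[OF continuous_on_profile_deriv] borel_measurable_radial[OF continuous_on_profile_second]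
  have [measurable]: "(\<lambda>z::pt. norm (fst z)) \<in> borel_measurable borel" "(\<lambda>z::pt. fst z \<bullet> e) \<in> borel_measurable borel"
    by (intro borel_measurable_continuous_onI continuous_intros)+
  show ?thesis unfolding radial_second_def[abs_def] by measurable
qed

lemma radial_bounds:
  obtains B where "0 \<le> B"
    "\<And>x y. x \<noteq> 0 \<Longrightarrow> \<bar>radial Q (x, y)\<bar> \<le> B" "\<And>x y. x \<noteq> 0 \<Longrightarrow> norm x ^ 3 * \<bar>radial Q (x, y)\<bar> \<le> B"
    "\<And>x y e t. x \<noteq> 0 \<Longrightarrow> e \<in> Basis \<Longrightarrow> \<bar>radial_grad P (x, y) \<bullet> (e, t)\<bar> \<le> B"
    "\<And>x y e t. x \<noteq> 0 \<Longrightarrow> e \<in> Basis \<Longrightarrow> norm x ^ 3 * \<bar>radial_grad P (x, y) \<bullet> (e, t)\<bar> \<le> B"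
    "\<And>x y e. x \<noteq> 0 \<Longrightarrow> e \<in> Basis \<Longrightarrow> \<bar>radial_second P R e (x, y)\<bar> \<le> 2 * B"
proof -
  obtain B where B: "\<forall>r>0. \<bar>Q r\<bar> \<le> B \<and> r ^ 3 * \<bar>Q r\<bar> \<le> B \<and> \<bar>P r\<bar> \<le> B \<and> r ^ 3 * \<bar>P r\<bar> \<le> B \<and>
      \<bar>P r\<bar> \<le> B * r \<and> \<bar>R r\<bar> \<le> B"
    using prof unfolding radial_profile_def by (elim conjE exE)
  have B0: "0 \<le> B" using B[rule_format, of 1] by linarith
  have ratio: "\<bar>(x \<bullet> e) / norm x\<bar> \<le> 1" if "x \<noteq> 0" "e \<in> Basis" for x e :: "real^3"
    using Basis_le_norm[OF that(2), of x] that by (simp add: divide_simps)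
  have gr: "\<bar>radial_grad P (x, y) \<bullet> (e, t)\<bar> \<le> \<bar>P (norm x)\<bar>" if "x \<noteq> 0" "e \<in> Basis" for x e y t
  proof -
    have "radial_grad P (x, y) \<bullet> (e, t) = P (norm x) * ((x \<bullet> e) / norm x)"
      unfolding radial_grad_inner by simp
    then show ?thesis using mult_left_mono[OF ratio[OF that], of "\<bar>P (norm x)\<bar>"] by (simp add: abs_mult)
  qed
  show ?thesis
  proof (rule that[OF B0])
    fix x :: "real^3" and y t :: real and e :: "real^3"
    assume x: "x \<noteq> 0"
    then have b: "0 < norm x" by simp
    note b = B[rule_format, OF b]
    show "\<bar>radial Q (x, y)\<bar> \<le> B" "norm x ^ 3 * \<bar>radial Q (x, y)\<bar> \<le> B" using b by (simp_all add: radial_def)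
    assume e: "e \<in> Basis"
    show "\<bar>radial_grad P (x, y) \<bullet> (e, t)\<bar> \<le> B" using gr[OF x e, of y t] b by linarith
    have "norm x ^ 3 * \<bar>radial_grad P (x, y) \<bullet> (e, t)\<bar> \<le> norm x ^ 3 * \<bar>P (norm x)\<bar>"
      by (intro mult_left_mono gr[OF x e]) simp
    then show "norm x ^ 3 * \<bar>radial_grad P (x, y) \<bullet> (e, t)\<bar> \<le> B" using b by linarith
    define q where "q = ((x \<bullet> e) / norm x)\<^sup>2"
    have q: "0 \<le> q" "q \<le> 1" using ratio[OF x e] by (simp_all only: q_def abs_square_le_1 zero_le_power2)
    have "\<bar>R (norm x) * q\<bar> \<le> B * 1"
      unfolding abs_mult using b q B0 by (intro mult_mono) auto
    moreover have "\<bar>P (norm x) / norm x\<bar> \<le> B" using b x by (simp add: divide_simps)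
    then have "\<bar>P (norm x) / norm x * (1 - q)\<bar> \<le> B * 1"
      unfolding abs_mult[of _ "1 - q"] using q B0 by (intro mult_mono) auto
    ultimately show "\<bar>radial_second P R e (x, y)\<bar> \<le> 2 * B"
      unfolding radial_second_def fst_conv q_def[symmetric] by linarith
  qed
qed

lemma radial_line_derivative:
  assumes "x \<noteq> 0"
  shows "((\<lambda>s. radial Q (x + s *\<^sub>R e, y)) has_real_derivative radial_grad P (x, y) \<bullet> (e, t)) (at 0)"
proof -
  have "0 < norm (x + 0 *\<^sub>R e)" using assms by simp
  from DERIV_chain2[OF profile_has_derivative[OF this] norm_line_has_derivative[OF assms]]
  show ?thesis unfolding radial_grad_inner by (simp add: radial_def)
qed

lemma radial_grad_line_derivative:
  assumes x: "x \<noteq> 0" and e: "e \<in> Basis"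
  shows "((\<lambda>s. radial_grad P (x + s *\<^sub>R e, y) \<bullet> (e, t)) has_real_derivative radial_second P R e (x, y)) (at 0)"
proof -
  let ?r = "norm x" and ?d = "(x \<bullet> e) / norm x"
  have nd: "((\<lambda>s. norm (x + s *\<^sub>R e)) has_real_derivative ?d) (at 0)"
    by (rule norm_line_has_derivative[OF x])
  have r: "0 < norm (x + 0 *\<^sub>R e)" using x by simp
  have pd: "((\<lambda>s. P (norm (x + s *\<^sub>R e))) has_real_derivative R ?r * ?d) (at 0)"
    using DERIV_chain2[OF profile_deriv_has_derivative[OF r] nd] by simp
  have "((\<lambda>s. P (norm (x + s *\<^sub>R e)) / norm (x + s *\<^sub>R e)) has_real_derivative
      (R ?r * ?d * ?r - P ?r * ?d) / (?r * ?r)) (at 0)"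
    using DERIV_divide[OF pd nd] x by simp
  moreover have "((\<lambda>s. (x + s *\<^sub>R e) \<bullet> e) has_real_derivative 1) (at 0)"
    using e by (auto intro!: derivative_eq_intros simp: inner_add_left)
  ultimately have "((\<lambda>s. P (norm (x + s *\<^sub>R e)) / norm (x + s *\<^sub>R e) * ((x + s *\<^sub>R e) \<bullet> e)) has_real_derivative
      (R ?r * ?d * ?r - P ?r * ?d) / (?r * ?r) * ((x + 0 *\<^sub>R e) \<bullet> e) + 1 * (P (norm (x + 0 *\<^sub>R e)) / norm (x + 0 *\<^sub>R e))) (at 0)"
    by (rule DERIV_mult)
  moreover have "(R ?r * ?d * ?r - P ?r * ?d) / (?r * ?r) * ((x + 0 *\<^sub>R e) \<bullet> e) + 1 * (P (norm (x + 0 *\<^sub>R e)) / norm (x + 0 *\<^sub>R e))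
      = radial_second P R e (x, y)"
    using x by (simp add: radial_second_def field_simps power2_eq_square)
  ultimately show ?thesis unfolding radial_grad_inner fst_conv by simp
qed

text \<open>In the \<open>x\<close>-directions this is integration by parts; in the
  \<open>y\<close>-direction both sides are 0, by periodicity of the test function and independence
  of \<open>y\<close>.\<close>

lemma radial_weak_gradient: "weak_gradient (radial Q) (radial_grad P)"
  unfolding weak_gradient_def
proof (intro conjI ballI allI impI)
  obtain B where B: "0 \<le> B"
    "\<And>x y. x \<noteq> 0 \<Longrightarrow> \<bar>radial Q (x, y)\<bar> \<le> B" "\<And>x y. x \<noteq> 0 \<Longrightarrow> norm x ^ 3 * \<bar>radial Q (x, y)\<bar> \<le> B"
    "\<And>x y e t. x \<noteq> 0 \<Longrightarrow> e \<in> Basis \<Longrightarrow> \<bar>radial_grad P (x, y) \<bullet> (e, t)\<bar> \<le> B"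
    "\<And>x y e t. x \<noteq> 0 \<Longrightarrow> e \<in> Basis \<Longrightarrow> norm x ^ 3 * \<bar>radial_grad P (x, y) \<bullet> (e, t)\<bar> \<le> B"
    by (rule radial_bounds) (rule that; assumption)
  fix b :: pt assume b: "b \<in> Basis"
  show "L2 (\<lambda>z. radial_grad P z \<bullet> b)"
    using b
  proof (cases rule: pt_Basis_cases)
    case (1 e)
    show ?thesis unfolding 1(2)
      by (rule L2_of_decay[where B=B]) (use B(4,5) 1(1) in \<open>simp_all\<close>)
  next
    case 2
    show ?thesis unfolding 2
      by (rule L2_of_decay[where B=0]) (simp_all add: radial_grad_inner)
  qed
  fix \<phi> assume \<phi>: "test_fun \<phi>"
  show "integral Omega (\<lambda>z. radial Q z * pd b \<phi> z) = - integral Omega (\<lambda>z. radial_grad P z \<bullet> b * \<phi> z)"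
    using b
  proof (cases rule: pt_Basis_cases)
    case (1 e)
    note ibp = integral_by_parts_x[OF \<phi> 1(1) radial_measurable radial_grad_measurable[of e 0] B(2) B(4)[OF _ 1(1)]
        radial_line_derivative]
    show ?thesis
      unfolding 1(2) using ibp(3) set_borel_integral_eq_integral(2)[OF ibp(1)] set_borel_integral_eq_integral(2)[OF ibp(2)]
      by simp
  next
    case 2
    have b1: "(0, 1) \<in> (Basis :: pt set)" by (simp add: Basis_prod_def)
    obtain K where K: "\<And>x y. K < norm x \<Longrightarrow> pd (0, 1) \<phi> (x, y) = 0"
      using test_fun_support[OF \<phi>] b1 by metis
    note cpd = test_fun_pd_continuous[OF \<phi> b1]
    have i: "set_integrable lborel Omega (\<lambda>z. radial Q z * pd (0, 1) \<phi> z)"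
      by (rule set_integrable_times_test[of "radial Q" B "pd (0, 1) \<phi>" K, OF radial_measurable B(2) cpd K])
    have "(LINT z:Omega|lborel. Q (norm (fst z)) * pd (0, 1) \<phi> z) = 0"
    proof (rule integral_y_derivative_eq_0[where a="\<lambda>x. Q (norm x)"])
      show "set_integrable lborel Omega (\<lambda>z. Q (norm (fst z)) * pd (0, 1) \<phi> z)"
        using i by (simp add: radial_def)
      show "((\<lambda>y. \<phi> (x, y)) has_real_derivative pd (0, 1) \<phi> (x, y)) (at y)" for x y
      proof -
        have "((\<lambda>s. \<phi> (x, s + y)) has_real_derivative pd (0, 1) \<phi> (x, y)) (at 0)"
          using test_fun_has_derivative[OF \<phi> b1, of "(x, y)"] by (simp add: add.commute)
        then show ?thesis using DERIV_shift[of "\<lambda>y. \<phi> (x, y)" "pd (0, 1) \<phi> (x, y)" 0 y] by simp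
      qed
      show "continuous_on UNIV (pd (0, 1) \<phi>)" by (rule cpd)
      have "\<forall>x y. \<phi> (x, y + 2*pi) = \<phi> (x, y)"
        using \<phi> unfolding test_fun_def periodic_y_def by blast
      then show "\<phi> (x, 2*pi) = \<phi> (x, 0)" for x by (metis add_0)
    qed
    then have "integral Omega (\<lambda>z. radial Q z * pd (0, 1) \<phi> z) = 0"
      using set_borel_integral_eq_integral(2)[OF i] by (simp add: radial_def)
    moreover have "radial_grad P z \<bullet> (0, 1) = 0" for z by (simp add: radial_grad_inner)
    ultimately show ?thesis unfolding 2 by simp
  qed
qed

lemma radial_H1: "H1 (radial Q)"
  unfolding H1_def
proof (intro conjI exI)
  show "periodic_y (radial Q)" by (simp add: periodic_y_def radial_def)
  obtain B where B:
    "\<And>x y. x \<noteq> 0 \<Longrightarrow> \<bar>radial Q (x, y)\<bar> \<le> B" "\<And>x y. x \<noteq> 0 \<Longrightarrow> norm x ^ 3 * \<bar>radial Q (x, y)\<bar> \<le> B"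
    by (rule radial_bounds) (rule that; assumption)
  show "L2 (radial Q)" by (rule L2_of_decay[OF radial_measurable B])
  show "weak_gradient (radial Q) (radial_grad P)" by (rule radial_weak_gradient)
qed

text \<open>Integrating each gradient component by parts once more produces the trace of the
  Hessian, that is the radial Laplacian. The equation then identifies the integrands off the axis,
  hence almost everywhere.\<close>

lemma radial_weak_solution:
  assumes f: "f \<in> borel_measurable borel" and fA: "\<And>x y. x \<noteq> 0 \<Longrightarrow> \<bar>f (x, y)\<bar> \<le> A"
    and eq: "\<And>x y. x \<noteq> 0 \<Longrightarrow> f (x, y) = lam * radial Q (x, y) - (R (norm x) + 2 * P (norm x) / norm x)"
  shows "weak_solution lam (radial Q) f"
  unfolding weak_solution_def
proof (intro exI[of _ "radial_grad P"] conjI allI impI)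
  show "weak_gradient (radial Q) (radial_grad P)" by (rule radial_weak_gradient)
  obtain B where B: "0 \<le> B"
    "\<And>x y. x \<noteq> 0 \<Longrightarrow> \<bar>radial Q (x, y)\<bar> \<le> B"
    "\<And>x y e t. x \<noteq> 0 \<Longrightarrow> e \<in> Basis \<Longrightarrow> \<bar>radial_grad P (x, y) \<bullet> (e, t)\<bar> \<le> B"
    "\<And>x y e. x \<noteq> 0 \<Longrightarrow> e \<in> Basis \<Longrightarrow> \<bar>radial_second P R e (x, y)\<bar> \<le> 2 * B"
    by (rule radial_bounds) (rule that; assumption)
  fix \<phi> assume \<phi>: "test_fun \<phi>"
  note c\<phi> = test_fun_continuous[OF \<phi>]
  obtain K where K: "\<And>x y. K < norm x \<Longrightarrow> \<phi> (x, y) = 0"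
    using test_fun_support[OF \<phi>] by metis
  have i1: "set_integrable lborel Omega (\<lambda>z. (radial_grad P z \<bullet> (e, 0)) * pd (e, 0) \<phi> z)"
    and i2: "set_integrable lborel Omega (\<lambda>z. radial_second P R e z * \<phi> z)"
    and ie: "(LINT z:Omega|lborel. (radial_grad P z \<bullet> (e, 0)) * pd (e, 0) \<phi> z) = - (LINT z:Omega|lborel. radial_second P R e z * \<phi> z)"
    if e: "e \<in> Basis" for e
  proof -
    have B3: "\<bar>radial_grad P (x, y) \<bullet> (e, 0)\<bar> \<le> 2 * B" if "x \<noteq> 0" for x y
      using B(3)[OF that e, of y 0] B(1) by linarith
    note ibp = integral_by_parts_x[OF \<phi> e radial_grad_measurable radial_second_measurable B3 B(4)[OF _ e]
        radial_grad_line_derivative[OF _ e]]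
    show "set_integrable lborel Omega (\<lambda>z. (radial_grad P z \<bullet> (e, 0)) * pd (e, 0) \<phi> z)"
      "set_integrable lborel Omega (\<lambda>z. radial_second P R e z * \<phi> z)"
      "(LINT z:Omega|lborel. (radial_grad P z \<bullet> (e, 0)) * pd (e, 0) \<phi> z) = - (LINT z:Omega|lborel. radial_second P R e z * \<phi> z)"
      using ibp by auto
  qed
  have iu: "set_integrable lborel Omega (\<lambda>z. lam * (radial Q z * \<phi> z))"
    by (intro set_integrable_mult_right set_integrable_times_test[of "radial Q" B \<phi> K, OF radial_measurable B(2) c\<phi> K])
  have if': "set_integrable lborel Omega (\<lambda>z. f z * \<phi> z)"
    by (rule set_integrable_times_test[of f A \<phi> K, OF f fA c\<phi> K])
  have grad_eq: "radial_grad P z \<bullet> grad \<phi> z = (\<Sum>e\<in>Basis. (radial_grad P z \<bullet> (e, 0)) * pd (e, 0) \<phi> z)" for z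
  proof -
    have "radial_grad P z \<bullet> grad \<phi> z = (\<Sum>b\<in>Basis. pd b \<phi> z * (radial_grad P z \<bullet> b))"
      by (simp add: grad_def inner_sum_right)
    also have "\<dots> = (\<Sum>e\<in>Basis. pd (e, 0) \<phi> z * (radial_grad P z \<bullet> (e, 0)))
        + pd (0, 1) \<phi> z * (radial_grad P z \<bullet> (0, 1))"
      by (rule sum_pt_Basis)
    finally show ?thesis by (simp add: radial_grad_inner mult.commute)
  qed
  have is1: "set_integrable lborel Omega (\<lambda>z. \<Sum>e\<in>Basis. (radial_grad P z \<bullet> (e, 0)) * pd (e, 0) \<phi> z)"
    by (intro set_integral_finite_sum(1) i1) auto
  have is2: "set_integrable lborel Omega (\<lambda>z. \<Sum>e\<in>Basis. radial_second P R e z * \<phi> z)"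
    by (intro set_integral_finite_sum(1) i2) auto
  have l1: "(LINT z:Omega|lborel. \<Sum>e\<in>Basis. (radial_grad P z \<bullet> (e, 0)) * pd (e, 0) \<phi> z)
      = - (LINT z:Omega|lborel. \<Sum>e\<in>Basis. radial_second P R e z * \<phi> z)"
    using i1 i2 ie by (simp add: set_integral_finite_sum(2) sum_negf)
  have lhs: "integral Omega (\<lambda>z. radial_grad P z \<bullet> grad \<phi> z + lam * radial Q z * \<phi> z)
      = (LINT z:Omega|lborel. lam * (radial Q z * \<phi> z)) - (LINT z:Omega|lborel. \<Sum>e\<in>Basis. radial_second P R e z * \<phi> z)"
    using set_borel_integral_eq_integral(2)[OF set_integral_add(1)[OF is1 iu]] set_integral_add(2)[OF is1 iu] l1
    by (simp add: grad_eq mult.assoc)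
  have "(LINT z:Omega|lborel. lam * (radial Q z * \<phi> z)) - (LINT z:Omega|lborel. \<Sum>e\<in>Basis. radial_second P R e z * \<phi> z)
      = (LINT z:Omega|lborel. lam * (radial Q z * \<phi> z) - (\<Sum>e\<in>Basis. radial_second P R e z * \<phi> z))"
    by (rule set_integral_diff(2)[OF iu is2, symmetric])
  also have "\<dots> = (LINT z:Omega|lborel. f z * \<phi> z)"
    unfolding set_lebesgue_integral_def
  proof (rule integral_cong_AE)
    obtain e where e: "e \<in> (Basis :: (real^3) set)" using nonempty_Basis by blast
    have "AE z :: pt in lborel. z \<bullet> (e, 0) \<noteq> 0"
      by (rule AE_lborel_inner_neq_0) (use e in \<open>simp add: Basis_prod_def\<close>)
    then show "AE z in lborel. indicator Omega z *\<^sub>R (lam * (radial Q z * \<phi> z) - (\<Sum>e\<in>Basis. radial_second P R e z * \<phi> z))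
        = indicator Omega z *\<^sub>R (f z * \<phi> z)"
    proof (rule AE_mp, intro AE_I2 impI)
      fix z :: pt assume z0: "z \<bullet> (e, 0) \<noteq> 0"
      obtain x y where z: "z = (x, y)" by (cases z)
      have x0: "x \<noteq> 0" using z0 z by auto
      have "lam * (radial Q z * \<phi> z) - (\<Sum>e\<in>Basis. radial_second P R e z * \<phi> z) = f z * \<phi> z"
        unfolding z eq[OF x0] sum_distrib_right[symmetric] sum_radial_second[OF x0] by (simp add: algebra_simps)
      then show "indicator Omega z *\<^sub>R (lam * (radial Q z * \<phi> z) - (\<Sum>e\<in>Basis. radial_second P R e z * \<phi> z))
        = indicator Omega z *\<^sub>R (f z * \<phi> z)" by simp
    qed
    show "(\<lambda>z. indicator Omega z *\<^sub>R (lam * (radial Q z * \<phi> z) - (\<Sum>e\<in>Basis. radial_second P R e z * \<phi> z))) \<in> borel_measurable lborel"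
      using set_integral_diff(1)[OF iu is2] unfolding set_integrable_def by (rule borel_measurable_integrable)
    show "(\<lambda>z. indicator Omega z *\<^sub>R (f z * \<phi> z)) \<in> borel_measurable lborel"
      using if' unfolding set_integrable_def by (rule borel_measurable_integrable)
  qed
  also have "\<dots> = integral Omega (\<lambda>z. f z * \<phi> z)"
    by (rule set_borel_integral_eq_integral(2)[OF if'])
  finally show "integral Omega (\<lambda>z. radial_grad P z \<bullet> grad \<phi> z + lam * radial Q z * \<phi> z) = integral Omega (\<lambda>z. f z * \<phi> z)"
    using lhs by simp
qed

lemma radial_square_integrable: "set_integrable lborel Omega (\<lambda>z. (radial Q z)\<^sup>2)"
proof -
  obtain B where B:
    "\<And>x y. x \<noteq> 0 \<Longrightarrow> \<bar>radial Q (x, y)\<bar> \<le> B" "\<And>x y. x \<noteq> 0 \<Longrightarrow> norm x ^ 3 * \<bar>radial Q (x, y)\<bar> \<le> B"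
    by (rule radial_bounds) (rule that; assumption)
  show ?thesis by (rule set_integrable_decay_square[OF radial_measurable B])
qed

lemma radial_pos: "0 < radial Q z"
  using prof by (simp add: radial_def radial_profile_def)

end

section \<open>Dilation in \<open>x\<close> and positivity of the mass\<close>

lemma integral_Omega_dilation:
  assumes [measurable]: "f \<in> borel_measurable borel" and \<kappa>: "0 < \<kappa>"
  shows "(LINT z:Omega|lborel. f (\<kappa> *\<^sub>R fst z, snd z)) = (LINT z:Omega|lborel. f z) / \<kappa> ^ 3"
proof -
  \<comment> \<open>Only the three \<open>x\<close>-directions are stretched: the period in
    \<open>y\<close> and hence \<open>Omega\<close> are preserved, and the Jacobian is
    \<open>\<kappa>^3\<close>.\<close>
  define c where "c = (\<lambda>b::pt. if b = (0, 1) then 1 else \<kappa>)"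
  define T where "T = (\<lambda>z::pt. (\<kappa> *\<^sub>R fst z, snd z))"
  have T: "0 + (\<Sum>j\<in>Basis. (c j * (z \<bullet> j)) *\<^sub>R j) = T z" for z
  proof (rule euclidean_eqI)
    fix b :: pt assume b: "b \<in> Basis"
    then have "(0 + (\<Sum>j\<in>Basis. (c j * (z \<bullet> j)) *\<^sub>R j)) \<bullet> b = c b * (z \<bullet> b)"
      by (simp add: inner_sum_left inner_Basis if_distrib cong: if_cong)
    also have "\<dots> = T z \<bullet> b"
      using b by (cases rule: pt_Basis_cases) (auto simp: c_def T_def inner_prod_def)
    finally show "(0 + (\<Sum>j\<in>Basis. (c j * (z \<bullet> j)) *\<^sub>R j)) \<bullet> b = T z \<bullet> b" .
  qed
  have pc: "(\<Prod>j\<in>Basis. \<bar>c j\<bar>) = \<kappa> ^ 3"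
  proof -
    have "(\<Prod>j\<in>Basis. \<bar>c j\<bar>) = (\<Prod>j\<in>(\<lambda>e. (e, 0)) ` Basis. \<bar>c j\<bar>) * (\<Prod>j\<in>{(0, 1)}. \<bar>c j\<bar>)"
      unfolding Basis_prod_def by (subst prod.union_disjoint) auto
    also have "(\<Prod>j\<in>(\<lambda>e. (e, 0)) ` Basis. \<bar>c j\<bar>) = (\<Prod>e\<in>(Basis :: (real^3) set). \<bar>c (e, 0)\<bar>)"
      by (subst prod.reindex) (auto simp: inj_on_def)
    finally show ?thesis using \<kappa> by (simp add: c_def)
  qed
  have Tm [measurable]: "T \<in> borel \<rightarrow>\<^sub>M borel"
    unfolding T_def by (intro borel_measurable_continuous_onI continuous_intros)
  have lb: "(lborel :: pt measure) = density (distr lborel borel T) (\<lambda>_. ennreal (\<kappa> ^ 3))"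
    using lborel_affine_euclidean[of c 0] \<kappa> unfolding T pc by (simp add: c_def)
  let ?g = "\<lambda>z. indicator Omega z *\<^sub>R f z"
  have "(LINT z|lborel. ?g z) = (LINT z|density (distr lborel borel T) (\<lambda>_. ennreal (\<kappa> ^ 3)). ?g z)"
    using lb by simp
  also have "\<dots> = (LINT z|distr lborel borel T. \<kappa> ^ 3 *\<^sub>R ?g z)"
    using \<kappa> by (intro integral_density) auto
  also have "\<dots> = (LINT z|lborel. \<kappa> ^ 3 *\<^sub>R ?g (T z))"
    by (intro integral_distr) auto
  also have "\<dots> = \<kappa> ^ 3 * (LINT z|lborel. ?g (T z))" by simp
  also have "(\<lambda>z. ?g (T z)) = (\<lambda>z. indicator Omega z *\<^sub>R f (\<kappa> *\<^sub>R fst z, snd z))"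
    by (auto simp: T_def Omega_def indicator_def)
  finally show ?thesis using \<kappa> by (simp add: set_lebesgue_integral_def)
qed

lemma integral_Omega_pos:
  fixes f :: "pt \<Rightarrow> real"
  assumes int: "set_integrable lborel Omega f" and pos: "\<And>z. 0 < f z"
  shows "0 < (LINT z:Omega|lborel. f z)"
proof (rule ccontr)
  assume neg: "\<not> 0 < (LINT z:Omega|lborel. f z)"
  have int': "integrable lborel (\<lambda>z. indicator Omega z *\<^sub>R f z)" using int by (simp add: set_integrable_def)
  have nn: "AE z in lborel. 0 \<le> indicator Omega z *\<^sub>R f z" by (intro AE_I2 scaleR_nonneg_nonneg) (simp_all add: pos less_imp_le)
  have "(LINT z|lborel. indicator Omega z *\<^sub>R f z) = 0"
    using neg integral_nonneg_AE[OF nn] by (simp add: set_lebesgue_integral_def)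
  then have ae: "AE z in lborel. indicator Omega z *\<^sub>R f z = 0"
    using integral_nonneg_eq_0_iff_AE[OF int' nn] by simp
  have "AE z in lborel. z \<notin> Omega"
    using ae
  proof (rule AE_mp, intro AE_I2 impI)
    fix z assume "indicator Omega z *\<^sub>R f z = 0"
    then show "z \<notin> Omega" using pos[of z] by (auto simp: indicator_def)
  qed
  then have "emeasure lborel Omega = 0" by (subst (asm) AE_iff_measurable[of Omega]) auto
  \<comment> \<open>The open unit cube lies in \<open>Omega\<close> because \<open>1 < 2*pi\<close>,
    and it has positive measure.\<close>
  moreover define p q :: pt where "p = ((\<chi> i. 0), 0)" and "q = ((\<chi> i. 1), 1)"
  have "box p q \<subseteq> Omega"
  proof
    fix z :: pt assume "z \<in> box p q"
    then have "0 < snd z" "snd z < 1" unfolding p_def q_def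
      by (auto simp: box_def Basis_prod_def inner_prod_def)
    moreover have "1 < 2 * pi" using pi_gt3 by simp
    ultimately show "z \<in> Omega" by (cases z) (simp add: Omega_def)
  qed
  ultimately have z: "emeasure lborel (box p q) = 0"
    using emeasure_mono[of "box p q" Omega lborel] by simp
  have pq: "p \<bullet> b < q \<bullet> b" if "b \<in> Basis" for b
    using that by (auto simp: p_def q_def Basis_prod_def Basis_vec_def inner_axis)
  then have "0 < (\<Prod>b\<in>Basis. (q - p) \<bullet> b)"
    by (intro prod_pos) (simp add: inner_diff_left)
  moreover have "emeasure lborel (box p q) = ennreal (\<Prod>b\<in>Basis. (q - p) \<bullet> b)"
    by (rule emeasure_lborel_box) (simp add: pq less_imp_le)
  ultimately show False using z by (metis ennreal_eq_0_iff not_le)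
qed

theorem theorem1p1:
  fixes \<Theta> :: real
  assumes "\<Theta> > 0"
  shows "\<exists>(l1::real) (l2::real) (u::pt \<Rightarrow> real) (v::pt \<Rightarrow> real).
    l1 * l2 \<ge> 0 \<and> l1 + l2 > 0 \<and>
    H1 u \<and> H1 v \<and> (\<forall>z. u z > 0) \<and> (\<forall>z. v z > 0) \<and>
    weak_solution l1 u (\<lambda>z. \<bar>u z\<bar>^2 * u z + u z * \<bar>v z\<bar>^2) \<and>
    weak_solution l2 v (\<lambda>z. \<bar>v z\<bar>^2 * v z + v z * \<bar>u z\<bar>^2) \<and>
    integral Omega (\<lambda>z. (u z)^2) = \<Theta>^2 \<and>
    integral Omega (\<lambda>z. (v z)^2) = \<Theta>^2"
proof -
  obtain Q P R where prof: "radial_profile Q P R"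
    and eq: "\<And>r. 0 < r \<Longrightarrow> R r + 2 * P r / r = Q r - (Q r) ^ 3"
    using ground_state_profile by metis
  define m where "m = (LINT z:Omega|lborel. (radial Q z)\<^sup>2)"
  have m: "0 < m"
    unfolding m_def using radial_pos[OF prof]
    by (intro integral_Omega_pos radial_square_integrable[OF prof] zero_less_power)
  \<comment> \<open>The mass of \<open>u\<close> comes out as
    \<open>a^2 * m / \<kappa>^3 = m / (2 \<kappa>)\<close>; this value of \<open>\<kappa>\<close>
    makes it \<open>\<Theta>^2\<close>.\<close>
  define \<kappa> where "\<kappa> = m / (2 * \<Theta>\<^sup>2)"
  \<comment> \<open>With \<open>u = v\<close> the two nonlinear terms add up to
    \<open>2 u^3\<close>, so the scaled profile must satisfy
    \<open>2 a^2 = \<kappa>^2\<close>.\<close>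
  define a where "a = \<kappa> / sqrt 2"
  have \<kappa>: "0 < \<kappa>" using m assms by (simp add: \<kappa>_def)
  have a: "0 < a" "a\<^sup>2 = \<kappa>\<^sup>2 / 2" using \<kappa> by (simp_all add: a_def power_divide)
  define Q' P' R' where "Q' = (\<lambda>r. a * Q (\<kappa> * r))" and "P' = (\<lambda>r. a * \<kappa> * P (\<kappa> * r))"
    and "R' = (\<lambda>r. a * \<kappa>\<^sup>2 * R (\<kappa> * r))"
  have prof': "radial_profile Q' P' R'"
    unfolding Q'_def P'_def R'_def by (rule radial_profile_scale[OF prof a(1) \<kappa>])
  have eq': "R' r + 2 * P' r / r = \<kappa>\<^sup>2 * Q' r - 2 * (Q' r) ^ 3" if r: "0 < r" for r
  proof -
    have "R' r + 2 * P' r / r = a * \<kappa>\<^sup>2 * (R (\<kappa> * r) + 2 * P (\<kappa> * r) / (\<kappa> * r))"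
      using \<kappa> r by (simp add: R'_def P'_def power2_eq_square field_simps)
    also have "\<dots> = a * \<kappa>\<^sup>2 * (Q (\<kappa> * r) - (Q (\<kappa> * r)) ^ 3)"
      using eq[of "\<kappa> * r"] \<kappa> r by simp
    also have "\<dots> = \<kappa>\<^sup>2 * Q' r - 2 * (a * a\<^sup>2 * (Q (\<kappa> * r)) ^ 3)"
      unfolding a(2) by (simp add: Q'_def algebra_simps)
    also have "a * a\<^sup>2 * (Q (\<kappa> * r)) ^ 3 = (Q' r) ^ 3"
      by (simp add: Q'_def power_mult_distrib power2_eq_square power3_eq_cube)
    finally show ?thesis .
  qed
  define u where "u = radial Q'"
  have um [measurable]: "u \<in> borel_measurable borel" unfolding u_def by (rule radial_measurable[OF prof'])
  obtain B where B: "\<And>x y. x \<noteq> 0 \<Longrightarrow> \<bar>radial Q' (x, y)\<bar> \<le> B"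
    by (rule radial_bounds[OF prof']) (rule that; assumption)
  have sol: "weak_solution (\<kappa>\<^sup>2) u (\<lambda>z. \<bar>u z\<bar>^2 * u z + u z * \<bar>u z\<bar>^2)"
  proof (rule radial_weak_solution[OF prof', folded u_def])
    show "(\<lambda>z. \<bar>u z\<bar>^2 * u z + u z * \<bar>u z\<bar>^2) \<in> borel_measurable borel" by measurable
    fix x :: "real^3" and y :: real assume x: "x \<noteq> 0"
    have cube: "\<bar>u (x, y)\<bar>^2 * u (x, y) + u (x, y) * \<bar>u (x, y)\<bar>^2 = 2 * (u (x, y)) ^ 3"
      by (simp add: power2_eq_square power3_eq_cube)
    have "\<bar>u (x, y)\<bar> ^ 3 \<le> B ^ 3" by (intro power_mono B[OF x, folded u_def]) simp
    then show "\<bar>\<bar>u (x, y)\<bar>^2 * u (x, y) + u (x, y) * \<bar>u (x, y)\<bar>^2\<bar> \<le> 2 * B ^ 3"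
      unfolding cube by (simp add: abs_mult power_abs)
    show "\<bar>u (x, y)\<bar>^2 * u (x, y) + u (x, y) * \<bar>u (x, y)\<bar>^2
        = \<kappa>\<^sup>2 * u (x, y) - (R' (norm x) + 2 * P' (norm x) / norm x)"
      unfolding cube using eq'[of "norm x"] x by (simp add: u_def radial_def)
  qed
  have mass: "integral Omega (\<lambda>z. (u z)\<^sup>2) = \<Theta>\<^sup>2"
  proof -
    have um2: "(\<lambda>z. (radial Q z)\<^sup>2) \<in> borel_measurable borel"
      by (intro borel_measurable_power radial_measurable[OF prof])
    have "integral Omega (\<lambda>z. (u z)\<^sup>2) = (LINT z:Omega|lborel. (u z)\<^sup>2)"
      using set_borel_integral_eq_integral(2)[OF radial_square_integrable[OF prof']] by (simp add: u_def)
    also have "\<dots> = (LINT z:Omega|lborel. a\<^sup>2 * (radial Q (\<kappa> *\<^sub>R fst z, snd z))\<^sup>2)"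
      using \<kappa> by (simp add: u_def radial_def Q'_def power_mult_distrib)
    also have "\<dots> = a\<^sup>2 * (LINT z:Omega|lborel. (radial Q (\<kappa> *\<^sub>R fst z, snd z))\<^sup>2)"
      by (rule set_integral_mult_right)
    also have "\<dots> = a\<^sup>2 * (m / \<kappa> ^ 3)"
      using integral_Omega_dilation[OF um2 \<kappa>] by (simp add: m_def)
    also have "\<dots> = m / (2 * \<kappa>)" unfolding a(2) using \<kappa> by (simp add: power2_eq_square power3_eq_cube)
    also have "\<dots> = \<Theta>\<^sup>2" using m assms by (simp add: \<kappa>_def)
    finally show ?thesis .
  qed
  have H1: "H1 u" unfolding u_def by (rule radial_H1[OF prof'])
  have pos: "\<forall>z. 0 < u z" unfolding u_def using radial_pos[OF prof'] by blast
  have "0 \<le> \<kappa>\<^sup>2 * \<kappa>\<^sup>2" "0 < \<kappa>\<^sup>2 + \<kappa>\<^sup>2" using \<kappa> by (simp_all add: add_pos_pos)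
  then show ?thesis using H1 pos sol mass by (intro exI conjI)
qed

end
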